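(* Let $\lambda$ be a deformation of a Courant pair $(A,L)$ with base a finite dimensional local algebra $(R,\mathcal{M}_R)$, and let $[\psi]\in H^2_{Harr}(R,\mathbb{K})$ correspond to a one-dimensional extension $0\to\mathbb{K}\xrightarrow{i}S\xrightarrow{p}R\to0$ of the $\mathbb{K}$-algebra $R$. Then $\lambda$ extends to a deformation of $(A,L)$ with base $(S,\mathcal{M}_S)$ (i.e. there is a deformation $\lambda'$ with base $(S,\mathcal{M}_S)$ such that $p_*\lambda'=\lambda$) if and only if $\Theta_\lambda([\psi])=0$ in $H^3_{CP}(A,L)$, where $\Theta_\lambda:H^2_{Harr}(R,\mathbb{K})\to H^3_{CP}(A,L)$ is the obstruction map.
   Context: $\mathbb{K}$ is a field of characteristic $0$; all maps are $\mathbb{K}$-linear unless stated otherwise. A (left) Leibniz algebra is a vector space $L$ with a bilinear bracket satisfying $[x,[y,z]]=[[x,y],z]+[y,[x,z]]$. A Courant pair $(A,L)$ consists of an associative algebra $A$, a Leibniz algebra $L$ and a Leibniz algebra homomorphism $\mu:L\to \mathrm{Der}_{\mathbb K}(A)$ (derivations with commutator bracket). The same notion is used over a commutative unital $\mathbb{K}$-algebra $R$, with all structure maps $R$-(bi)linear. A homomorphism of Courant pairs $(A,L)\to(A_1,L_1)$ is a pair $(f,g)$, with $f:A\to A_1$ an algebra homomorphism and $g:L\to L_1$ a Leibniz homomorphism, such that $f(\mu(x)(a))=\mu_1(g(x))(f(a))$. Cohomology of $(A,L)$. Put $C^{0,q}=\mathrm{Hom}(L^{\otimes q},L)$ and, for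 $p>0$, $C^{p,q}=\mathrm{Hom}(L^{\otimes q},\mathrm{Hom}(A^{\otimes p},A))\cong \mathrm{Hom}(L^{\otimes q}\otimes A^{\otimes p},A)$, $q\ge 0$. Vertical maps $C^{p,q}\to C^{p+1,q}$, all denoted $\delta_H$: for $p>0$, apply to the values in $\mathrm{Hom}(A^{\otimes p},A)$ the Hochschild coboundary $\delta_Hf(a_1,\dots,a_{p+1})=a_1f(a_2,\dots,a_{p+1})+\sum_{i=1}^{p}(-1)^if(a_1,\dots,a_ia_{i+1},\dots,a_{p+1})+(-1)^{p+1}f(a_1,\dots,a_p)a_{p+1}$; for $p=0$, $(\delta_H f)(x_1,\dots,x_q)(a)=\mu(f(x_1,\dots,x_q))(a)$. Horizontal maps $\delta_L:C^{p,q}\to C^{p,q+1}$: the Leibniz coboundary $$(\delta_L\psi)(x_1,\dots,x_{q+1})=(-1)^{q+1}\Big(\sum_{i=1}^{q}(-1)^{i-1}[x_i,\psi(x_1,\dots,\hat{x_i},\dots,x_{q+1})]+(-1)^{q+1}[\psi(x_1,\dots,x_q),x_{q+1}]+\sum_{1\le i<j\le q+1}(-1)^i\psi(x_1,\dots,\hat{x_i},\dots,x_{j-1},[x_i,x_j],x_{j+1},\dots,x_{q+1})\Big),$$ where for $p=0$ the brackets with values are those of $L$, and for $p>0$, $[x,f](a_1,\dots,a_p)=\mu(x)(f(a_1,\dots,a_p))-\sum_i f(a_1,\dots,\mu(x)(a_i),\dots,a_p)$ and $[f,x]=-[x,f]$. Put $C^n_{tot}(A,L)=\bigoplus_{p+q=n}C^{p,q}$,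 with $\delta_{tot}$ equal to $\delta_H+(-1)^p\delta_L$ on $C^{p,q}$; its cohomology is $H^*_{CP}(A,L)$. In particular $C^2_{tot}=\mathrm{Hom}(A^{\otimes 2},A)\oplus\mathrm{Hom}(L\otimes A,A)\oplus\mathrm{Hom}(L^{\otimes 2},L)$ and $C^3_{tot}=\mathrm{Hom}(A^{\otimes 3},A)\oplus\mathrm{Hom}(L\otimes A^{\otimes 2},A)\oplus\mathrm{Hom}(L^{\otimes 2}\otimes A,A)\oplus\mathrm{Hom}(L^{\otimes 3},L)$. Deformations. Let $R$ be a commutative unital $\mathbb{K}$-algebra with an augmentation $\epsilon:R\to\mathbb{K}$ (an algebra homomorphism, $\epsilon(1)=1$) and $\mathcal{M}=\ker\epsilon$. A deformation $\lambda$ of $(A,L)$ with base $(R,\mathcal{M})$ is a Courant pair structure over $R$ on $(R\otimes A,R\otimes L)$, given by a triplet $(\cdot_\lambda,\mu_\lambda,[-,-]_\lambda)$ of an $R$-bilinear associative product, an $R$-Leibniz homomorphism $\mu_\lambda:R\otimes L\to\mathrm{Der}_R(R\otimes A)$, and an $R$-bilinear Leibniz bracket, such that $(\epsilon\otimes\mathrm{id}_A,\epsilon\otimes\mathrm{id}_L):(R\otimes A,R\otimes L)\to(A,L)$ is a homomorphism of Courant pairs. If $R$ is local, $\mathcal{M}=\mathcal{M}_R$ is its maximal ideal. For a unital algebra homomorphism $\phi:R\to R_1$ compatible with augmentations, the push-out $\phi_*\lambda$ is the deformation with base $R_1$ obtained from $\lambda$ by extension of scalars along $\phi$ (using $R_1\otimes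 A=R_1\otimes_R(R\otimes A)$, $R_1\otimes L=R_1\otimes_R(R\otimes L)$). Extensions. An extension of $R$ by an $R$-module $M$ is an exact sequence $0\to M\xrightarrow{i}S\xrightarrow{p}R\to0$ with $S$ a commutative unital $\mathbb{K}$-algebra, $p$ an algebra homomorphism and $s\cdot i(m)=i(p(s)m)$. Equivalence classes of such extensions correspond bijectively to the second Harrison cohomology $H^2_{Harr}(R,M)$: choosing a linear section $q$ of $p$, write $(r,m)_q=q(r)+i(m)$; the product of $S$ is $(r_1,m_1)_q(r_2,m_2)_q=(r_1r_2,r_1m_2+r_2m_1+\psi(r_1,r_2))_q$ with $\psi$ a Harrison 2-cocycle. Here $M=\mathbb{K}$ is an $R$-module via $\epsilon$; $S$ is local with maximal ideal $\mathcal{M}_S=p^{-1}(\mathcal{M}_R)$ and augmentation $\epsilon\circ p$. Obstruction map. Let $\lambda$ be a deformation with finite dimensional local base $(R,\mathcal{M}_R)$, $\{m_i\}_{1\le i\le n}$ a basis of $\mathcal{M}_R$, and write $(1\otimes a)\cdot_\lambda(1\otimes b)=1\otimes ab+\sum_{i=1}^n m_i\otimes\psi^1_i(a,b)$, $\mu_\lambda(1\otimes x)(1\otimes a)=1\otimes\mu(x)(a)+\sum_{i=1}^n m_i\otimes\psi^2_i(x,a)$, $[1\otimes x,1\otimes y]_\lambda=1\otimes[x,y]+\sum_{i=1}^n m_i\otimes\psi^3_i(x,y)$. Put $n_i=(m_i,0)_q$ for $1\le i\le n$ and $n_{n+1}=(0,1)_q$, a basis of $\mathcal{M}_S$. Choose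 any $(\psi^1_{n+1},\psi^2_{n+1},\psi^3_{n+1})\in C^2_{tot}(A,L)$ and define $S$-bilinear maps by $(s_1\otimes a)\cdot_s(s_2\otimes b)=s_1s_2\otimes ab+\sum_{i=1}^{n+1}s_1s_2n_i\otimes\psi^1_i(a,b)$, $\mu_s(s_1\otimes x)(s_2\otimes a)=s_1s_2\otimes\mu(x)(a)+\sum_{i=1}^{n+1}s_1s_2n_i\otimes\psi^2_i(x,a)$, $[s_1\otimes x,s_2\otimes y]_s=s_1s_2\otimes[x,y]+\sum_{i=1}^{n+1}s_1s_2n_i\otimes\psi^3_i(x,y)$. Identify $a\in A$, $x\in L$ with $1\otimes a$, $1\otimes x$. There are unique linear maps $\theta_A:A^{\otimes3}\to A$, $\theta_1:L\otimes A^{\otimes2}\to A$, $\theta_2:L^{\otimes2}\otimes A\to A$, $\theta_L:L^{\otimes3}\to L$ with $n_{n+1}\otimes\theta_A(a,b,c)=a\cdot_s(b\cdot_sc)-(a\cdot_sb)\cdot_sc$, $n_{n+1}\otimes\theta_1(x,a,b)=-\big(\mu_s(x)(a\cdot_sb)-\mu_s(x)(a)\cdot_sb-a\cdot_s\mu_s(x)(b)\big)$, $n_{n+1}\otimes\theta_2(x,y,a)=\mu_s([x,y]_s)(a)-\mu_s(x)(\mu_s(y)(a))+\mu_s(y)(\mu_s(x)(a))$, $n_{n+1}\otimes\theta_L(x,y,z)=-\big([x,[y,z]_s]_s-[[x,y]_s,z]_s-[y,[x,z]_s]_s\big)$. The cochain $\Theta=(\theta_A,\theta_1,\theta_2,\theta_L)\in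 C^3_{tot}(A,L)$ is a cocycle whose class does not depend on the choices, and $\Theta_\lambda([\psi]):=[\Theta]$. *)

theory Defs
  imports
    Complex_Main
    "HOL-Library.Function_Algebras"
    "HOL-Library.Product_Plus"
begin

section \<open>Algebras, modules and ideals\<close>

text \<open>
  Vector spaces over the field \<open>'k\<close> are types of class \<open>ab_group_add\<close> with an explicit scalar
  multiplication. The multiplication of an algebra is explicit as well, because the same vector
  space carries several products (e.g. all extensions of \<open>R\<close> by \<open>\<bbbK>\<close> live on \<open>R \<oplus> \<bbbK>\<close>).
\<close>

record ('k, 'r) ualg =
  smul :: "'k \<Rightarrow> 'r \<Rightarrow> 'r"
  amul :: "'r \<Rightarrow> 'r \<Rightarrow> 'r"
  aunit :: 'r

definition base_field :: "('k::field, 'k) ualg" where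
  "base_field = \<lparr> smul = (*), amul = (*), aunit = 1 \<rparr>"

definition bilin ::
  "('k::field \<Rightarrow> 'u::ab_group_add \<Rightarrow> 'u) \<Rightarrow> ('k \<Rightarrow> 'v::ab_group_add \<Rightarrow> 'v) \<Rightarrow>
   ('k \<Rightarrow> 'w::ab_group_add \<Rightarrow> 'w) \<Rightarrow> ('u \<Rightarrow> 'v \<Rightarrow> 'w) \<Rightarrow> bool" where
  "bilin sU sV sW f \<longleftrightarrow>
     (\<forall>v. Vector_Spaces.linear sU sW (\<lambda>u. f u v)) \<and> (\<forall>u. Vector_Spaces.linear sV sW (f u))"

definition comm_alg :: "('k::field, 'r::ab_group_add) ualg \<Rightarrow> bool" where
  "comm_alg R \<longleftrightarrow>
     vector_space (smul R) \<and> bilin (smul R) (smul R) (smul R) (amul R) \<and>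
     (\<forall>r s t. amul R (amul R r s) t = amul R r (amul R s t)) \<and>
     (\<forall>r s. amul R r s = amul R s r) \<and>
     (\<forall>r. amul R (aunit R) r = r)"

definition alg_hom ::
  "('k::field, 'r::ab_group_add) ualg \<Rightarrow> ('k, 's::ab_group_add) ualg \<Rightarrow> ('r \<Rightarrow> 's) \<Rightarrow> bool" where
  "alg_hom R S \<phi> \<longleftrightarrow>
     Vector_Spaces.linear (smul R) (smul S) \<phi> \<and>
     (\<forall>r s. \<phi> (amul R r s) = amul S (\<phi> r) (\<phi> s)) \<and> \<phi> (aunit R) = aunit S"

definition augmentation :: "('k::field, 'r::ab_group_add) ualg \<Rightarrow> ('r \<Rightarrow> 'k) \<Rightarrow> bool" where
  "augmentation R \<epsilon> \<longleftrightarrow> alg_hom R base_field \<epsilon>"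

definition ring_ideal :: "('k, 'r::ab_group_add) ualg \<Rightarrow> 'r set \<Rightarrow> bool" where
  "ring_ideal R I \<longleftrightarrow> 0 \<in> I \<and> (\<forall>x\<in>I. \<forall>y\<in>I. x + y \<in> I) \<and> (\<forall>r. \<forall>x\<in>I. amul R r x \<in> I)"

definition maximal_ideal :: "('k, 'r::ab_group_add) ualg \<Rightarrow> 'r set \<Rightarrow> bool" where
  "maximal_ideal R I \<longleftrightarrow>
     ring_ideal R I \<and> I \<noteq> UNIV \<and> (\<forall>J. ring_ideal R J \<and> I \<subseteq> J \<longrightarrow> J = I \<or> J = UNIV)"

definition local_alg :: "('k::field, 'r::ab_group_add) ualg \<Rightarrow> bool" where
  "local_alg R \<longleftrightarrow> comm_alg R \<and> (\<exists>!I. maximal_ideal R I)"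

text \<open>
  The kernel of an augmentation is a maximal ideal, so for local \<open>R\<close> it is \<open>\<M>\<^sub>R\<close>.
\<close>

definition aug_ideal :: "('r \<Rightarrow> 'k::field) \<Rightarrow> 'r set" where
  "aug_ideal \<epsilon> = {r. \<epsilon> r = 0}"

definition fd_local_base :: "('k::field, 'r::ab_group_add) ualg \<Rightarrow> ('r \<Rightarrow> 'k) \<Rightarrow> bool" where
  "fd_local_base R \<epsilon> \<longleftrightarrow>
     local_alg R \<and> augmentation R \<epsilon> \<and> (\<exists>B. finite_dimensional_vector_space (smul R) B)"

text \<open>
  Modules over an algebra \<open>R\<close>, with a carrier set: the modules \<open>R \<otimes> A\<close> and \<open>R \<otimes> L\<close> below are
  proper subsets of their ambient types.
\<close>

definition module_on ::
  "('k, 'r::ab_group_add) ualg \<Rightarrow> ('r \<Rightarrow> 'm::ab_group_add \<Rightarrow> 'm) \<Rightarrow> 'm set \<Rightarrow> bool" where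
  "module_on R act M \<longleftrightarrow>
     0 \<in> M \<and> (\<forall>x\<in>M. \<forall>y\<in>M. x + y \<in> M) \<and> (\<forall>x\<in>M. - x \<in> M) \<and> (\<forall>r. \<forall>x\<in>M. act r x \<in> M) \<and>
     (\<forall>r. \<forall>x\<in>M. \<forall>y\<in>M. act r (x + y) = act r x + act r y) \<and>
     (\<forall>r s. \<forall>x\<in>M. act (r + s) x = act r x + act s x) \<and>
     (\<forall>r s. \<forall>x\<in>M. act (amul R r s) x = act r (act s x)) \<and>
     (\<forall>x\<in>M. act (aunit R) x = x)"

definition linear_on ::
  "('r \<Rightarrow> 'm::ab_group_add \<Rightarrow> 'm) \<Rightarrow> 'm set \<Rightarrow> ('r \<Rightarrow> 'n::ab_group_add \<Rightarrow> 'n) \<Rightarrow> 'n set \<Rightarrow>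
   ('m \<Rightarrow> 'n) \<Rightarrow> bool" where
  "linear_on actM M actN N f \<longleftrightarrow>
     (\<forall>x\<in>M. f x \<in> N) \<and> (\<forall>x\<in>M. \<forall>y\<in>M. f (x + y) = f x + f y) \<and>
     (\<forall>r. \<forall>x\<in>M. f (actM r x) = actN r (f x))"

definition bilinear_on ::
  "('r \<Rightarrow> 'm::ab_group_add \<Rightarrow> 'm) \<Rightarrow> 'm set \<Rightarrow> ('r \<Rightarrow> 'n::ab_group_add \<Rightarrow> 'n) \<Rightarrow> 'n set \<Rightarrow>
   ('r \<Rightarrow> 'p::ab_group_add \<Rightarrow> 'p) \<Rightarrow> 'p set \<Rightarrow> ('m \<Rightarrow> 'n \<Rightarrow> 'p) \<Rightarrow> bool" where
  "bilinear_on actM M actN N actP P f \<longleftrightarrow>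
     (\<forall>x\<in>M. linear_on actN N actP P (f x)) \<and> (\<forall>y\<in>N. linear_on actM M actP P (\<lambda>x. f x y))"


section \<open>Courant pairs\<close>

record ('r, 'a, 'l) courant =
  carA :: "'a set"
  actA :: "'r \<Rightarrow> 'a \<Rightarrow> 'a"
  carL :: "'l set"
  actL :: "'r \<Rightarrow> 'l \<Rightarrow> 'l"
  mult :: "'a \<Rightarrow> 'a \<Rightarrow> 'a"
  anch :: "'l \<Rightarrow> 'a \<Rightarrow> 'a"
  brk :: "'l \<Rightarrow> 'l \<Rightarrow> 'l"

definition derivation_on ::
  "('r \<Rightarrow> 'a::ab_group_add \<Rightarrow> 'a) \<Rightarrow> 'a set \<Rightarrow> ('a \<Rightarrow> 'a \<Rightarrow> 'a) \<Rightarrow> ('a \<Rightarrow> 'a) \<Rightarrow> bool" where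
  "derivation_on act A m D \<longleftrightarrow>
     linear_on act A act A D \<and> (\<forall>a\<in>A. \<forall>b\<in>A. D (m a b) = m (D a) b + m a (D b))"

text \<open>Courant pairs over a commutative unital algebra \<open>R\<close>; those over \<open>\<bbbK>\<close> have \<open>R = base_field\<close>.\<close>

definition courant_pair ::
  "('k, 'r::ab_group_add) ualg \<Rightarrow> ('r, 'a::ab_group_add, 'l::ab_group_add) courant \<Rightarrow> bool" where
  "courant_pair R P \<longleftrightarrow>
     module_on R (actA P) (carA P) \<and> module_on R (actL P) (carL P) \<and>
     bilinear_on (actA P) (carA P) (actA P) (carA P) (actA P) (carA P) (mult P) \<and>
     (\<forall>a\<in>carA P. \<forall>b\<in>carA P. \<forall>c\<in>carA P. mult P (mult P a b) c = mult P a (mult P b c)) \<and>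
     bilinear_on (actL P) (carL P) (actL P) (carL P) (actL P) (carL P) (brk P) \<and>
     (\<forall>x\<in>carL P. \<forall>y\<in>carL P. \<forall>z\<in>carL P.
        brk P x (brk P y z) = brk P (brk P x y) z + brk P y (brk P x z)) \<and>
     bilinear_on (actL P) (carL P) (actA P) (carA P) (actA P) (carA P) (anch P) \<and>
     (\<forall>x\<in>carL P. derivation_on (actA P) (carA P) (mult P) (anch P x)) \<and>
     (\<forall>x\<in>carL P. \<forall>y\<in>carL P. \<forall>a\<in>carA P.
        anch P (brk P x y) a = anch P x (anch P y a) - anch P y (anch P x a))"

definition courant_hom ::
  "('r, 'a::ab_group_add, 'l::ab_group_add) courant \<Rightarrow>
   ('r, 'b::ab_group_add, 'm::ab_group_add) courant \<Rightarrow> ('a \<Rightarrow> 'b) \<Rightarrow> ('l \<Rightarrow> 'm) \<Rightarrow> bool" where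
  "courant_hom P Q f g \<longleftrightarrow>
     linear_on (actA P) (carA P) (actA Q) (carA Q) f \<and>
     linear_on (actL P) (carL P) (actL Q) (carL Q) g \<and>
     (\<forall>a\<in>carA P. \<forall>b\<in>carA P. f (mult P a b) = mult Q (f a) (f b)) \<and>
     (\<forall>x\<in>carL P. \<forall>y\<in>carL P. g (brk P x y) = brk Q (g x) (g y)) \<and>
     (\<forall>x\<in>carL P. \<forall>a\<in>carA P. f (anch P x a) = anch Q (g x) (f a))"

definition restrict_scalars ::
  "('k, 'r) ualg \<Rightarrow> ('r, 'a, 'l) courant \<Rightarrow> ('k, 'a, 'l) courant" where
  "restrict_scalars R P = \<lparr>
     carA = carA P, actA = (\<lambda>k. actA P (smul R k (aunit R))),
     carL = carL P, actL = (\<lambda>k. actL P (smul R k (aunit R))),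
     mult = mult P, anch = anch P, brk = brk P \<rparr>"


section \<open>Cohomology of a Courant pair\<close>

text \<open>
  All cochains of a Courant pair are collected in one type: in \<open>(g, f)\<close>, the component in
  \<open>C\<^sup>0\<^sup>,\<^sup>q\<close> is \<open>g\<close> on lists of length \<open>q\<close>, and the component in \<open>C\<^sup>p\<^sup>,\<^sup>q\<close> for \<open>p > 0\<close> is
  \<open>f xs as\<close> for \<open>length xs = q\<close>, \<open>length as = p\<close>. Thus \<open>C\<^sup>n\<^sub>t\<^sub>o\<^sub>t\<close> consists of the pairs that are
  multilinear for \<open>p + q = n\<close> and vanish for all other lengths.
\<close>

type_synonym ('a, 'l) cochain = "('l list \<Rightarrow> 'l) \<times> ('l list \<Rightarrow> 'a list \<Rightarrow> 'a)"

definition C_tot ::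
  "('k::field, 'a::ab_group_add, 'l::ab_group_add) courant \<Rightarrow> nat \<Rightarrow> ('a, 'l) cochain set" where
  "C_tot P n = {(g, f).
     (\<forall>xs. length xs \<noteq> n \<longrightarrow> g xs = 0) \<and>
     (\<forall>xs k. length xs = n \<and> k < n \<longrightarrow>
        Vector_Spaces.linear (actL P) (actL P) (\<lambda>x. g (xs[k := x]))) \<and>
     (\<forall>xs as. as = [] \<or> length xs + length as \<noteq> n \<longrightarrow> f xs as = 0) \<and>
     (\<forall>xs as. as \<noteq> [] \<and> length xs + length as = n \<longrightarrow>
        (\<forall>k < length xs. Vector_Spaces.linear (actL P) (actA P) (\<lambda>x. f (xs[k := x]) as)) \<and>
        (\<forall>k < length as. Vector_Spaces.linear (actA P) (actA P) (\<lambda>a. f xs (as[k := a]))))}"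

definition sgn_pow :: "nat \<Rightarrow> 'm::ab_group_add \<Rightarrow> 'm" where
  "sgn_pow i v = (if even i then v else - v)"

text \<open>In the following, positions in lists are counted from 1, as usual for these formulas.\<close>

definition nth1 :: "'x list \<Rightarrow> nat \<Rightarrow> 'x" where
  "nth1 xs i = xs ! (i - 1)"

definition omit :: "nat \<Rightarrow> 'x list \<Rightarrow> 'x list" where
  "omit i xs = take (i - 1) xs @ drop i xs"

definition leibniz_cobd ::
  "('l \<Rightarrow> 'l \<Rightarrow> 'l) \<Rightarrow> ('l \<Rightarrow> 'm \<Rightarrow> 'm) \<Rightarrow> ('m \<Rightarrow> 'l \<Rightarrow> 'm) \<Rightarrow>
   ('l list \<Rightarrow> 'm) \<Rightarrow> 'l list \<Rightarrow> 'm::ab_group_add" where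
  "leibniz_cobd br lact ract \<psi> xs =
     (if xs = [] then 0 else
      let q = length xs - 1 in
      sgn_pow (q + 1)
        ((\<Sum>i\<in>{1..q}. sgn_pow (i - 1) (lact (nth1 xs i) (\<psi> (omit i xs))))
         + sgn_pow (q + 1) (ract (\<psi> (butlast xs)) (last xs))
         + (\<Sum>j\<in>{1..q+1}. \<Sum>i\<in>{1..<j}.
              sgn_pow i (\<psi> (omit i (xs[j - 1 := br (nth1 xs i) (nth1 xs j)]))))))"

text \<open>The action of \<open>L\<close> on \<open>Hom(A\<^sup>\<otimes>\<^sup>p, A)\<close>.\<close>

definition hom_act ::
  "('r, 'a::ab_group_add, 'l) courant \<Rightarrow> 'l \<Rightarrow> ('a list \<Rightarrow> 'a) \<Rightarrow> 'a list \<Rightarrow> 'a" where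
  "hom_act P x f as =
     anch P x (f as) - (\<Sum>k\<in>{1..length as}. f (as[k - 1 := anch P x (nth1 as k)]))"

definition merge :: "('a \<Rightarrow> 'a \<Rightarrow> 'a) \<Rightarrow> nat \<Rightarrow> 'a list \<Rightarrow> 'a list" where
  "merge m i as = take (i - 1) as @ [m (nth1 as i) (nth1 as (i + 1))] @ drop (i + 1) as"

definition hochschild_cobd ::
  "('a \<Rightarrow> 'a \<Rightarrow> 'a) \<Rightarrow> ('a list \<Rightarrow> 'a) \<Rightarrow> 'a list \<Rightarrow> 'a::ab_group_add" where
  "hochschild_cobd m f as =
     (let p = length as - 1 in
      m (hd as) (f (tl as))
      + (\<Sum>i\<in>{1..p}. sgn_pow i (f (merge m i as)))
      + sgn_pow (p + 1) (m (f (butlast as)) (last as)))"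

text \<open>
  The second component of \<open>\<delta>\<^sub>t\<^sub>o\<^sub>t\<close> on \<open>as\<close> of length \<open>p\<close>: the vertical part comes from row \<open>p - 1\<close>,
  which consists of \<open>L\<close>-valued cochains if \<open>p = 1\<close>.
\<close>

definition delta_tot ::
  "('k, 'a::ab_group_add, 'l::ab_group_add) courant \<Rightarrow> ('a, 'l) cochain \<Rightarrow> ('a, 'l) cochain" where
  "delta_tot P = (\<lambda>(g, f).
     (\<lambda>xs. leibniz_cobd (brk P) (brk P) (brk P) g xs,
      \<lambda>xs as.
        (if length as = 0 then 0
         else if length as = 1 then anch P (g xs) (hd as)
         else hochschild_cobd (mult P) (f xs) as)
        + sgn_pow (length as)
            (leibniz_cobd (brk P) (hom_act P) (\<lambda>h x. - hom_act P x h) f xs as)))"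

definition Z_tot ::
  "('k::field, 'a::ab_group_add, 'l::ab_group_add) courant \<Rightarrow> nat \<Rightarrow> ('a, 'l) cochain set" where
  "Z_tot P n = {u \<in> C_tot P n. delta_tot P u = 0}"

definition B_tot ::
  "('k::field, 'a::ab_group_add, 'l::ab_group_add) courant \<Rightarrow> nat \<Rightarrow> ('a, 'l) cochain set" where
  "B_tot P n = (if n = 0 then {0} else delta_tot P ` C_tot P (n - 1))"

definition cohomologous ::
  "('k::field, 'a::ab_group_add, 'l::ab_group_add) courant \<Rightarrow> nat \<Rightarrow>
   (('a, 'l) cochain \<times> ('a, 'l) cochain) set" where
  "cohomologous P n = {(u, v). u \<in> Z_tot P n \<and> v \<in> Z_tot P n \<and> u - v \<in> B_tot P n}"

definition H_CP ::
  "('k::field, 'a::ab_group_add, 'l::ab_group_add) courant \<Rightarrow> nat \<Rightarrow> ('a, 'l) cochain set set" where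
  "H_CP P n = Z_tot P n // cohomologous P n"

definition class_CP ::
  "('k::field, 'a::ab_group_add, 'l::ab_group_add) courant \<Rightarrow> nat \<Rightarrow> ('a, 'l) cochain \<Rightarrow>
   ('a, 'l) cochain set" where
  "class_CP P n u = cohomologous P n `` {u}"


section \<open>Tensor products of vector spaces\<close>

text \<open>
  \<open>U \<otimes> V\<close> is realised inside the dual of the space of bilinear forms on \<open>U \<times> V\<close>, as the span of
  the evaluations \<open>u \<otimes> v\<close>. The lemmas below establish its universal property.
\<close>

type_synonym ('k, 'u, 'v) tens = "('u \<Rightarrow> 'v \<Rightarrow> 'k) \<Rightarrow> 'k"

definition tscale :: "'k::field \<Rightarrow> ('k, 'u, 'v) tens \<Rightarrow> ('k, 'u, 'v) tens" where
  "tscale c T = (\<lambda>\<beta>. c * T \<beta>)"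

definition tensor ::
  "('k::field \<Rightarrow> 'u::ab_group_add \<Rightarrow> 'u) \<Rightarrow> ('k \<Rightarrow> 'v::ab_group_add \<Rightarrow> 'v) \<Rightarrow>
   'u \<Rightarrow> 'v \<Rightarrow> ('k, 'u, 'v) tens" where
  "tensor sU sV u v = (\<lambda>\<beta>. if bilin sU sV (*) \<beta> then \<beta> u v else 0)"

definition tensor_space ::
  "('k::field \<Rightarrow> 'u::ab_group_add \<Rightarrow> 'u) \<Rightarrow> ('k \<Rightarrow> 'v::ab_group_add \<Rightarrow> 'v) \<Rightarrow>
   ('k, 'u, 'v) tens set" where
  "tensor_space sU sV = module.span tscale {tensor sU sV u v | u v. True}"

text \<open>
  The linear map on \<open>U \<otimes> V\<close> induced by a bilinear map on \<open>U \<times> V\<close>; its values outside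
  \<open>tensor_space\<close> are irrelevant.
\<close>

definition tensor_lift ::
  "('k::field \<Rightarrow> 'u::ab_group_add \<Rightarrow> 'u) \<Rightarrow> ('k \<Rightarrow> 'v::ab_group_add \<Rightarrow> 'v) \<Rightarrow>
   ('k \<Rightarrow> 'w::ab_group_add \<Rightarrow> 'w) \<Rightarrow> ('u \<Rightarrow> 'v \<Rightarrow> 'w) \<Rightarrow> ('k, 'u, 'v) tens \<Rightarrow> 'w" where
  "tensor_lift sU sV sW f =
     (SOME g. Vector_Spaces.linear tscale sW g \<and> (\<forall>u v. g (tensor sU sV u v) = f u v))"

lemma vector_space_tscale: "vector_space (tscale :: 'k::field \<Rightarrow> ('k, 'u, 'v) tens \<Rightarrow> _)"
  by unfold_locales (auto simp: tscale_def fun_eq_iff algebra_simps)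

lemma linear_intro:
  assumes "vector_space s" "vector_space t"
    and "\<And>x y. f (x + y) = f x + f y" "\<And>c x. f (s c x) = t c (f x)"
  shows "Vector_Spaces.linear s t f"
  using assms
  by (simp add: Vector_Spaces.linear_def module_hom_iff module_iff_vector_space)

lemma bilin_tensor:
  assumes "vector_space sU" "vector_space sV"
  shows "bilin sU sV tscale (tensor sU sV)"
proof -
  have *: "\<beta> (u + u') v = \<beta> u v + \<beta> u' v" "\<beta> u (v + v') = \<beta> u v + \<beta> u v'"
    "\<beta> (sU k u) v = k * \<beta> u v" "\<beta> u (sV k v) = k * \<beta> u v"
    if "bilin sU sV (*) \<beta>" for \<beta> u u' v v' k
  proof -
    have l: "Vector_Spaces.linear sU (*) (\<lambda>u. \<beta> u v)" "Vector_Spaces.linear sV (*) (\<beta> u)" for u v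
      using that by (auto simp: bilin_def)
    show "\<beta> (u + u') v = \<beta> u v + \<beta> u' v" "\<beta> (sU k u) v = k * \<beta> u v"
      using Vector_Spaces.linear.axioms(3)[OF l(1)] by (auto simp: module_hom_iff)
    show "\<beta> u (v + v') = \<beta> u v + \<beta> u v'" "\<beta> u (sV k v) = k * \<beta> u v"
      using Vector_Spaces.linear.axioms(3)[OF l(2)] by (auto simp: module_hom_iff)
  qed
  show ?thesis
    unfolding bilin_def[of sU sV tscale]
    by (intro conjI allI linear_intro assms vector_space_tscale)
      (simp_all add: tensor_def tscale_def fun_eq_iff *)
qed

lemma tensor_universal:
  fixes sU :: "'k::field \<Rightarrow> 'u::ab_group_add \<Rightarrow> 'u" and sV :: "'k \<Rightarrow> 'v::ab_group_add \<Rightarrow> 'v"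
    and sW :: "'k \<Rightarrow> 'w::ab_group_add \<Rightarrow> 'w"
  assumes f: "bilin sU sV sW f"
  shows "\<exists>g. Vector_Spaces.linear tscale sW g \<and> (\<forall>u v. g (tensor sU sV u v) = f u v)"
proof -
  have lf: "Vector_Spaces.linear sU sW (\<lambda>u. f u v)" "Vector_Spaces.linear sV sW (f u)" for u v
    using f by (auto simp: bilin_def)
  have vW: "vector_space sW" using lf(1) by (auto simp: Vector_Spaces.linear_def)
  have vK: "vector_space ((*) :: 'k \<Rightarrow> _)" by unfold_locales (auto simp: algebra_simps)
  interpret TW: vector_space_pair "tscale :: 'k \<Rightarrow> ('k, 'u, 'v) tens \<Rightarrow> _" sW
    by (simp add: vector_space_pair_def vector_space_tscale vW)
  interpret WK: vector_space_pair sW "(*) :: 'k \<Rightarrow> _"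
    by (simp add: vector_space_pair_def vK vW)
  interpret TK: vector_space_pair "tscale :: 'k \<Rightarrow> ('k, 'u, 'v) tens \<Rightarrow> _" "(*) :: 'k \<Rightarrow> _"
    by (simp add: vector_space_pair_def vector_space_tscale vK)
  let ?P = "{tensor sU sV u v | u v. True}"
  obtain B where B: "B \<subseteq> ?P" "TW.vs1.independent B" "?P \<subseteq> TW.vs1.span B"
    by (rule TW.vs1.maximal_independent_subset[of ?P])
  have "\<forall>b\<in>B. \<exists>p. b = tensor sU sV (fst p) (snd p)" using B(1) by auto
  then obtain c where c: "\<And>b. b \<in> B \<Longrightarrow> b = tensor sU sV (fst (c b)) (snd (c b))" by metis
  obtain g where g: "Vector_Spaces.linear tscale sW g"
      "\<forall>b\<in>B. g b = f (fst (c b)) (snd (c b))"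
    using TW.linear_independent_extend[OF B(2), of "\<lambda>b. f (fst (c b)) (snd (c b))"] by blast
  have "g (tensor sU sV u v) = f u v" for u v
  proof (rule ccontr)
    let ?w = "g (tensor sU sV u v) - f u v"
    assume "g (tensor sU sV u v) \<noteq> f u v"
    then have "TW.vs2.independent {?w}" by simp
    then obtain \<phi> where \<phi>: "Vector_Spaces.linear sW (*) \<phi>" "\<phi> ?w = 1"
      using WK.linear_independent_extend[of "{?w}" "\<lambda>_. 1"] by auto
    let ?\<beta> = "\<lambda>u v. \<phi> (f u v)"
    have \<beta>: "bilin sU sV (*) ?\<beta>"
      unfolding bilin_def using Vector_Spaces.linear_compose[OF lf(1) \<phi>(1)]
        Vector_Spaces.linear_compose[OF lf(2) \<phi>(1)] by (auto simp: o_def)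
    have ev: "Vector_Spaces.linear tscale (*) (\<lambda>T :: ('k, 'u, 'v) tens. T ?\<beta>)"
      by (intro linear_intro vector_space_tscale vK) (simp_all add: tscale_def)
    have "tensor sU sV u v ?\<beta> = (\<phi> \<circ> g) (tensor sU sV u v)"
    proof (rule TK.linear_eq_on[OF ev Vector_Spaces.linear_compose[OF g(1) \<phi>(1)]])
      show "tensor sU sV u v \<in> TW.vs1.span B" using B(3) by auto
      fix b assume b: "b \<in> B"
      have "b ?\<beta> = ?\<beta> (fst (c b)) (snd (c b))"
        by (subst c[OF b]) (simp add: tensor_def \<beta>)
      then show "b ?\<beta> = (\<phi> \<circ> g) b" using g(2) b by simp
    qed
    then have "\<phi> (f u v) = \<phi> (g (tensor sU sV u v))" by (simp add: tensor_def \<beta>)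
    moreover have "\<phi> ?w = \<phi> (g (tensor sU sV u v)) - \<phi> (f u v)"
      by (rule WK.linear_diff[OF \<phi>(1)])
    ultimately show False using \<phi>(2) by simp
  qed
  with g(1) show ?thesis by blast
qed

lemma tensor_lift:
  assumes "bilin sU sV sW f"
  shows "Vector_Spaces.linear tscale sW (tensor_lift sU sV sW f)"
    and "tensor_lift sU sV sW f (tensor sU sV u v) = f u v"
  using someI_ex[OF tensor_universal[OF assms]] unfolding tensor_lift_def by blast+

lemma tensor_lift_unique:
  assumes f: "bilin sU sV sW f" and g: "Vector_Spaces.linear tscale sW g"
    and gf: "\<And>u v. g (tensor sU sV u v) = f u v" and T: "T \<in> tensor_space sU sV"
  shows "g T = tensor_lift sU sV sW f T"
proof -
  have "vector_space sW" using g by (simp add: Vector_Spaces.linear_def)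
  then interpret vector_space_pair "tscale :: 'a \<Rightarrow> ('a, 'b, 'c) tens \<Rightarrow> _" sW
    by (simp add: vector_space_pair_def vector_space_tscale)
  show ?thesis
    by (rule linear_eq_on[OF g tensor_lift(1)[OF f] T[unfolded tensor_space_def]])
      (auto simp: gf tensor_lift(2)[OF f])
qed


section \<open>Deformations\<close>

text \<open>\<open>R \<otimes> V\<close> as an \<open>R\<close>-module, and the maps \<open>\<phi> \<otimes> id\<^sub>V\<close>, \<open>\<epsilon> \<otimes> id\<^sub>V : R \<otimes> V \<rightarrow> \<bbbK> \<otimes> V = V\<close>.\<close>

definition base_act ::
  "('k::field, 'r::ab_group_add) ualg \<Rightarrow> ('k \<Rightarrow> 'v::ab_group_add \<Rightarrow> 'v) \<Rightarrow>
   'r \<Rightarrow> ('k, 'r, 'v) tens \<Rightarrow> ('k, 'r, 'v) tens" where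
  "base_act R sV r =
     tensor_lift (smul R) sV tscale (\<lambda>r' v. tensor (smul R) sV (amul R r r') v)"

definition base_change ::
  "('k::field, 'r::ab_group_add) ualg \<Rightarrow> ('k, 's::ab_group_add) ualg \<Rightarrow>
   ('k \<Rightarrow> 'v::ab_group_add \<Rightarrow> 'v) \<Rightarrow> ('r \<Rightarrow> 's) \<Rightarrow> ('k, 'r, 'v) tens \<Rightarrow> ('k, 's, 'v) tens" where
  "base_change R S sV \<phi> = tensor_lift (smul R) sV tscale (\<lambda>r v. tensor (smul S) sV (\<phi> r) v)"

definition aug_map ::
  "('k::field, 'r::ab_group_add) ualg \<Rightarrow> ('k \<Rightarrow> 'v::ab_group_add \<Rightarrow> 'v) \<Rightarrow> ('r \<Rightarrow> 'k) \<Rightarrow>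
   ('k, 'r, 'v) tens \<Rightarrow> 'v" where
  "aug_map R sV \<epsilon> = tensor_lift (smul R) sV sV (\<lambda>r v. sV (\<epsilon> r) v)"

definition one_tensor ::
  "('k::field, 'r::ab_group_add) ualg \<Rightarrow> ('k \<Rightarrow> 'v::ab_group_add \<Rightarrow> 'v) \<Rightarrow> 'v \<Rightarrow>
   ('k, 'r, 'v) tens" where
  "one_tensor R sV v = tensor (smul R) sV (aunit R) v"

record ('t, 'u) triplet =
  tmult :: "'t \<Rightarrow> 't \<Rightarrow> 't"
  tanch :: "'u \<Rightarrow> 't \<Rightarrow> 't"
  tbrk :: "'u \<Rightarrow> 'u \<Rightarrow> 'u"

type_synonym ('k, 'r, 'a, 'l) deform = "(('k, 'r, 'a) tens, ('k, 'r, 'l) tens) triplet"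

definition triplet_pair ::
  "('k::field, 'a::ab_group_add, 'l::ab_group_add) courant \<Rightarrow> ('k, 'r::ab_group_add) ualg \<Rightarrow>
   ('k, 'r, 'a, 'l) deform \<Rightarrow> ('r, ('k, 'r, 'a) tens, ('k, 'r, 'l) tens) courant" where
  "triplet_pair P R lam = \<lparr>
     carA = tensor_space (smul R) (actA P), actA = base_act R (actA P),
     carL = tensor_space (smul R) (actL P), actL = base_act R (actL P),
     mult = tmult lam, anch = tanch lam, brk = tbrk lam \<rparr>"

definition deformation ::
  "('k::field, 'a::ab_group_add, 'l::ab_group_add) courant \<Rightarrow> ('k, 'r::ab_group_add) ualg \<Rightarrow>
   ('r \<Rightarrow> 'k) \<Rightarrow> ('k, 'r, 'a, 'l) deform \<Rightarrow> bool" where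
  "deformation P R \<epsilon> lam \<longleftrightarrow>
     courant_pair R (triplet_pair P R lam) \<and>
     courant_hom (restrict_scalars R (triplet_pair P R lam)) P
       (aug_map R (actA P) \<epsilon>) (aug_map R (actL P) \<epsilon>)"

text \<open>Triplets are compared on \<open>R \<otimes> A\<close> and \<open>R \<otimes> L\<close>, not on the ambient types.\<close>

definition triplet_eq ::
  "('k::field, 'a::ab_group_add, 'l::ab_group_add) courant \<Rightarrow> ('k, 'r::ab_group_add) ualg \<Rightarrow>
   ('k, 'r, 'a, 'l) deform \<Rightarrow> ('k, 'r, 'a, 'l) deform \<Rightarrow> bool" where
  "triplet_eq P R lam lam' \<longleftrightarrow>
     (let RA = tensor_space (smul R) (actA P); RL = tensor_space (smul R) (actL P) in
      (\<forall>t\<in>RA. \<forall>t'\<in>RA. tmult lam t t' = tmult lam' t t') \<and>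
      (\<forall>u\<in>RL. \<forall>t\<in>RA. tanch lam u t = tanch lam' u t) \<and>
      (\<forall>u\<in>RL. \<forall>u'\<in>RL. tbrk lam u u' = tbrk lam' u u'))"

text \<open>
  The \<open>R\<close>-bilinear map \<open>(R \<otimes> U) \<times> (R \<otimes> V) \<rightarrow> R \<otimes> W\<close>,
  \<open>(r\<^sub>1 \<otimes> u, r\<^sub>2 \<otimes> v) \<mapsto> r\<^sub>1 r\<^sub>2 \<cdot> f u v\<close>.
\<close>

definition scalar_ext ::
  "('k::field, 'r::ab_group_add) ualg \<Rightarrow> ('k \<Rightarrow> 'u::ab_group_add \<Rightarrow> 'u) \<Rightarrow>
   ('k \<Rightarrow> 'v::ab_group_add \<Rightarrow> 'v) \<Rightarrow> ('k \<Rightarrow> 'w::ab_group_add \<Rightarrow> 'w) \<Rightarrow>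
   ('u \<Rightarrow> 'v \<Rightarrow> ('k, 'r, 'w) tens) \<Rightarrow>
   ('k, 'r, 'u) tens \<Rightarrow> ('k, 'r, 'v) tens \<Rightarrow> ('k, 'r, 'w) tens" where
  "scalar_ext R sU sV sW f t t' =
     tensor_lift (smul R) sU tscale (\<lambda>r\<^sub>1 u.
       tensor_lift (smul R) sV tscale (\<lambda>r\<^sub>2 v. base_act R sW (amul R r\<^sub>1 r\<^sub>2) (f u v)) t') t"

text \<open>
  Under \<open>R\<^sub>1 \<otimes> V = R\<^sub>1 \<otimes>\<^sub>R (R \<otimes> V)\<close> the element \<open>r\<^sub>1 \<otimes> v\<close> is \<open>r\<^sub>1 \<otimes>\<^sub>R (1 \<otimes> v)\<close>, and
  \<open>1 \<otimes>\<^sub>R t\<close> is \<open>(\<phi> \<otimes> id\<^sub>V) t\<close>.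
\<close>

definition push_out ::
  "('k::field, 'a::ab_group_add, 'l::ab_group_add) courant \<Rightarrow> ('k, 'r::ab_group_add) ualg \<Rightarrow>
   ('k, 's::ab_group_add) ualg \<Rightarrow> ('r \<Rightarrow> 's) \<Rightarrow>
   ('k, 'r, 'a, 'l) deform \<Rightarrow> ('k, 's, 'a, 'l) deform" where
  "push_out P R R\<^sub>1 \<phi> lam = \<lparr>
     tmult = scalar_ext R\<^sub>1 (actA P) (actA P) (actA P) (\<lambda>a b.
       base_change R R\<^sub>1 (actA P) \<phi>
         (tmult lam (one_tensor R (actA P) a) (one_tensor R (actA P) b))),
     tanch = scalar_ext R\<^sub>1 (actL P) (actA P) (actA P) (\<lambda>x a.
       base_change R R\<^sub>1 (actA P) \<phi>
         (tanch lam (one_tensor R (actL P) x) (one_tensor R (actA P) a))),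
     tbrk = scalar_ext R\<^sub>1 (actL P) (actL P) (actL P) (\<lambda>x y.
       base_change R R\<^sub>1 (actL P) \<phi>
         (tbrk lam (one_tensor R (actL P) x) (one_tensor R (actL P) y))) \<rparr>"


section \<open>One-dimensional extensions and Harrison cohomology\<close>

text \<open>Here \<open>\<bbbK>\<close> is an \<open>R\<close>-module via the augmentation \<open>\<epsilon>\<close>.\<close>

definition one_dim_extension ::
  "('k::field, 'r::ab_group_add) ualg \<Rightarrow> ('r \<Rightarrow> 'k) \<Rightarrow> ('k, 's::ab_group_add) ualg \<Rightarrow>
   ('k \<Rightarrow> 's) \<Rightarrow> ('s \<Rightarrow> 'r) \<Rightarrow> bool" where
  "one_dim_extension R \<epsilon> S i p \<longleftrightarrow>
     comm_alg S \<and> alg_hom S R p \<and> Vector_Spaces.linear (*) (smul S) i \<and>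
     inj i \<and> range i = {s. p s = 0} \<and> surj p \<and>
     (\<forall>s m. amul S s (i m) = i (\<epsilon> (p s) * m))"

definition linear_section ::
  "('k::field, 'r::ab_group_add) ualg \<Rightarrow> ('k, 's::ab_group_add) ualg \<Rightarrow> ('s \<Rightarrow> 'r) \<Rightarrow>
   ('r \<Rightarrow> 's) \<Rightarrow> bool" where
  "linear_section R S p q \<longleftrightarrow> Vector_Spaces.linear (smul R) (smul S) q \<and> (\<forall>r. p (q r) = r)"

definition section_pair :: "('k \<Rightarrow> 's::ab_group_add) \<Rightarrow> ('r \<Rightarrow> 's) \<Rightarrow> 'r \<Rightarrow> 'k \<Rightarrow> 's" where
  "section_pair i q r m = q r + i m"

definition harr_Z2 ::
  "('k::field, 'r::ab_group_add) ualg \<Rightarrow> ('r \<Rightarrow> 'k) \<Rightarrow> ('r \<Rightarrow> 'r \<Rightarrow> 'k) set" where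
  "harr_Z2 R \<epsilon> = {\<psi>. bilin (smul R) (smul R) (*) \<psi> \<and> (\<forall>r s. \<psi> r s = \<psi> s r) \<and>
     (\<forall>r s t. \<epsilon> r * \<psi> s t - \<psi> (amul R r s) t + \<psi> r (amul R s t) - \<psi> r s * \<epsilon> t = 0)}"

definition harr_B2 ::
  "('k::field, 'r::ab_group_add) ualg \<Rightarrow> ('r \<Rightarrow> 'k) \<Rightarrow> ('r \<Rightarrow> 'r \<Rightarrow> 'k) set" where
  "harr_B2 R \<epsilon> = {\<lambda>r s. \<epsilon> r * h s - h (amul R r s) + h r * \<epsilon> s | h.
     Vector_Spaces.linear (smul R) (*) h}"

definition harr_cohomologous ::
  "('k::field, 'r::ab_group_add) ualg \<Rightarrow> ('r \<Rightarrow> 'k) \<Rightarrow>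
   (('r \<Rightarrow> 'r \<Rightarrow> 'k) \<times> ('r \<Rightarrow> 'r \<Rightarrow> 'k)) set" where
  "harr_cohomologous R \<epsilon> =
     {(\<psi>, \<psi>'). \<psi> \<in> harr_Z2 R \<epsilon> \<and> \<psi>' \<in> harr_Z2 R \<epsilon> \<and> \<psi> - \<psi>' \<in> harr_B2 R \<epsilon>}"

definition H2_harr ::
  "('k::field, 'r::ab_group_add) ualg \<Rightarrow> ('r \<Rightarrow> 'k) \<Rightarrow> ('r \<Rightarrow> 'r \<Rightarrow> 'k) set set" where
  "H2_harr R \<epsilon> = harr_Z2 R \<epsilon> // harr_cohomologous R \<epsilon>"

text \<open>The cocycle \<open>\<psi>\<close> in \<open>(r\<^sub>1, m\<^sub>1)\<^sub>q (r\<^sub>2, m\<^sub>2)\<^sub>q = (r\<^sub>1 r\<^sub>2, r\<^sub>1 m\<^sub>2 + r\<^sub>2 m\<^sub>1 + \<psi>(r\<^sub>1, r\<^sub>2))\<^sub>q\<close>.\<close>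

definition section_cocycle ::
  "('k::field, 'r::ab_group_add) ualg \<Rightarrow> ('r \<Rightarrow> 'k) \<Rightarrow> ('k, 's::ab_group_add) ualg \<Rightarrow>
   ('k \<Rightarrow> 's) \<Rightarrow> ('r \<Rightarrow> 's) \<Rightarrow> ('r \<Rightarrow> 'r \<Rightarrow> 'k) \<Rightarrow> bool" where
  "section_cocycle R \<epsilon> S i q \<psi> \<longleftrightarrow>
     (\<forall>r\<^sub>1 m\<^sub>1 r\<^sub>2 m\<^sub>2. amul S (section_pair i q r\<^sub>1 m\<^sub>1) (section_pair i q r\<^sub>2 m\<^sub>2) =
        section_pair i q (amul R r\<^sub>1 r\<^sub>2) (\<epsilon> r\<^sub>1 * m\<^sub>2 + \<epsilon> r\<^sub>2 * m\<^sub>1 + \<psi> r\<^sub>1 r\<^sub>2))"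

definition corresponds ::
  "('k::field, 'r::ab_group_add) ualg \<Rightarrow> ('r \<Rightarrow> 'k) \<Rightarrow> ('k, 's::ab_group_add) ualg \<Rightarrow>
   ('k \<Rightarrow> 's) \<Rightarrow> ('s \<Rightarrow> 'r) \<Rightarrow> ('r \<Rightarrow> 'r \<Rightarrow> 'k) set \<Rightarrow> bool" where
  "corresponds R \<epsilon> S i p c \<longleftrightarrow>
     (\<exists>q \<psi>. linear_section R S p q \<and> section_cocycle R \<epsilon> S i q \<psi> \<and> \<psi> \<in> c)"


section \<open>The obstruction map\<close>

text \<open>
  \<open>coeff_triplet P R m n \<Psi>\<close> is the \<open>R\<close>-bilinear triplet with coefficients
  \<open>\<Psi>\<^sub>i = (\<psi>\<^sup>1\<^sub>i, \<psi>\<^sup>2\<^sub>i, \<psi>\<^sup>3\<^sub>i) \<in> C\<^sup>2\<^sub>t\<^sub>o\<^sub>t\<close> at \<open>m\<^sub>1, \<dots>, m\<^sub>n \<in> R\<close>: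
  e.g. the product of \<open>1 \<otimes> a\<close> and \<open>1 \<otimes> b\<close> is \<open>1 \<otimes> ab + \<Sum>i. m\<^sub>i \<otimes> \<psi>\<^sup>1\<^sub>i(a, b)\<close>.
\<close>

definition coeff_mult ::
  "('k::field, 'a::ab_group_add, 'l::ab_group_add) courant \<Rightarrow> ('k, 'r::ab_group_add) ualg \<Rightarrow>
   (nat \<Rightarrow> 'r) \<Rightarrow> nat \<Rightarrow> (nat \<Rightarrow> ('a, 'l) cochain) \<Rightarrow> 'a \<Rightarrow> 'a \<Rightarrow> ('k, 'r, 'a) tens" where
  "coeff_mult P R m n \<Psi> a b =
     one_tensor R (actA P) (mult P a b)
     + (\<Sum>i\<in>{1..n}. tensor (smul R) (actA P) (m i) (snd (\<Psi> i) [] [a, b]))"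

definition coeff_anch ::
  "('k::field, 'a::ab_group_add, 'l::ab_group_add) courant \<Rightarrow> ('k, 'r::ab_group_add) ualg \<Rightarrow>
   (nat \<Rightarrow> 'r) \<Rightarrow> nat \<Rightarrow> (nat \<Rightarrow> ('a, 'l) cochain) \<Rightarrow> 'l \<Rightarrow> 'a \<Rightarrow> ('k, 'r, 'a) tens" where
  "coeff_anch P R m n \<Psi> x a =
     one_tensor R (actA P) (anch P x a)
     + (\<Sum>i\<in>{1..n}. tensor (smul R) (actA P) (m i) (snd (\<Psi> i) [x] [a]))"

definition coeff_brk ::
  "('k::field, 'a::ab_group_add, 'l::ab_group_add) courant \<Rightarrow> ('k, 'r::ab_group_add) ualg \<Rightarrow>
   (nat \<Rightarrow> 'r) \<Rightarrow> nat \<Rightarrow> (nat \<Rightarrow> ('a, 'l) cochain) \<Rightarrow> 'l \<Rightarrow> 'l \<Rightarrow> ('k, 'r, 'l) tens" where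
  "coeff_brk P R m n \<Psi> x y =
     one_tensor R (actL P) (brk P x y)
     + (\<Sum>i\<in>{1..n}. tensor (smul R) (actL P) (m i) (fst (\<Psi> i) [x, y]))"

definition coeff_triplet ::
  "('k::field, 'a::ab_group_add, 'l::ab_group_add) courant \<Rightarrow> ('k, 'r::ab_group_add) ualg \<Rightarrow>
   (nat \<Rightarrow> 'r) \<Rightarrow> nat \<Rightarrow> (nat \<Rightarrow> ('a, 'l) cochain) \<Rightarrow> ('k, 'r, 'a, 'l) deform" where
  "coeff_triplet P R m n \<Psi> = \<lparr>
     tmult = scalar_ext R (actA P) (actA P) (actA P) (coeff_mult P R m n \<Psi>),
     tanch = scalar_ext R (actL P) (actA P) (actA P) (coeff_anch P R m n \<Psi>),
     tbrk = scalar_ext R (actL P) (actL P) (actL P) (coeff_brk P R m n \<Psi>) \<rparr>"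

definition has_coeffs ::
  "('k::field, 'a::ab_group_add, 'l::ab_group_add) courant \<Rightarrow> ('k, 'r::ab_group_add) ualg \<Rightarrow>
   (nat \<Rightarrow> 'r) \<Rightarrow> nat \<Rightarrow> (nat \<Rightarrow> ('a, 'l) cochain) \<Rightarrow> ('k, 'r, 'a, 'l) deform \<Rightarrow> bool" where
  "has_coeffs P R m n \<Psi> lam \<longleftrightarrow>
     (\<forall>a b. tmult lam (one_tensor R (actA P) a) (one_tensor R (actA P) b) = coeff_mult P R m n \<Psi> a b) \<and>
     (\<forall>x a. tanch lam (one_tensor R (actL P) x) (one_tensor R (actA P) a) = coeff_anch P R m n \<Psi> x a) \<and>
     (\<forall>x y. tbrk lam (one_tensor R (actL P) x) (one_tensor R (actL P) y) = coeff_brk P R m n \<Psi> x y)"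

definition indexed_basis ::
  "('k::field, 'r::ab_group_add) ualg \<Rightarrow> (nat \<Rightarrow> 'r) \<Rightarrow> nat \<Rightarrow> 'r set \<Rightarrow> bool" where
  "indexed_basis R m n V \<longleftrightarrow>
     inj_on m {1..n} \<and> \<not> module.dependent (smul R) (m ` {1..n}) \<and>
     module.span (smul R) (m ` {1..n}) = V"

text \<open>\<open>n\<^sub>i = (m\<^sub>i, 0)\<^sub>q\<close> for \<open>i \<le> n\<close> and \<open>n\<^sub>n\<^sub>+\<^sub>1 = (0, 1)\<^sub>q\<close>.\<close>

definition ext_basis ::
  "('k::field \<Rightarrow> 's::ab_group_add) \<Rightarrow> ('r::ab_group_add \<Rightarrow> 's) \<Rightarrow> (nat \<Rightarrow> 'r) \<Rightarrow> nat \<Rightarrow> nat \<Rightarrow> 's" where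
  "ext_basis i q m n j = (if j \<le> n then section_pair i q (m j) 0 else section_pair i q 0 1)"

text \<open>
  \<open>\<Theta> = (\<theta>\<^sub>A, \<theta>\<^sub>1, \<theta>\<^sub>2, \<theta>\<^sub>L)\<close> measures the failure of the triplet \<open>t\<close> over \<open>S\<close> to be a
  Courant pair; \<open>e\<close> stands for \<open>n\<^sub>n\<^sub>+\<^sub>1\<close>.
\<close>

definition defect_cochain ::
  "('k::field, 'a::ab_group_add, 'l::ab_group_add) courant \<Rightarrow> ('k, 's::ab_group_add) ualg \<Rightarrow>
   's \<Rightarrow> ('k, 's, 'a, 'l) deform \<Rightarrow> ('a, 'l) cochain \<Rightarrow> bool" where
  "defect_cochain P S e t \<Theta> \<longleftrightarrow>
     \<Theta> \<in> C_tot P 3 \<and>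
     (let \<iota>A = one_tensor S (actA P); \<iota>L = one_tensor S (actL P);
          eA = tensor (smul S) (actA P) e; eL = tensor (smul S) (actL P) e;
          m = tmult t; \<mu> = tanch t; br = tbrk t in
      (\<forall>a b c. eA (snd \<Theta> [] [a, b, c]) =
         m (\<iota>A a) (m (\<iota>A b) (\<iota>A c)) - m (m (\<iota>A a) (\<iota>A b)) (\<iota>A c)) \<and>
      (\<forall>x a b. eA (snd \<Theta> [x] [a, b]) =
         - (\<mu> (\<iota>L x) (m (\<iota>A a) (\<iota>A b)) - m (\<mu> (\<iota>L x) (\<iota>A a)) (\<iota>A b)
            - m (\<iota>A a) (\<mu> (\<iota>L x) (\<iota>A b)))) \<and>
      (\<forall>x y a. eA (snd \<Theta> [x, y] [a]) =
         \<mu> (br (\<iota>L x) (\<iota>L y)) (\<iota>A a) - \<mu> (\<iota>L x) (\<mu> (\<iota>L y) (\<iota>A a))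
         + \<mu> (\<iota>L y) (\<mu> (\<iota>L x) (\<iota>A a))) \<and>
      (\<forall>x y z. eL (fst \<Theta> [x, y, z]) =
         - (br (\<iota>L x) (br (\<iota>L y) (\<iota>L z)) - br (br (\<iota>L x) (\<iota>L y)) (\<iota>L z)
            - br (\<iota>L y) (br (\<iota>L x) (\<iota>L z)))))"

text \<open>
  \<open>\<Theta>\<close> is an obstruction cochain of \<open>\<lambda>\<close> for the extension \<open>S\<close>, for some choice of the section
  \<open>q\<close>, of the basis \<open>m\<close> of \<open>\<M>\<^sub>R\<close> and of \<open>\<Psi>\<^sub>n\<^sub>+\<^sub>1 \<in> C\<^sup>2\<^sub>t\<^sub>o\<^sub>t\<close>.
\<close>

definition obstruction_cochain ::
  "('k::field, 'a::ab_group_add, 'l::ab_group_add) courant \<Rightarrow> ('k, 'r::ab_group_add) ualg \<Rightarrow>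
   ('r \<Rightarrow> 'k) \<Rightarrow> ('k, 'r, 'a, 'l) deform \<Rightarrow> ('k, 's::ab_group_add) ualg \<Rightarrow> ('k \<Rightarrow> 's) \<Rightarrow>
   ('s \<Rightarrow> 'r) \<Rightarrow> ('a, 'l) cochain \<Rightarrow> bool" where
  "obstruction_cochain P R \<epsilon> lam S i p \<Theta> \<longleftrightarrow>
     (\<exists>q n m \<Psi>.
        linear_section R S p q \<and> indexed_basis R m n (aug_ideal \<epsilon>) \<and>
        (\<forall>j\<in>{1..n+1}. \<Psi> j \<in> C_tot P 2) \<and> has_coeffs P R m n \<Psi> lam \<and>
        defect_cochain P S (ext_basis i q m n (n + 1))
          (coeff_triplet P S (ext_basis i q m n) (n + 1) \<Psi>) \<Theta>)"

text \<open>
  \<open>\<Theta>\<^sub>\<lambda> : H\<^sup>2\<^sub>H\<^sub>a\<^sub>r\<^sub>r(R, \<bbbK>) \<rightarrow> H\<^sup>3\<^sub>C\<^sub>P(A, L)\<close>: the class of \<open>\<Theta>\<close>, which is the same for all choices. A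
  section identifies every extension of \<open>R\<close> by \<open>\<bbbK>\<close> with one on the vector space \<open>R \<oplus> \<bbbK>\<close>, so it
  suffices to consider algebras \<open>S\<close> on the type \<open>'r \<times> 'k\<close>.
\<close>

definition obstruction_map ::
  "('k::field, 'a::ab_group_add, 'l::ab_group_add) courant \<Rightarrow> ('k, 'r::ab_group_add) ualg \<Rightarrow>
   ('r \<Rightarrow> 'k) \<Rightarrow> ('k, 'r, 'a, 'l) deform \<Rightarrow> ('r \<Rightarrow> 'r \<Rightarrow> 'k) set \<Rightarrow> ('a, 'l) cochain set" where
  "obstruction_map P R \<epsilon> lam c =
     (THE h. \<exists>(S :: ('k, 'r \<times> 'k) ualg) i p \<Theta>.
        one_dim_extension R \<epsilon> S i p \<and> corresponds R \<epsilon> S i p c \<and>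
        obstruction_cochain P R \<epsilon> lam S i p \<Theta> \<and> h = class_CP P 3 \<Theta>)"

end

theory Submission
  imports Defs
begin

text \<open>
  Put \<open>e = i 1\<close>. The idea is to replace all choices by one notion: a \<^emph>\<open>lift\<close> of \<open>\<lambda>\<close> is an
  \<open>S\<close>-bilinear triplet \<open>T\<close> on \<open>(S \<otimes> A, S \<otimes> L)\<close> with \<open>p\<^sub>* T = \<lambda>\<close>. It has the shape of a
  deformation over \<open>S\<close> but may violate the four axioms of a Courant pair: associativity, the
  derivation property, compatibility of \<open>\<mu>\<close> with the brackets, and the Leibniz identity. Since
  \<open>\<lambda>\<close> satisfies them, the four defects of \<open>T\<close> lie in \<open>ker (p \<otimes> id) = e \<otimes> V\<close>, where \<open>V\<close> is \<open>A\<close> or \<open>L\<close>.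

  Everything rests on \<open>s e = \<epsilon>(p s) e\<close>. An \<open>S\<close>-linear map with values in \<open>e \<otimes> V\<close> depends only on the
  augmentation of its argument (\<open>kernel_valued_factors\<close>), so the defects amount to a cochain
  \<open>\<Theta>\<close> of \<open>(A, L)\<close> of degree three. A product of \<open>T\<close> with a factor in \<open>e \<otimes> V\<close> is the product of the
  undeformed pair with the augmentation of the other factor. This has three consequences.

  \<^item> \<open>\<Theta>\<close> is a cocycle (\<open>defect_cochain_cocycle\<close>): after applying \<open>e \<otimes> -\<close>, the equation \<open>\<delta>\<Theta> = 0\<close> becomes
    an identity among nested products which holds for arbitrary bilinear operations.
  \<^item> Two lifts differ by \<open>e \<otimes> \<Phi>\<close> for a cochain \<open>\<Phi>\<close> of degree two, and adding \<open>e \<otimes> \<Phi>\<close> to a lift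
    changes \<open>\<Theta>\<close> by exactly \<open>\<delta>\<Phi>\<close> (\<open>defect_cochain_difference\<close>). So the class of \<open>\<Theta>\<close> is the same for
    all lifts, and it vanishes if and only if some lift has defect zero.
  \<^item> The lifts with defect zero are the deformations \<open>\<lambda>'\<close> over \<open>S\<close> with \<open>p\<^sub>* \<lambda>' = \<lambda>\<close>
    (\<open>deformation_iff_zero_defect\<close>, \<open>push_out_eq_iff_lift\<close>).

  It remains to see that the class of \<open>\<Theta>\<close> is \<open>\<Theta>\<^sub>\<lambda>([\<psi>])\<close>. The triplets built from a section, a basis
  of \<open>\<M>\<^sub>R\<close> and structure constants are lifts (\<open>coeff_triplet_lift\<close>), and such data exist because \<open>R\<close>
  is finite dimensional. Extensions belonging to one Harrison class are connected by a morphism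
  (\<open>extension_morphism\<close>), and morphisms of extensions carry obstruction cochains to obstruction
  cochains (\<open>obstruction_cochain_transport\<close>). Hence all extensions on the vector space \<open>R \<oplus> \<bbbK>\<close> over which
  the obstruction map ranges give the class of \<open>\<Theta>\<close>.
\<close>

(* Tensors are functions. Addition of tensors must not be evaluated at an argument by simp, which
   would happen when unification eta-expands a sum. *)
declare plus_fun_apply [simp del] zero_fun_apply [simp del] minus_apply [simp del]
  uminus_apply [simp del]

section \<open>Linear algebra of tensor products\<close>

lemma linear_rules:
  assumes "Vector_Spaces.linear s t f"
  shows "f (x + y) = f x + f y" "f (s c x) = t c (f x)" "f 0 = 0" "f (- x) = - f x"
    "f (x - y) = f x - f y"
proof -
  interpret module_hom s t f using assms by (rule Vector_Spaces.linear.axioms(3))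
  show "f (x + y) = f x + f y" "f (s c x) = t c (f x)" "f 0 = 0" "f (- x) = - f x"
    "f (x - y) = f x - f y" by (simp_all add: add scale zero neg diff)
qed

lemma bilin_rules:
  assumes "bilin sU sV sW f"
  shows "f (x + y) v = f x v + f y v" "f u (v + w) = f u v + f u w"
    "f (sU c u) v = sW c (f u v)" "f u (sV c v) = sW c (f u v)"
    "f 0 v = 0" "f u 0 = 0" "f (- u) v = - f u v" "f u (- v) = - f u v"
    "f (x - y) v = f x v - f y v" "f u (v - w) = f u v - f u w"
  using linear_rules[of sU sW "\<lambda>u. f u v"] linear_rules[of sV sW "f u"] assms
  unfolding bilin_def by blast+

lemma bilin_intro:
  assumes "vector_space sU" "vector_space sV" "vector_space sW"
    "\<And>x y v. f (x + y) v = f x v + f y v" "\<And>u v w. f u (v + w) = f u v + f u w"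
    "\<And>c u v. f (sU c u) v = sW c (f u v)" "\<And>c u v. f u (sV c v) = sW c (f u v)"
  shows "bilin sU sV sW f"
  unfolding bilin_def using assms by (auto intro!: linear_intro)

lemma linear_vector_spaces:
  assumes "Vector_Spaces.linear s t f"
  shows "vector_space s" "vector_space t"
  using assms by (auto simp: Vector_Spaces.linear_def)

lemma vector_space_field: "vector_space ((*) :: 'k::field \<Rightarrow> _)"
  by unfold_locales (auto simp: algebra_simps)

lemma vector_space_rules:
  assumes "vector_space s"
  shows "s c (x + y) = s c x + s c y" "s (c + d) x = s c x + s d x" "s c (s d x) = s (c * d) x"
    "s 1 x = x" "s c 0 = 0" "s 0 x = 0"
proof -
  interpret vector_space s by fact
  show "s c (x + y) = s c x + s c y" "s (c + d) x = s c x + s d x" "s c (s d x) = s (c * d) x"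
    "s 1 x = x" "s c 0 = 0" "s 0 x = 0" by (simp_all add: scale_right_distrib scale_left_distrib)
qed

context
  fixes sU :: "'k::field \<Rightarrow> 'u::ab_group_add \<Rightarrow> 'u" and sV :: "'k \<Rightarrow> 'v::ab_group_add \<Rightarrow> 'v"
  assumes U: "vector_space sU" and V: "vector_space sV"
begin

lemmas tensor_rules = bilin_rules[OF bilin_tensor[OF U V]]

lemma tensor_space_tensor [simp]: "tensor sU sV u v \<in> tensor_space sU sV"
proof -
  interpret vector_space "tscale :: 'k \<Rightarrow> ('k, 'u, 'v) tens \<Rightarrow> _" by (rule vector_space_tscale)
  show ?thesis unfolding tensor_space_def by (rule span_base) auto
qed

lemma tensor_space_closed:
  "0 \<in> tensor_space sU sV"
  "x \<in> tensor_space sU sV \<Longrightarrow> y \<in> tensor_space sU sV \<Longrightarrow> x + y \<in> tensor_space sU sV"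
  "x \<in> tensor_space sU sV \<Longrightarrow> - x \<in> tensor_space sU sV"
  "x \<in> tensor_space sU sV \<Longrightarrow> y \<in> tensor_space sU sV \<Longrightarrow> x - y \<in> tensor_space sU sV"
  "x \<in> tensor_space sU sV \<Longrightarrow> tscale c x \<in> tensor_space sU sV"
proof -
  interpret vector_space "tscale :: 'k \<Rightarrow> ('k, 'u, 'v) tens \<Rightarrow> _" by (rule vector_space_tscale)
  show "0 \<in> tensor_space sU sV"
    "x \<in> tensor_space sU sV \<Longrightarrow> y \<in> tensor_space sU sV \<Longrightarrow> x + y \<in> tensor_space sU sV"
    "x \<in> tensor_space sU sV \<Longrightarrow> - x \<in> tensor_space sU sV"
    "x \<in> tensor_space sU sV \<Longrightarrow> y \<in> tensor_space sU sV \<Longrightarrow> x - y \<in> tensor_space sU sV"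
    "x \<in> tensor_space sU sV \<Longrightarrow> tscale c x \<in> tensor_space sU sV"
    unfolding tensor_space_def by (auto intro: span_zero span_add span_neg span_diff span_scale)
qed

lemma tensor_space_sum:
  "(\<And>j. j \<in> J \<Longrightarrow> f j \<in> tensor_space sU sV) \<Longrightarrow> sum f J \<in> tensor_space sU sV"
  by (induction J rule: infinite_finite_induct) (auto simp: tensor_space_closed)

lemma tensor_space_induct [consumes 1, case_names zero add tensor]:
  assumes t: "t \<in> tensor_space sU sV" and 0: "Q 0"
    and add: "\<And>x y. x \<in> tensor_space sU sV \<Longrightarrow> y \<in> tensor_space sU sV \<Longrightarrow> Q x \<Longrightarrow> Q y \<Longrightarrow> Q (x + y)"
    and tn: "\<And>u v. Q (tensor sU sV u v)"
  shows "Q t"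
proof -
  interpret vector_space "tscale :: 'k \<Rightarrow> ('k, 'u, 'v) tens \<Rightarrow> _" by (rule vector_space_tscale)
  have "t \<in> tensor_space sU sV \<and> Q t"
    using t[unfolded tensor_space_def]
  proof (induction rule: span_induct_alt)
    case base
    then show ?case by (simp add: 0 tensor_space_closed)
  next
    case (step c x y)
    then obtain u v where x: "x = tensor sU sV u v" by auto
    have "tscale c x = tensor sU sV (sU c u) v" by (simp add: x tensor_rules)
    then show ?case using step add[of "tscale c x" y] tn[of "sU c u" v]
      by (simp add: tensor_space_closed)
  qed
  then show ?thesis ..
qed

text \<open>
  Additivity suffices for uniqueness on \<open>U \<otimes> V\<close>, since a scalar multiple of a pure tensor is again
  a pure tensor.
\<close>

lemma additive_eq_on_tensor_space:
  fixes F G :: "('k, 'u, 'v) tens \<Rightarrow> 'w::ab_group_add"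
  assumes t: "t \<in> tensor_space sU sV"
    and F: "\<And>x y. x \<in> tensor_space sU sV \<Longrightarrow> y \<in> tensor_space sU sV \<Longrightarrow> F (x + y) = F x + F y"
    and G: "\<And>x y. x \<in> tensor_space sU sV \<Longrightarrow> y \<in> tensor_space sU sV \<Longrightarrow> G (x + y) = G x + G y"
    and FG: "\<And>u v. F (tensor sU sV u v) = G (tensor sU sV u v)"
  shows "F t = G t"
  using t
proof (induction rule: tensor_space_induct)
  case zero
  show ?case using F[of 0 0] G[of 0 0] by (simp add: tensor_space_closed)
qed (auto simp: F G FG)

lemma tensor_lift_rules:
  assumes "bilin sU sV sW f"
  shows "tensor_lift sU sV sW f (x + y) = tensor_lift sU sV sW f x + tensor_lift sU sV sW f y"
    "tensor_lift sU sV sW f (tscale c x) = sW c (tensor_lift sU sV sW f x)"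
    "tensor_lift sU sV sW f 0 = 0"
    "tensor_lift sU sV sW f (- x) = - tensor_lift sU sV sW f x"
    "tensor_lift sU sV sW f (x - y) = tensor_lift sU sV sW f x - tensor_lift sU sV sW f y"
    "tensor_lift sU sV sW f (tensor sU sV u v) = f u v"
  using linear_rules[OF tensor_lift(1)[OF assms]] tensor_lift(2)[OF assms] by auto

lemma tensor_lift_closed:
  assumes "bilin sU sV tscale f" "\<And>u v. f u v \<in> tensor_space sA sB"
    "t \<in> tensor_space sU sV" "vector_space sA" "vector_space sB"
  shows "tensor_lift sU sV tscale f t \<in> tensor_space sA sB"
  using assms(3)
proof (induction rule: tensor_space_induct)
  case zero
  show ?case by (simp add: tensor_lift_rules[OF assms(1)] tensor_space_def module.span_zero
        vector_space_tscale module_iff_vector_space)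
next
  case (add x y)
  then show ?case by (simp add: tensor_lift_rules[OF assms(1)] tensor_space_def module.span_add
        vector_space_tscale module_iff_vector_space)
qed (simp add: tensor_lift_rules[OF assms(1)] assms(2))

end


section \<open>Scalar extension\<close>

abbreviation ext_space (infixl "\<otimes>s" 70) where
  "S \<otimes>s sV \<equiv> tensor_space (smul S) sV"

locale base_algebra =
  fixes S :: "('k::field, 's::ab_group_add) ualg"
  assumes comm: "comm_alg S"
begin

lemma smul_vs: "vector_space (smul S)"
  and bilin_amul: "bilin (smul S) (smul S) (smul S) (amul S)"
  and assoc: "amul S (amul S r s) t = amul S r (amul S s t)"
  and commute: "amul S r s = amul S s r"
  and unit [simp]: "amul S (aunit S) r = r" "amul S r (aunit S) = r"
  using comm unfolding comm_alg_def by (blast, blast, blast, blast, blast, metis)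

lemmas amul_rules = bilin_rules[OF bilin_amul]

lemma left_commute: "amul S r (amul S s t) = amul S s (amul S r t)"
  by (metis assoc commute)

context
  fixes sV :: "'k \<Rightarrow> 'v::ab_group_add \<Rightarrow> 'v"
  assumes V: "vector_space sV"
begin

lemmas ten_rules = tensor_rules[OF smul_vs V]
lemmas ext_closed = tensor_space_closed[OF smul_vs V]
lemmas ext_eq = additive_eq_on_tensor_space[OF smul_vs V]

lemma one_tensor_closed [simp]: "one_tensor S sV v \<in> S \<otimes>s sV"
  by (simp add: one_tensor_def tensor_space_tensor[OF smul_vs V])

lemma bilin_base_act: "bilin (smul S) sV tscale (\<lambda>r v. tensor (smul S) sV (amul S s r) v)"
  by (intro bilin_intro smul_vs V vector_space_tscale) (simp_all add: ten_rules amul_rules)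

lemmas base_act_rules = tensor_lift_rules[OF smul_vs V bilin_base_act, folded base_act_def]

lemma base_act_closed [simp]: "t \<in> S \<otimes>s sV \<Longrightarrow> base_act S sV s t \<in> S \<otimes>s sV"
  unfolding base_act_def
  by (rule tensor_lift_closed[OF smul_vs V bilin_base_act]) (simp_all add: smul_vs V tensor_space_tensor)

lemma base_act_one: "base_act S sV s (one_tensor S sV v) = tensor (smul S) sV s v"
  by (simp add: one_tensor_def base_act_rules)

lemma base_act_mult:
  "t \<in> S \<otimes>s sV \<Longrightarrow> base_act S sV (amul S r s) t = base_act S sV r (base_act S sV s t)"
  by (rule ext_eq[where F = "base_act S sV (amul S r s)"]) (simp_all add: base_act_rules assoc)

lemma base_act_add:
  "t \<in> S \<otimes>s sV \<Longrightarrow> base_act S sV (r + s) t = base_act S sV r t + base_act S sV s t"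
  by (rule ext_eq[where F = "base_act S sV (r + s)"])
    (simp_all add: base_act_rules amul_rules ten_rules)

lemma base_act_smul:
  "t \<in> S \<otimes>s sV \<Longrightarrow> base_act S sV (smul S k r) t = tscale k (base_act S sV r t)"
  by (rule ext_eq[where F = "base_act S sV (smul S k r)"])
    (simp_all add: base_act_rules amul_rules ten_rules vector_space_rules[OF vector_space_tscale])

lemma base_act_unit: "t \<in> S \<otimes>s sV \<Longrightarrow> base_act S sV (aunit S) t = t"
  by (rule ext_eq[where F = "base_act S sV (aunit S)" and G = "\<lambda>t. t"])
    (simp_all add: base_act_rules)

lemma module_on_ext: "module_on S (base_act S sV) (S \<otimes>s sV)"
  unfolding module_on_def
  by (simp add: ext_closed base_act_rules base_act_add base_act_mult base_act_unit)

lemma one_tensor_rules: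
  "one_tensor S sV (x + y) = one_tensor S sV x + one_tensor S sV y"
  "one_tensor S sV (sV c x) = tscale c (one_tensor S sV x)"
  by (simp_all add: one_tensor_def ten_rules)

end

end

abbreviation ext_bilinear where
  "ext_bilinear S sU sV sW f \<equiv>
     bilinear_on (base_act S sU) (S \<otimes>s sU) (base_act S sV) (S \<otimes>s sV)
       (base_act S sW) (S \<otimes>s sW) f"

lemma ext_bilinear_rules:
  fixes S :: "('k::field, 's::ab_group_add) ualg"
  assumes f: "ext_bilinear S sU sV sW f" and S: "comm_alg S"
    and vs: "vector_space sU" "vector_space sV" "vector_space sW"
    and t: "t \<in> S \<otimes>s sU" and u: "u \<in> S \<otimes>s sV"
  shows "f t u \<in> S \<otimes>s sW"
    "x \<in> S \<otimes>s sU \<Longrightarrow> f (t + x) u = f t u + f x u"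
    "y \<in> S \<otimes>s sV \<Longrightarrow> f t (u + y) = f t u + f t y"
    "x \<in> S \<otimes>s sU \<Longrightarrow> f (t - x) u = f t u - f x u"
    "y \<in> S \<otimes>s sV \<Longrightarrow> f t (u - y) = f t u - f t y"
    "f (- t) u = - f t u" "f t (- u) = - f t u"
    "f 0 u = 0" "f t 0 = 0"
    "f (base_act S sU s t) u = base_act S sW s (f t u)"
    "f t (base_act S sV s u) = base_act S sW s (f t u)"
    "f (tscale c t) u = tscale c (f t u)"
    "f t (tscale c u) = tscale c (f t u)"
proof -
  interpret S: base_algebra S by (rule base_algebra.intro[OF S])
  note cl = S.ext_closed[OF vs(1)] S.ext_closed[OF vs(2)]
  have 1: "f (x + x') y = f x y + f x' y" "f x (y + y') = f x y + f x y'"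
     "f (base_act S sU s x) y = base_act S sW s (f x y)"
     "f x (base_act S sV s y) = base_act S sW s (f x y)" "f x y \<in> S \<otimes>s sW"
    if "x \<in> S \<otimes>s sU" "x' \<in> S \<otimes>s sU" "y \<in> S \<otimes>s sV" "y' \<in> S \<otimes>s sV" for x x' y y' s
    using f that unfolding bilinear_on_def linear_on_def by auto
  show "f t u \<in> S \<otimes>s sW"
    "x \<in> S \<otimes>s sU \<Longrightarrow> f (t + x) u = f t u + f x u"
    "y \<in> S \<otimes>s sV \<Longrightarrow> f t (u + y) = f t u + f t y"
    "f (base_act S sU s t) u = base_act S sW s (f t u)"
    "f t (base_act S sV s u) = base_act S sW s (f t u)"
    using 1 t u by auto
  show z: "f 0 u = 0" "f t 0 = 0" using 1(1)[of 0 0 u u] 1(2)[of t t 0 0] t u by (auto simp: cl)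
  show n: "f (- t) u = - f t u" "f t (- u) = - f t u"
    using 1(1)[of t "- t" u u] 1(2)[of t t u "- u"] t u z
    by (auto simp: cl eq_neg_iff_add_eq_0 add.commute)
  have n': "f (- x) u = - f x u" if "x \<in> S \<otimes>s sU" for x
    using 1(1)[of x "- x" u u] that u z by (auto simp: cl eq_neg_iff_add_eq_0 add.commute)
  have n'': "f t (- y) = - f t y" if "y \<in> S \<otimes>s sV" for y
    using 1(2)[of t t y "- y"] that t z by (auto simp: cl eq_neg_iff_add_eq_0 add.commute)
  show "f (t - x) u = f t u - f x u" if "x \<in> S \<otimes>s sU"
    using 1(1)[of t "- x" u u] that t u by (simp add: cl n')
  show "f t (u - y) = f t u - f t y" if "y \<in> S \<otimes>s sV"
    using 1(2)[of t t u "- y"] that t u by (simp add: cl n'')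
  have k: "tscale c t = base_act S sU (smul S c (aunit S)) t"
      "tscale c u = base_act S sV (smul S c (aunit S)) u"
      "tscale c (f t u) = base_act S sW (smul S c (aunit S)) (f t u)"
    using t u 1(5)[of t t u u]
    by (simp_all add: S.base_act_smul vs S.base_act_unit)
  show "f (tscale c t) u = tscale c (f t u)" "f t (tscale c u) = tscale c (f t u)"
    unfolding k by (rule 1(3,4)[OF t t u u])+
qed


section \<open>Base change\<close>

lemma bilin_base_change:
  assumes "Vector_Spaces.linear (smul R) (smul S) \<phi>" "vector_space sV"
  shows "bilin (smul R) sV tscale (\<lambda>r v. tensor (smul S) sV (\<phi> r) v)"
  using assms by (intro bilin_intro vector_space_tscale linear_vector_spaces[OF assms(1)])
    (simp_all add: linear_rules[OF assms(1)] tensor_rules linear_vector_spaces[OF assms(1)])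

lemma base_change_rules:
  assumes l: "Vector_Spaces.linear (smul R) (smul S) \<phi>" and V: "vector_space sV"
  shows "base_change R S sV \<phi> (x + y) = base_change R S sV \<phi> x + base_change R S sV \<phi> y"
    "base_change R S sV \<phi> (tscale c x) = tscale c (base_change R S sV \<phi> x)"
    "base_change R S sV \<phi> 0 = 0"
    "base_change R S sV \<phi> (- x) = - base_change R S sV \<phi> x"
    "base_change R S sV \<phi> (x - y) = base_change R S sV \<phi> x - base_change R S sV \<phi> y"
    "base_change R S sV \<phi> (tensor (smul R) sV r v) = tensor (smul S) sV (\<phi> r) v"
  unfolding base_change_def
  by (rule tensor_lift_rules[OF linear_vector_spaces(1)[OF l] V bilin_base_change[OF l V]])+

lemma base_change_closed:
  assumes "Vector_Spaces.linear (smul R) (smul S) \<phi>" "vector_space sV" "t \<in> R \<otimes>s sV"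
  shows "base_change R S sV \<phi> t \<in> S \<otimes>s sV"
  unfolding base_change_def
  by (rule tensor_lift_closed[OF linear_vector_spaces(1)[OF assms(1)] assms(2)
        bilin_base_change[OF assms(1,2)] _ assms(3)])
    (simp_all add: assms linear_vector_spaces(2)[OF assms(1)] tensor_space_tensor)

lemma alg_hom_rules:
  assumes "alg_hom R S \<phi>"
  shows "Vector_Spaces.linear (smul R) (smul S) \<phi>" "\<phi> (amul R r s) = amul S (\<phi> r) (\<phi> s)"
    "\<phi> (aunit R) = aunit S"
  using assms by (auto simp: alg_hom_def)

lemma base_change_base_act:
  assumes \<phi>: "alg_hom R S \<phi>" and "comm_alg R" "comm_alg S" and V: "vector_space sV"
    and t: "t \<in> R \<otimes>s sV"
  shows "base_change R S sV \<phi> (base_act R sV r t) = base_act S sV (\<phi> r) (base_change R S sV \<phi> t)"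
proof -
  interpret R: base_algebra R by (rule base_algebra.intro) fact
  interpret S: base_algebra S by (rule base_algebra.intro) fact
  note r = base_change_rules[OF alg_hom_rules(1)[OF \<phi>] V]
  show ?thesis
    by (rule R.ext_eq[OF V t]) (simp_all add: r R.base_act_rules[OF V] S.base_act_rules[OF V]
        alg_hom_rules[OF \<phi>])
qed

lemma base_change_one:
  assumes \<phi>: "alg_hom R S \<phi>" and V: "vector_space sV"
  shows "base_change R S sV \<phi> (one_tensor R sV v) = one_tensor S sV v"
  unfolding one_tensor_def
  by (simp add: base_change_rules[OF alg_hom_rules(1)[OF \<phi>] V]
    alg_hom_rules[OF \<phi>])

text \<open>
  Bilinear maps over \<open>R\<close> and \<open>S\<close> are determined by their values on \<open>1 \<otimes> U\<close> and \<open>1 \<otimes> V\<close>, so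
  compatibility with a base change need only be checked there.
\<close>

lemma base_change_ext_bilinear:
  assumes \<phi>: "alg_hom R S \<phi>" and RS: "comm_alg R" "comm_alg S"
    and vs: "vector_space sU" "vector_space sV" "vector_space sW"
    and f: "ext_bilinear R sU sV sW f" and g: "ext_bilinear S sU sV sW g"
    and fg: "\<And>u v. base_change R S sW \<phi> (f (one_tensor R sU u) (one_tensor R sV v)) =
      g (one_tensor S sU u) (one_tensor S sV v)"
    and t: "t \<in> R \<otimes>s sU" and u: "u \<in> R \<otimes>s sV"
  shows "base_change R S sW \<phi> (f t u) = g (base_change R S sU \<phi> t) (base_change R S sV \<phi> u)"
proof -
  interpret R: base_algebra R by (rule base_algebra.intro) fact
  interpret S: base_algebra S by (rule base_algebra.intro) fact
  note l = alg_hom_rules(1)[OF \<phi>]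
  note bU = base_change_rules[OF l vs(1)] base_change_closed[OF l vs(1)]
  note bV = base_change_rules[OF l vs(2)] base_change_closed[OF l vs(2)]
  note bW = base_change_rules[OF l vs(3)] base_change_closed[OF l vs(3)]
  note fr = ext_bilinear_rules[OF f RS(1) vs] and gr = ext_bilinear_rules[OF g RS(2) vs]
  have 1: "base_change R S sW \<phi> (f (tensor (smul R) sU r a) (tensor (smul R) sV r' b)) =
     g (tensor (smul S) sU (\<phi> r) a) (tensor (smul S) sV (\<phi> r') b)" for r r' a b
  proof -
    have "base_change R S sW \<phi> (f (base_act R sU r (one_tensor R sU a)) (base_act R sV r' (one_tensor R sV b)))
      = g (base_act S sU (\<phi> r) (one_tensor S sU a)) (base_act S sV (\<phi> r') (one_tensor S sV b))"
      by (simp add: fr gr vs fg base_change_base_act[OF \<phi> RS])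
    then show ?thesis by (simp add: R.base_act_one S.base_act_one vs)
  qed
  have 2: "base_change R S sW \<phi> (f t (tensor (smul R) sV r' b)) =
     g (base_change R S sU \<phi> t) (tensor (smul S) sV (\<phi> r') b)" for r' b
    by (rule R.ext_eq[OF vs(1) t])
      (simp_all add: 1 bU bW fr gr tensor_space_tensor R.smul_vs S.smul_vs vs)
  show ?thesis
    by (rule R.ext_eq[OF vs(2) u])
      (simp_all add: 2 t bU bV bW fr gr tensor_space_tensor R.smul_vs S.smul_vs vs)
qed

lemma base_change_id:
  assumes R: "comm_alg R" and V: "vector_space sV" and t: "t \<in> R \<otimes>s sV"
  shows "base_change R R sV (\<lambda>r. r) t = t"
proof -
  interpret R: base_algebra R by (rule base_algebra.intro) fact
  have l: "Vector_Spaces.linear (smul R) (smul R) (\<lambda>r. r)" by (intro linear_intro R.smul_vs) auto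
  show ?thesis
    by (rule R.ext_eq[OF V t]) (simp_all add: base_change_rules[OF l V])
qed

lemma ext_bilinear_eq:
  assumes R: "comm_alg R" and vs: "vector_space sU" "vector_space sV" "vector_space sW"
    and f: "ext_bilinear R sU sV sW f" and g: "ext_bilinear R sU sV sW g"
    and fg: "\<And>u v. f (one_tensor R sU u) (one_tensor R sV v) =
      g (one_tensor R sU u) (one_tensor R sV v)"
    and t: "t \<in> R \<otimes>s sU" and u: "u \<in> R \<otimes>s sV"
  shows "f t u = g t u"
proof -
  interpret R: base_algebra R by (rule base_algebra.intro) fact
  have h: "alg_hom R R (\<lambda>r. r)" unfolding alg_hom_def by (auto intro!: linear_intro R.smul_vs)
  have "base_change R R sW (\<lambda>r. r) (f t u) =
      g (base_change R R sU (\<lambda>r. r) t) (base_change R R sV (\<lambda>r. r) u)"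
    by (rule base_change_ext_bilinear[OF h R R vs f g _ t u])
      (simp add: base_change_id[OF R] vs fg ext_bilinear_rules[OF g R vs] R.one_tensor_closed)
  then show ?thesis
    by (simp add: base_change_id[OF R] vs t u ext_bilinear_rules(1)[OF f R vs])
qed

text \<open>
  In the iterated lift that defines \<open>scalar_ext\<close>, bilinearity of the inner lift as a function of
  \<open>r\<^sub>1\<close> and \<open>u\<close> follows from the uniqueness of lifts, and so only for arguments \<open>t' \<in> S \<otimes> V\<close>.
\<close>

lemma scalar_ext:
  assumes S: "comm_alg S" and vs: "vector_space sU" "vector_space sV" "vector_space sW"
    and f: "bilin sU sV tscale f" and fc: "\<And>u v. f u v \<in> S \<otimes>s sW"
  shows "ext_bilinear S sU sV sW (scalar_ext S sU sV sW f)"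
    and "scalar_ext S sU sV sW f (one_tensor S sU u) (one_tensor S sV v) = f u v"
proof -
  interpret S: base_algebra S by (rule base_algebra.intro) fact
  define inner where "inner r1 u =
    tensor_lift (smul S) sV tscale (\<lambda>r2 v. base_act S sW (amul S r1 r2) (f u v))" for r1 u
  let ?F = "scalar_ext S sU sV sW f"
  note br = S.base_act_rules[OF vs(3)] S.base_act_add[OF vs(3)] S.base_act_mult[OF vs(3)]
    S.base_act_smul[OF vs(3)] S.base_act_closed[OF vs(3)]
  have "bilin (smul S) sV tscale (\<lambda>r2 v. base_act S sW (amul S r1 r2) (f u v))" for r1 u
    by (intro bilin_intro S.smul_vs vs vector_space_tscale)
      (simp_all add: bilin_rules[OF f] S.amul_rules br fc)
  note in_r = tensor_lift_rules[OF S.smul_vs vs(2) this, folded inner_def] and in_b = this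
  have in_c: "inner r1 u t \<in> S \<otimes>s sW" if "t \<in> S \<otimes>s sV" for r1 u t
    unfolding inner_def
    by (rule tensor_lift_closed[OF S.smul_vs vs(2) in_b]) (simp_all add: that S.smul_vs vs fc br)
  have out_b: "bilin (smul S) sU tscale (\<lambda>r u. inner r u t)" if "t \<in> S \<otimes>s sV" for t
  proof (intro bilin_intro S.smul_vs vs vector_space_tscale)
    fix x y v c
    show "inner (x + y) v t = inner x v t + inner y v t"
      by (rule S.ext_eq[OF vs(2) that]) (simp_all add: in_r S.amul_rules br fc)
    show "inner (smul S c x) v t = tscale c (inner x v t)"
      by (rule S.ext_eq[OF vs(2) that])
        (simp_all add: in_r S.amul_rules br fc vector_space_rules[OF vector_space_tscale])
  next
    fix x u v c
    show "inner x (u + v) t = inner x u t + inner x v t"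
      by (rule S.ext_eq[OF vs(2) that]) (simp_all add: in_r bilin_rules[OF f] br fc)
    show "inner x (sU c u) t = tscale c (inner x u t)"
      by (rule S.ext_eq[OF vs(2) that])
        (simp_all add: in_r bilin_rules[OF f] br fc vector_space_rules[OF vector_space_tscale])
  qed
  have F_eq: "?F t t' = tensor_lift (smul S) sU tscale (\<lambda>r u. inner r u t') t" for t t'
    unfolding scalar_ext_def inner_def ..
  note out_r = tensor_lift_rules[OF S.smul_vs vs(1) out_b, folded F_eq]
  have Fc: "?F t t' \<in> S \<otimes>s sW" if "t \<in> S \<otimes>s sU" "t' \<in> S \<otimes>s sV" for t t'
    unfolding F_eq
    by (rule tensor_lift_closed[OF S.smul_vs vs(1) out_b]) (simp_all add: that S.smul_vs vs in_c)
  have 1: "?F t (x + y) = ?F t x + ?F t y"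
    if "t \<in> S \<otimes>s sU" "x \<in> S \<otimes>s sV" "y \<in> S \<otimes>s sV" for t x y
    by (rule S.ext_eq[OF vs(1) that(1)])
      (simp_all add: out_r that S.ext_closed[OF vs(2)] in_r)
  have ss: "?F (base_act S sU r t) u = base_act S sW r (?F t u)"
      "?F t (base_act S sV r u) = base_act S sW r (?F t u)"
    if t: "t \<in> S \<otimes>s sU" and u: "u \<in> S \<otimes>s sV" for r t u
  proof -
    note tt = tensor_space_tensor[OF S.smul_vs]
    show "?F (base_act S sU r t) u = base_act S sW r (?F t u)"
    proof (rule S.ext_eq[OF vs(1) t])
      show "?F (base_act S sU r (tensor (smul S) sU a b)) u = base_act S sW r (?F (tensor (smul S) sU a b) u)" for a b
        by (rule S.ext_eq[OF vs(2) u])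
          (simp_all add: out_r br S.base_act_rules vs tt u 1 in_r fc S.assoc S.ext_closed[OF vs(2)] S.base_act_closed)
    qed (simp_all add: out_r u S.base_act_rules vs)
    show "?F t (base_act S sV r u) = base_act S sW r (?F t u)"
    proof (rule S.ext_eq[OF vs(1) t])
      show "?F (tensor (smul S) sU a b) (base_act S sV r u) = base_act S sW r (?F (tensor (smul S) sU a b) u)" for a b
        by (rule S.ext_eq[OF vs(2) u])
          (simp_all add: out_r br S.base_act_rules vs tt u 1 in_r fc S.left_commute S.ext_closed[OF vs(2)] S.base_act_closed flip: S.base_act_mult[OF vs(3)])
    qed (simp_all add: out_r u S.base_act_rules S.base_act_closed vs)
  qed
  show "ext_bilinear S sU sV sW ?F"
    unfolding bilinear_on_def linear_on_def by (simp add: Fc 1 ss out_r)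
  show "?F (one_tensor S sU u) (one_tensor S sV v) = f u v"
    unfolding one_tensor_def
    by (simp add: out_r in_r tensor_space_tensor[OF S.smul_vs] vs S.base_act_unit fc)
qed


section \<open>Augmentations and one-dimensional extensions\<close>

lemma bilin_augmentation:
  assumes "Vector_Spaces.linear (smul R) (*) \<epsilon>" "vector_space sV"
  shows "bilin (smul R) sV sV (\<lambda>r v. sV (\<epsilon> r) v)"
  using assms by (intro bilin_intro linear_vector_spaces[OF assms(1)])
    (simp_all add: linear_rules[OF assms(1)] vector_space_rules[OF assms(2)] mult.commute)

lemma aug_map_rules:
  assumes l: "Vector_Spaces.linear (smul R) (*) \<epsilon>" and V: "vector_space sV"
  shows "aug_map R sV \<epsilon> (x + y) = aug_map R sV \<epsilon> x + aug_map R sV \<epsilon> y"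
    "aug_map R sV \<epsilon> (tscale c x) = sV c (aug_map R sV \<epsilon> x)"
    "aug_map R sV \<epsilon> 0 = 0"
    "aug_map R sV \<epsilon> (- x) = - aug_map R sV \<epsilon> x"
    "aug_map R sV \<epsilon> (x - y) = aug_map R sV \<epsilon> x - aug_map R sV \<epsilon> y"
    "aug_map R sV \<epsilon> (tensor (smul R) sV r v) = sV (\<epsilon> r) v"
  unfolding aug_map_def
  by (rule tensor_lift_rules[OF linear_vector_spaces(1)[OF l] V bilin_augmentation[OF l V]])+

locale augmented_algebra = base_algebra R for R :: "('k::field, 'r::ab_group_add) ualg" +
  fixes \<epsilon> :: "'r \<Rightarrow> 'k"
  assumes augmentation: "augmentation R \<epsilon>"
begin

lemma aug_linear: "Vector_Spaces.linear (smul R) (*) \<epsilon>"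
  and aug_amul: "\<epsilon> (amul R r s) = \<epsilon> r * \<epsilon> s" and aug_unit: "\<epsilon> (aunit R) = 1"
  using augmentation by (auto simp: augmentation_def alg_hom_def base_field_def)

lemma aug_one: "vector_space sV \<Longrightarrow> aug_map R sV \<epsilon> (one_tensor R sV v) = v"
  unfolding one_tensor_def by (simp add: aug_map_rules aug_linear aug_unit vector_space_rules)

lemma aug_base_act:
  assumes V: "vector_space sV" and t: "t \<in> R \<otimes>s sV"
  shows "aug_map R sV \<epsilon> (base_act R sV r t) = sV (\<epsilon> r) (aug_map R sV \<epsilon> t)"
  by (rule ext_eq[OF V t])
    (simp_all add: base_act_rules V aug_map_rules aug_linear vector_space_rules[OF V] aug_amul)

text \<open>The analogue of \<open>base_change_ext_bilinear\<close> for \<open>\<epsilon>\<close>, with \<open>\<bbbK> \<otimes> V\<close> replaced by \<open>V\<close>.\<close>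

lemma aug_ext_bilinear:
  assumes vs: "vector_space sU" "vector_space sV" "vector_space sW"
    and f: "ext_bilinear R sU sV sW f" and g: "bilin sU sV sW g"
    and fg: "\<And>u v. aug_map R sW \<epsilon> (f (one_tensor R sU u) (one_tensor R sV v)) = g u v"
    and t: "t \<in> R \<otimes>s sU" and u: "u \<in> R \<otimes>s sV"
  shows "aug_map R sW \<epsilon> (f t u) = g (aug_map R sU \<epsilon> t) (aug_map R sV \<epsilon> u)"
proof -
  note fr = ext_bilinear_rules[OF f comm vs]
  note r = aug_map_rules[OF aug_linear] bilin_rules[OF g]
  have 1: "aug_map R sW \<epsilon> (f (tensor (smul R) sU r a) (tensor (smul R) sV r' b)) =
     g (sU (\<epsilon> r) a) (sV (\<epsilon> r') b)" for r r' a b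
  proof -
    have "aug_map R sW \<epsilon> (f (base_act R sU r (one_tensor R sU a)) (base_act R sV r' (one_tensor R sV b)))
      = g (sU (\<epsilon> r) a) (sV (\<epsilon> r') b)"
      by (simp add: fr vs fg r aug_base_act)
    then show ?thesis by (simp add: base_act_one vs)
  qed
  have 2: "aug_map R sW \<epsilon> (f t (tensor (smul R) sV r' b)) =
     g (aug_map R sU \<epsilon> t) (sV (\<epsilon> r') b)" for r' b
    by (rule ext_eq[OF vs(1) t]) (simp_all add: 1 fr r tensor_space_tensor smul_vs vs vector_space_rules[OF vs(3)])
  show ?thesis
    by (rule ext_eq[OF vs(2) u]) (simp_all add: 2 t r fr tensor_space_tensor smul_vs vs)
qed

end

locale extension = R: augmented_algebra R \<epsilon> for R :: "('k::field, 'r::ab_group_add) ualg" and \<epsilon> +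
  fixes S :: "('k, 's::ab_group_add) ualg" and i :: "'k \<Rightarrow> 's" and p :: "'s \<Rightarrow> 'r"
  assumes ext: "one_dim_extension R \<epsilon> S i p"
begin

lemma comm_S: "comm_alg S" and p_hom: "alg_hom S R p"
  and i_linear: "Vector_Spaces.linear (*) (smul S) i" and i_inj: "inj i"
  and i_range: "range i = {s. p s = 0}" and p_surj: "surj p"
  and amul_i: "amul S s (i k) = i (\<epsilon> (p s) * k)"
  using ext by (auto simp: one_dim_extension_def)

lemmas p_linear = alg_hom_rules(1)[OF p_hom]

sublocale S: augmented_algebra S "\<epsilon> \<circ> p"
proof
  show "comm_alg S" by (rule comm_S)
  have "Vector_Spaces.linear (smul S) (*) (\<epsilon> \<circ> p)"
    by (rule Vector_Spaces.linear_compose[OF p_linear R.aug_linear])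
  then show "augmentation S (\<epsilon> \<circ> p)"
    by (simp add: augmentation_def alg_hom_def base_field_def alg_hom_rules[OF p_hom] R.aug_amul
        R.aug_unit)
qed

text \<open>The embedding of \<open>V\<close> onto the kernel of \<open>p \<otimes> id : S \<otimes> V \<rightarrow> R \<otimes> V\<close>.\<close>

definition emb :: "('k \<Rightarrow> 'v::ab_group_add \<Rightarrow> 'v) \<Rightarrow> 'v \<Rightarrow> ('k, 's, 'v) tens" where
  "emb sV v = tensor (smul S) sV (i 1) v"

lemma p_i: "p (i k) = 0"
  using i_range by auto

lemma amul_i1: "amul S s (i 1) = smul S (\<epsilon> (p s)) (i 1)"
  using amul_i[of s 1] linear_rules(2)[OF i_linear, of "\<epsilon> (p s)" 1] by simp

lemma section_exists: "\<exists>q. linear_section R S p q"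
proof -
  have pr: "vector_space_pair (smul S) (smul R)"
    by (simp add: vector_space_pair_def S.smul_vs R.smul_vs)
  obtain q where "Vector_Spaces.linear (smul R) (smul S) q" "p \<circ> q = id"
    using vector_space_pair.linear_surjective_right_inverse[OF pr p_linear p_surj] by blast
  then show ?thesis unfolding linear_section_def by (metis comp_apply id_apply)
qed

lemma section_coefficient:
  assumes "linear_section R S p q"
  obtains \<kappa> where "Vector_Spaces.linear (smul S) (*) \<kappa>" "\<And>s. s = q (p s) + i (\<kappa> s)"
    "\<And>r k. \<kappa> (q r + i k) = k"
proof -
  have ql: "Vector_Spaces.linear (smul R) (smul S) q" and pq: "p (q r) = r" for r
    using assms by (auto simp: linear_section_def)
  have "\<exists>k. s - q (p s) = i k" for s
  proof -
    have "p (s - q (p s)) = 0" by (simp add: linear_rules[OF p_linear] pq)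
    then show ?thesis using i_range by blast
  qed
  then obtain \<kappa> where \<kappa>: "\<And>s. s - q (p s) = i (\<kappa> s)" by metis
  have eq: "k = l" if "i k = i l" for k l using that i_inj by (simp add: inj_eq)
  have "Vector_Spaces.linear (smul S) (*) \<kappa>"
  proof (rule linear_intro[OF S.smul_vs vector_space_field])
    show "\<kappa> (x + y) = \<kappa> x + \<kappa> y" for x y
      by (rule eq) (simp add: linear_rules[OF i_linear] linear_rules[OF ql]
          linear_rules[OF p_linear] flip: \<kappa>)
    show "\<kappa> (smul S c x) = c * \<kappa> x" for c x
      by (rule eq) (simp add: linear_rules[OF i_linear] linear_rules[OF ql]
          linear_rules[OF p_linear] bilin_rules[OF S.bilin_amul] flip: \<kappa>,
          metis S.smul_vs module.scale_right_diff_distrib module_iff_vector_space)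
  qed
  moreover have "\<kappa> (q r + i k) = k" for r k
    by (rule eq) (simp add: p_i pq linear_rules[OF p_linear] flip: \<kappa>)
  moreover have "s = q (p s) + i (\<kappa> s)" for s by (simp flip: \<kappa>)
  ultimately show thesis by (intro that)
qed

context
  fixes sV :: "'k \<Rightarrow> 'v::ab_group_add \<Rightarrow> 'v"
  assumes V: "vector_space sV"
begin

lemma emb_rules:
  "emb sV (x + y) = emb sV x + emb sV y" "emb sV (x - y) = emb sV x - emb sV y"
  "emb sV (- x) = - emb sV x" "emb sV 0 = 0" "emb sV (sV c x) = tscale c (emb sV x)"
  by (simp_all add: emb_def S.ten_rules[OF V])

lemma emb_closed [simp]: "emb sV v \<in> S \<otimes>s sV"
  by (simp add: emb_def tensor_space_tensor[OF S.smul_vs V])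

lemma base_change_emb: "base_change S R sV p (emb sV v) = 0"
  by (simp add: emb_def base_change_rules[OF p_linear V] p_i R.ten_rules[OF V])

lemma aug_emb: "aug_map S sV (\<epsilon> \<circ> p) (emb sV v) = 0"
  by (simp add: emb_def aug_map_rules[OF S.aug_linear V] p_i linear_rules[OF R.aug_linear]
      vector_space_rules[OF V])

lemma base_act_emb: "base_act S sV s (emb sV v) = emb sV (sV (\<epsilon> (p s)) v)"
  by (simp add: emb_def S.base_act_rules[OF V] amul_i1 S.ten_rules[OF V])

lemma base_act_i1:
  "t \<in> S \<otimes>s sV \<Longrightarrow> base_act S sV (i 1) t = emb sV (aug_map S sV (\<epsilon> \<circ> p) t)"
proof (rule S.ext_eq[OF V, where F = "base_act S sV (i 1)"
      and G = "\<lambda>t. emb sV (aug_map S sV (\<epsilon> \<circ> p) t)"], assumption)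
  show "base_act S sV (i 1) (tensor (smul S) sV s v) =
      emb sV (aug_map S sV (\<epsilon> \<circ> p) (tensor (smul S) sV s v))" for s v
    unfolding aug_map_rules[OF S.aug_linear V]
    by (simp add: S.base_act_rules[OF V] emb_def S.commute[of "i 1"] amul_i1 S.ten_rules[OF V])
qed (simp_all add: S.base_act_rules[OF V] emb_rules aug_map_rules[OF S.aug_linear V] del: o_apply)

text \<open>
  A section \<open>q\<close> splits \<open>S\<close> as \<open>q(R) \<oplus> \<bbbK> e\<close>, hence \<open>S \<otimes> V\<close> as \<open>q(R) \<otimes> V \<oplus> e \<otimes> V\<close>; the coefficient at
  \<open>e\<close> is a left inverse of the embedding.
\<close>

lemma emb_coefficient_exists:
  "\<exists>g. Vector_Spaces.linear tscale sV g \<and> (\<forall>v. g (emb sV v) = v) \<and>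
     (\<forall>t\<in>S \<otimes>s sV. base_change S R sV p t = 0 \<longrightarrow> t = emb sV (g t))"
proof -
  obtain q where q: "linear_section R S p q" using section_exists ..
  then obtain \<kappa> where \<kappa>: "Vector_Spaces.linear (smul S) (*) \<kappa>"
    and dec: "\<And>s. s = q (p s) + i (\<kappa> s)" and \<kappa>i: "\<And>r k. \<kappa> (q r + i k) = k"
    by (rule section_coefficient) blast
  have ql: "Vector_Spaces.linear (smul R) (smul S) q" using q by (simp add: linear_section_def)
  have \<kappa>1: "\<kappa> (i 1) = 1" using \<kappa>i[of 0 1] by (simp add: linear_rules[OF ql])
  let ?g = "tensor_lift (smul S) sV sV (\<lambda>s v. sV (\<kappa> s) v)"
  note b = bilin_augmentation[OF \<kappa> V]
  note gr = tensor_lift_rules[OF S.smul_vs V b]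
  have t: "t = base_change R S sV q (base_change S R sV p t) + emb sV (?g t)" if "t \<in> S \<otimes>s sV" for t
  proof (rule S.ext_eq[OF V that])
    fix s v
    have "i (\<kappa> s) = smul S (\<kappa> s) (i 1)"
      using linear_rules(2)[OF i_linear, of "\<kappa> s" 1] by simp
    then have "tensor (smul S) sV s v =
        tensor (smul S) sV (q (p s)) v + tensor (smul S) sV (smul S (\<kappa> s) (i 1)) v"
      using dec[of s] by (metis S.ten_rules(1)[OF V])
    moreover have "base_change R S sV q (base_change S R sV p (tensor (smul S) sV s v)) =
        tensor (smul S) sV (q (p s)) v"
      by (simp add: base_change_rules[OF p_linear V] base_change_rules[OF ql V])
    moreover have "emb sV (?g (tensor (smul S) sV s v)) =
        tensor (smul S) sV (smul S (\<kappa> s) (i 1)) v"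
      by (simp add: gr emb_def S.ten_rules[OF V])
    ultimately show "tensor (smul S) sV s v = base_change R S sV q
         (base_change S R sV p (tensor (smul S) sV s v)) + emb sV (?g (tensor (smul S) sV s v))"
      by simp
  qed (simp_all add: base_change_rules[OF p_linear V] base_change_rules[OF ql V] gr emb_rules)
  show ?thesis
  proof (intro exI[of _ ?g] conjI allI ballI impI)
    show "Vector_Spaces.linear tscale sV ?g" by (rule tensor_lift(1)[OF b])
    show "?g (emb sV v) = v" for v by (simp add: emb_def gr \<kappa>1 vector_space_rules[OF V])
    show "t = emb sV (?g t)" if "t \<in> S \<otimes>s sV" "base_change S R sV p t = 0" for t
      using t[OF that(1)] that(2) by (simp add: base_change_rules[OF ql V])
  qed
qed

definition emb_coeff :: "('k, 's, 'v) tens \<Rightarrow> 'v" where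
  "emb_coeff = (SOME g. Vector_Spaces.linear tscale sV g \<and> (\<forall>v. g (emb sV v) = v) \<and>
     (\<forall>t\<in>S \<otimes>s sV. base_change S R sV p t = 0 \<longrightarrow> t = emb sV (g t)))"

lemma emb_coeff_linear: "Vector_Spaces.linear tscale sV emb_coeff"
  and emb_coeff_emb: "emb_coeff (emb sV v) = v"
  and emb_emb_coeff: "t \<in> S \<otimes>s sV \<Longrightarrow> base_change S R sV p t = 0 \<Longrightarrow> emb sV (emb_coeff t) = t"
  using someI_ex[OF emb_coefficient_exists, folded emb_coeff_def] by auto

lemma emb_inject: "emb sV v = emb sV w \<longleftrightarrow> v = w"
  by (metis emb_coeff_emb)

lemma aug_base_change:
  "t \<in> S \<otimes>s sV \<Longrightarrow> aug_map R sV \<epsilon> (base_change S R sV p t) = aug_map S sV (\<epsilon> \<circ> p) t"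
  by (rule S.ext_eq[OF V, where G = "aug_map S sV (\<epsilon> \<circ> p)"])
    (simp_all add: base_change_rules[OF p_linear V] aug_map_rules[OF S.aug_linear V]
      aug_map_rules[OF R.aug_linear V])

end

text \<open>
  The maximal ideal of \<open>S\<close> annihilates \<open>i(\<bbbK>)\<close>, so an \<open>S\<close>-linear map into \<open>ker (p \<otimes> id)\<close> only
  sees the augmentation of its argument.
\<close>

lemma kernel_valued_factors:
  fixes F :: "('k, 's, 'u::ab_group_add) tens \<Rightarrow> ('k, 's, 'w::ab_group_add) tens"
  assumes U: "vector_space sU" and W: "vector_space sW"
    and add: "\<And>x y. x \<in> S \<otimes>s sU \<Longrightarrow> y \<in> S \<otimes>s sU \<Longrightarrow> F (x + y) = F x + F y"
    and act: "\<And>s x. x \<in> S \<otimes>s sU \<Longrightarrow> F (base_act S sU s x) = base_act S sW s (F x)"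
    and closed: "\<And>x. x \<in> S \<otimes>s sU \<Longrightarrow> F x \<in> S \<otimes>s sW"
    and kernel: "\<And>x. x \<in> S \<otimes>s sU \<Longrightarrow> base_change S R sW p (F x) = 0"
    and t: "t \<in> S \<otimes>s sU"
  shows "F t = F (one_tensor S sU (aug_map S sU (\<epsilon> \<circ> p) t))"
proof (rule S.ext_eq[OF U t])
  show "F (one_tensor S sU (aug_map S sU (\<epsilon> \<circ> p) (x + y))) =
      F (one_tensor S sU (aug_map S sU (\<epsilon> \<circ> p) x)) + F (one_tensor S sU (aug_map S sU (\<epsilon> \<circ> p) y))"
    for x y
    by (simp add: aug_map_rules[OF S.aug_linear U] S.one_tensor_rules[OF U] add
        S.one_tensor_closed[OF U])
  fix s u
  let ?c = "\<epsilon> (p s)" and ?\<iota> = "one_tensor S sU"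
  obtain w where w: "F (?\<iota> u) = emb sW w"
    using emb_emb_coeff[OF W closed kernel, of "?\<iota> u"] S.one_tensor_closed[OF U] by metis
  have "F (tensor (smul S) sU s u) = emb sW (sW ?c w)"
    using act[of "?\<iota> u" s] by (simp add: S.base_act_one[OF U] S.one_tensor_closed[OF U] w
        base_act_emb[OF W])
  also have "\<dots> = base_act S sW (smul S ?c (aunit S)) (F (?\<iota> u))"
    by (simp add: w base_act_emb[OF W] linear_rules[OF S.aug_linear, simplified] S.aug_unit[simplified])
  also have "\<dots> = F (base_act S sU (smul S ?c (aunit S)) (?\<iota> u))"
    by (simp add: act S.one_tensor_closed[OF U])
  also have "\<dots> = F (?\<iota> (sU ?c u))"
    by (simp add: S.base_act_one[OF U] S.one_tensor_rules[OF U] S.ten_rules[OF U])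
      (simp add: one_tensor_def)
  finally show "F (tensor (smul S) sU s u) = F (?\<iota> (aug_map S sU (\<epsilon> \<circ> p) (tensor (smul S) sU s u)))"
    by (simp add: aug_map_rules[OF S.aug_linear U])
qed (simp add: add)

end


section \<open>Triplets over the base and their defects\<close>

locale courant_over_field =
  fixes P :: "('k::field, 'a::ab_group_add, 'l::ab_group_add) courant"
  assumes pair: "courant_pair base_field P" and carA: "carA P = UNIV" and carL: "carL P = UNIV"
begin

lemma vector_spaces: "vector_space (actA P)" "vector_space (actL P)"
  using pair unfolding courant_pair_def module_on_def carA carL
  by (auto simp: base_field_def intro!: vector_space.intro)

lemmas vsA = vector_spaces(1) and vsL = vector_spaces(2)

lemma bilin_of_bilinear_on:
  assumes "vector_space sU" "vector_space sV" "vector_space sW"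
    and "bilinear_on sU UNIV sV UNIV sW UNIV f"
  shows "bilin sU sV sW f"
  using assms(4) unfolding bilinear_on_def linear_on_def
  by (intro bilin_intro assms(1-3)) simp_all

lemma bilin_mult: "bilin (actA P) (actA P) (actA P) (mult P)"
  and bilin_brk: "bilin (actL P) (actL P) (actL P) (brk P)"
  and bilin_anch: "bilin (actL P) (actA P) (actA P) (anch P)"
  using pair unfolding courant_pair_def carA carL
  by (simp_all add: bilin_of_bilinear_on vsA vsL)

lemmas mult_rules = bilin_rules[OF bilin_mult]
  and brk_rules = bilin_rules[OF bilin_brk]
  and anch_rules = bilin_rules[OF bilin_anch]

end

text \<open>
  The defects of a triplet, arranged with the signs of the obstruction cochain; a bilinear
  triplet is a Courant pair when they vanish.
\<close>

definition defectA :: "('t::ab_group_add, 'u) triplet \<Rightarrow> 't \<Rightarrow> 't \<Rightarrow> 't \<Rightarrow> 't" where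
  "defectA T t u v = tmult T t (tmult T u v) - tmult T (tmult T t u) v"

definition defect1 :: "('t::ab_group_add, 'u) triplet \<Rightarrow> 'u \<Rightarrow> 't \<Rightarrow> 't \<Rightarrow> 't" where
  "defect1 T x t u =
     - (tanch T x (tmult T t u) - tmult T (tanch T x t) u - tmult T t (tanch T x u))"

definition defect2 :: "('t::ab_group_add, 'u) triplet \<Rightarrow> 'u \<Rightarrow> 'u \<Rightarrow> 't \<Rightarrow> 't" where
  "defect2 T x y t = tanch T (tbrk T x y) t - tanch T x (tanch T y t) + tanch T y (tanch T x t)"

definition defectL :: "('t, 'u::ab_group_add) triplet \<Rightarrow> 'u \<Rightarrow> 'u \<Rightarrow> 'u \<Rightarrow> 'u" where
  "defectL T x y z =
     - (tbrk T x (tbrk T y z) - tbrk T (tbrk T x y) z - tbrk T y (tbrk T x z))"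

lemma defect_eq_0_iff:
  "defectA T t u v = 0 \<longleftrightarrow> tmult T (tmult T t u) v = tmult T t (tmult T u v)"
  "defect1 T x t u = 0 \<longleftrightarrow>
     tanch T x (tmult T t u) = tmult T (tanch T x t) u + tmult T t (tanch T x u)"
  "defect2 T x y t = 0 \<longleftrightarrow>
     tanch T (tbrk T x y) t = tanch T x (tanch T y t) - tanch T y (tanch T x t)"
  "defectL T x y z = 0 \<longleftrightarrow>
     tbrk T x (tbrk T y z) = tbrk T (tbrk T x y) z + tbrk T y (tbrk T x z)"
proof -
  have 1: "- (a - b - c) = 0 \<longleftrightarrow> a = b + c" and 2: "a - b + c = 0 \<longleftrightarrow> a = b - c"
    for a b c :: "'c::ab_group_add"
  proof -
    have "a - b - c = a - (b + c)" "a - b + c = a - (b - c)" by (simp_all only: diff_diff_eq diff_diff_eq2 diff_add_eq)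
    then show "- (a - b - c) = 0 \<longleftrightarrow> a = b + c" "a - b + c = 0 \<longleftrightarrow> a = b - c"
      by (simp_all only: neg_equal_0_iff_equal right_minus_eq)
  qed
  show "defectA T t u v = 0 \<longleftrightarrow> tmult T (tmult T t u) v = tmult T t (tmult T u v)"
    by (auto simp: defectA_def)
  show "defect1 T x t u = 0 \<longleftrightarrow>
     tanch T x (tmult T t u) = tmult T (tanch T x t) u + tmult T t (tanch T x u)"
    "defect2 T x y t = 0 \<longleftrightarrow>
     tanch T (tbrk T x y) t = tanch T x (tanch T y t) - tanch T y (tanch T x t)"
    "defectL T x y z = 0 \<longleftrightarrow>
     tbrk T x (tbrk T y z) = tbrk T (tbrk T x y) z + tbrk T y (tbrk T x z)"
    unfolding defect1_def defect2_def defectL_def by (rule 1 2)+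
qed

lemmas defect_defs = defectA_def defect1_def defect2_def defectL_def

definition ext_triplet where
  "ext_triplet P R T \<longleftrightarrow>
     ext_bilinear R (actA P) (actA P) (actA P) (tmult T) \<and>
     ext_bilinear R (actL P) (actA P) (actA P) (tanch T) \<and>
     ext_bilinear R (actL P) (actL P) (actL P) (tbrk T)"

definition defects_vanish where
  "defects_vanish P R T \<longleftrightarrow>
     (\<forall>t\<in>R \<otimes>s actA P. \<forall>u\<in>R \<otimes>s actA P. \<forall>v\<in>R \<otimes>s actA P. defectA T t u v = 0) \<and>
     (\<forall>x\<in>R \<otimes>s actL P. \<forall>t\<in>R \<otimes>s actA P. \<forall>u\<in>R \<otimes>s actA P. defect1 T x t u = 0) \<and>
     (\<forall>x\<in>R \<otimes>s actL P. \<forall>y\<in>R \<otimes>s actL P. \<forall>t\<in>R \<otimes>s actA P. defect2 T x y t = 0) \<and>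
     (\<forall>x\<in>R \<otimes>s actL P. \<forall>y\<in>R \<otimes>s actL P. \<forall>z\<in>R \<otimes>s actL P. defectL T x y z = 0)"

definition reduces_to where
  "reduces_to P R \<epsilon> T \<longleftrightarrow>
     (\<forall>a b. aug_map R (actA P) \<epsilon> (tmult T (one_tensor R (actA P) a) (one_tensor R (actA P) b)) =
        mult P a b) \<and>
     (\<forall>x a. aug_map R (actA P) \<epsilon> (tanch T (one_tensor R (actL P) x) (one_tensor R (actA P) a)) =
        anch P x a) \<and>
     (\<forall>x y. aug_map R (actL P) \<epsilon> (tbrk T (one_tensor R (actL P) x) (one_tensor R (actL P) y)) =
        brk P x y)"

locale courant_base = R: augmented_algebra R \<epsilon> + courant_over_field P
  for R :: "('k::field, 'r::ab_group_add) ualg" and \<epsilon>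
    and P :: "('k, 'a::ab_group_add, 'l::ab_group_add) courant"
begin

lemma reduces_to_ext:
  assumes T: "ext_triplet P R T" "reduces_to P R \<epsilon> T"
  shows "t \<in> R \<otimes>s actA P \<Longrightarrow> u \<in> R \<otimes>s actA P \<Longrightarrow> aug_map R (actA P) \<epsilon> (tmult T t u) =
      mult P (aug_map R (actA P) \<epsilon> t) (aug_map R (actA P) \<epsilon> u)"
    and "x \<in> R \<otimes>s actL P \<Longrightarrow> u \<in> R \<otimes>s actA P \<Longrightarrow> aug_map R (actA P) \<epsilon> (tanch T x u) =
      anch P (aug_map R (actL P) \<epsilon> x) (aug_map R (actA P) \<epsilon> u)"
    and "x \<in> R \<otimes>s actL P \<Longrightarrow> y \<in> R \<otimes>s actL P \<Longrightarrow> aug_map R (actL P) \<epsilon> (tbrk T x y) =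
      brk P (aug_map R (actL P) \<epsilon> x) (aug_map R (actL P) \<epsilon> y)"
proof -
  note b = T(1)[unfolded ext_triplet_def] and r = T(2)[unfolded reduces_to_def]
  show "t \<in> R \<otimes>s actA P \<Longrightarrow> u \<in> R \<otimes>s actA P \<Longrightarrow> aug_map R (actA P) \<epsilon> (tmult T t u) =
      mult P (aug_map R (actA P) \<epsilon> t) (aug_map R (actA P) \<epsilon> u)"
    using b r by (intro R.aug_ext_bilinear[OF vsA vsA vsA _ bilin_mult]) simp_all
  show "x \<in> R \<otimes>s actL P \<Longrightarrow> u \<in> R \<otimes>s actA P \<Longrightarrow> aug_map R (actA P) \<epsilon> (tanch T x u) =
      anch P (aug_map R (actL P) \<epsilon> x) (aug_map R (actA P) \<epsilon> u)"
    using b r by (intro R.aug_ext_bilinear[OF vsL vsA vsA _ bilin_anch]) simp_all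
  show "x \<in> R \<otimes>s actL P \<Longrightarrow> y \<in> R \<otimes>s actL P \<Longrightarrow> aug_map R (actL P) \<epsilon> (tbrk T x y) =
      brk P (aug_map R (actL P) \<epsilon> x) (aug_map R (actL P) \<epsilon> y)"
    using b r by (intro R.aug_ext_bilinear[OF vsL vsL vsL _ bilin_brk]) simp_all
qed

text \<open>
  The module axioms and the linearity of \<open>\<epsilon> \<otimes> id\<close> hold for every triplet, and compatibility with
  \<open>\<epsilon>\<close> need only be checked on \<open>1 \<otimes> A\<close> and \<open>1 \<otimes> L\<close>.
\<close>

lemma deformation_iff:
  "deformation P R \<epsilon> T \<longleftrightarrow> ext_triplet P R T \<and> defects_vanish P R T \<and> reduces_to P R \<epsilon> T"
proof -
  have lin: "linear_on (\<lambda>k. base_act R sV (smul R k (aunit R))) (R \<otimes>s sV) sV UNIV (aug_map R sV \<epsilon>)"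
    if "vector_space sV" for sV :: "'k \<Rightarrow> 'v::ab_group_add \<Rightarrow> 'v"
    using that by (simp add: linear_on_def aug_map_rules R.aug_linear R.base_act_smul
        R.base_act_unit)
  have "derivation_on (base_act R (actA P)) (R \<otimes>s actA P) (tmult T) (tanch T x)
     \<longleftrightarrow> (\<forall>t\<in>R \<otimes>s actA P. \<forall>u\<in>R \<otimes>s actA P. defect1 T x t u = 0)"
    if "ext_bilinear R (actL P) (actA P) (actA P) (tanch T)" "x \<in> R \<otimes>s actL P" for x
    using that unfolding derivation_on_def bilinear_on_def defect_eq_0_iff by blast
  then have der: "ext_bilinear R (actL P) (actA P) (actA P) (tanch T) \<longrightarrow>
    (\<forall>x\<in>R \<otimes>s actL P.
       derivation_on (base_act R (actA P)) (R \<otimes>s actA P) (tmult T) (tanch T x)) =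
    (\<forall>x\<in>R \<otimes>s actL P. \<forall>t\<in>R \<otimes>s actA P. \<forall>u\<in>R \<otimes>s actA P. defect1 T x t u = 0)"
    by (intro impI ball_cong) simp_all
  have "courant_pair R (triplet_pair P R T) \<longleftrightarrow> ext_triplet P R T \<and> defects_vanish P R T"
    unfolding courant_pair_def triplet_pair_def ext_triplet_def defects_vanish_def courant.simps
      defect_eq_0_iff(1,3,4)
    using der R.module_on_ext[OF vsA] R.module_on_ext[OF vsL] by argo
  moreover have "courant_hom (restrict_scalars R (triplet_pair P R T)) P
       (aug_map R (actA P) \<epsilon>) (aug_map R (actL P) \<epsilon>) \<longleftrightarrow> reduces_to P R \<epsilon> T"
    if "ext_triplet P R T"
  proof
    assume "reduces_to P R \<epsilon> T"
    then show "courant_hom (restrict_scalars R (triplet_pair P R T)) P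
       (aug_map R (actA P) \<epsilon>) (aug_map R (actL P) \<epsilon>)"
      unfolding courant_hom_def restrict_scalars_def triplet_pair_def
      by (simp add: carA carL lin vsA vsL reduces_to_ext[OF that])
  next
    assume "courant_hom (restrict_scalars R (triplet_pair P R T)) P
       (aug_map R (actA P) \<epsilon>) (aug_map R (actL P) \<epsilon>)"
    then show "reduces_to P R \<epsilon> T"
      unfolding courant_hom_def restrict_scalars_def triplet_pair_def reduces_to_def
      by (simp add: R.aug_one R.one_tensor_closed vsA vsL)
  qed
  ultimately show ?thesis unfolding deformation_def by blast
qed

end


section \<open>Lifts of a deformation to the extension\<close>

locale lifting_problem = extension R \<epsilon> S i p + courant_base R \<epsilon> P
  for R :: "('k::field, 'r::ab_group_add) ualg" and \<epsilon> and S :: "('k, 's::ab_group_add) ualg"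
    and i p and P :: "('k, 'a::ab_group_add, 'l::ab_group_add) courant" +
  fixes lam :: "('k, 'r, 'a, 'l) deform"
  assumes deformation: "deformation P R \<epsilon> lam"
begin

sublocale S: courant_base S "\<epsilon> \<circ> p" P
  by unfold_locales

text \<open>A lift satisfies \<open>p\<^sub>* T = \<lambda>\<close>, but may fail to be a Courant pair.\<close>

definition lift :: "('k, 's, 'a, 'l) deform \<Rightarrow> bool" where
  "lift T \<longleftrightarrow> ext_triplet P S T \<and>
     (\<forall>a b. base_change S R (actA P) p (tmult T (one_tensor S (actA P) a) (one_tensor S (actA P) b)) =
        tmult lam (one_tensor R (actA P) a) (one_tensor R (actA P) b)) \<and>
     (\<forall>x a. base_change S R (actA P) p (tanch T (one_tensor S (actL P) x) (one_tensor S (actA P) a)) =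
        tanch lam (one_tensor R (actL P) x) (one_tensor R (actA P) a)) \<and>
     (\<forall>x y. base_change S R (actL P) p (tbrk T (one_tensor S (actL P) x) (one_tensor S (actL P) y)) =
        tbrk lam (one_tensor R (actL P) x) (one_tensor R (actL P) y))"

lemma lam: "ext_triplet P R lam" "defects_vanish P R lam" "reduces_to P R \<epsilon> lam"
  using deformation by (auto simp: deformation_iff)

lemma lam_bilinear:
  "ext_bilinear R (actA P) (actA P) (actA P) (tmult lam)"
  "ext_bilinear R (actL P) (actA P) (actA P) (tanch lam)"
  "ext_bilinear R (actL P) (actL P) (actL P) (tbrk lam)"
  using lam(1) by (auto simp: ext_triplet_def)

text \<open>
  In both components, \<open>\<iota>\<close> stands for \<open>v \<mapsto> 1 \<otimes> v\<close>, \<open>\<alpha>\<close> for the augmentation \<open>S \<otimes> V \<rightarrow> V\<close>,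
  \<open>\<pi>\<close> for \<open>p \<otimes> id\<close>, and \<open>E\<close> for \<open>v \<mapsto> e \<otimes> v\<close>.
\<close>

abbreviation "\<iota>A \<equiv> one_tensor S (actA P)"
abbreviation "\<iota>L \<equiv> one_tensor S (actL P)"
abbreviation "\<alpha>A \<equiv> aug_map S (actA P) (\<epsilon> \<circ> p)"
abbreviation "\<alpha>L \<equiv> aug_map S (actL P) (\<epsilon> \<circ> p)"
abbreviation "\<pi>A \<equiv> base_change S R (actA P) p"
abbreviation "\<pi>L \<equiv> base_change S R (actL P) p"
abbreviation "SA \<equiv> S \<otimes>s actA P"
abbreviation "SL \<equiv> S \<otimes>s actL P"
abbreviation "EA \<equiv> emb (actA P)"
abbreviation "EL \<equiv> emb (actL P)"

lemmas closed [simp] =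
  S.ext_closed[OF vsA] S.ext_closed[OF vsL] S.one_tensor_closed[OF vsA] S.one_tensor_closed[OF vsL]
  emb_closed[OF vsA] emb_closed[OF vsL] S.base_act_closed[OF vsA] S.base_act_closed[OF vsL]

lemmas aug_rules [simp] =
  aug_map_rules(1-5)[OF S.aug_linear vsA] aug_map_rules(1-5)[OF S.aug_linear vsL]
  S.aug_one[OF vsA] S.aug_one[OF vsL] aug_emb[OF vsA] aug_emb[OF vsL]

lemmas pi_rules [simp] =
  base_change_rules(1-5)[OF p_linear vsA] base_change_rules(1-5)[OF p_linear vsL]
  base_change_one[OF p_hom vsA] base_change_one[OF p_hom vsL]
  base_change_emb[OF vsA] base_change_emb[OF vsL]

lemmas pi_closed [simp] =
  base_change_closed[OF p_linear vsA] base_change_closed[OF p_linear vsL]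

end

(* The rules above mention \<epsilon> \<circ> p, which has to stay folded for them to apply. *)
declare o_apply [simp del]

locale lifted = lifting_problem R \<epsilon> S i p P lam
  for R :: "('k::field, 'r::ab_group_add) ualg" and \<epsilon> and S :: "('k, 's::ab_group_add) ualg"
    and i p and P :: "('k, 'a::ab_group_add, 'l::ab_group_add) courant" and lam +
  fixes T :: "('k, 's, 'a, 'l) deform"
  assumes lift: "lift T"
begin

abbreviation "m \<equiv> tmult T"
abbreviation "\<mu> \<equiv> tanch T"
abbreviation "br \<equiv> tbrk T"

lemma T_triplet: "ext_triplet P S T"
  using lift by (simp add: lift_def)

lemma T_bilinear:
  "ext_bilinear S (actA P) (actA P) (actA P) m"
  "ext_bilinear S (actL P) (actA P) (actA P) \<mu>"
  "ext_bilinear S (actL P) (actL P) (actL P) br"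
  using T_triplet by (auto simp: ext_triplet_def)

lemmas T_rules [simp] =
  ext_bilinear_rules[OF T_bilinear(1) comm_S vsA vsA vsA]
  ext_bilinear_rules[OF T_bilinear(2) comm_S vsL vsA vsA]
  ext_bilinear_rules[OF T_bilinear(3) comm_S vsL vsL vsL]

lemma lift_one:
  "\<pi>A (m (\<iota>A a) (\<iota>A b)) = tmult lam (one_tensor R (actA P) a) (one_tensor R (actA P) b)"
  "\<pi>A (\<mu> (\<iota>L x) (\<iota>A b)) = tanch lam (one_tensor R (actL P) x) (one_tensor R (actA P) b)"
  "\<pi>L (br (\<iota>L x) (\<iota>L y)) = tbrk lam (one_tensor R (actL P) x) (one_tensor R (actL P) y)"
  using lift unfolding lift_def by blast+

lemmas pi_T [simp] =
  base_change_ext_bilinear[OF p_hom comm_S R.comm vsA vsA vsA T_bilinear(1) lam_bilinear(1) lift_one(1)]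
  base_change_ext_bilinear[OF p_hom comm_S R.comm vsL vsA vsA T_bilinear(2) lam_bilinear(2) lift_one(2)]
  base_change_ext_bilinear[OF p_hom comm_S R.comm vsL vsL vsL T_bilinear(3) lam_bilinear(3) lift_one(3)]

lemma pi_defects:
  "t \<in> SA \<Longrightarrow> u \<in> SA \<Longrightarrow> v \<in> SA \<Longrightarrow> \<pi>A (defectA T t u v) = 0"
  "x \<in> SL \<Longrightarrow> t \<in> SA \<Longrightarrow> u \<in> SA \<Longrightarrow> \<pi>A (defect1 T x t u) = 0"
  "x \<in> SL \<Longrightarrow> y \<in> SL \<Longrightarrow> t \<in> SA \<Longrightarrow> \<pi>A (defect2 T x y t) = 0"
  "x \<in> SL \<Longrightarrow> y \<in> SL \<Longrightarrow> z \<in> SL \<Longrightarrow> \<pi>L (defectL T x y z) = 0"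
proof -
  note z = lam(2)[unfolded defects_vanish_def]
  assume [simp]: "t \<in> SA" "u \<in> SA"
  show "v \<in> SA \<Longrightarrow> \<pi>A (defectA T t u v) = 0"
    by (rule trans[of _ "defectA lam (\<pi>A t) (\<pi>A u) (\<pi>A v)"])
      (simp add: defectA_def, simp add: z)
  show "x \<in> SL \<Longrightarrow> \<pi>A (defect1 T x t u) = 0"
    by (rule trans[of _ "defect1 lam (\<pi>L x) (\<pi>A t) (\<pi>A u)"])
      (simp add: defect1_def, simp add: z)
next
  note z = lam(2)[unfolded defects_vanish_def]
  assume [simp]: "x \<in> SL" "y \<in> SL"
  show "t \<in> SA \<Longrightarrow> \<pi>A (defect2 T x y t) = 0"
    by (rule trans[of _ "defect2 lam (\<pi>L x) (\<pi>L y) (\<pi>A t)"])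
      (simp add: defect2_def, simp add: z)
  show "z \<in> SL \<Longrightarrow> \<pi>L (defectL T x y z) = 0"
    by (rule trans[of _ "defectL lam (\<pi>L x) (\<pi>L y) (\<pi>L z)"])
      (simp add: defectL_def, simp add: z)
qed

lemma T_reduces: "reduces_to P S (\<epsilon> \<circ> p) T"
  using lam(3) unfolding reduces_to_def
  by (simp add: lift_one flip: aug_base_change[OF vsA] aug_base_change[OF vsL])

lemmas aug_T [simp] = S.reduces_to_ext[OF T_triplet T_reduces]

text \<open>
  Since \<open>e = i 1\<close> satisfies \<open>s e = \<epsilon>(p s) e\<close>, products with elements of \<open>e \<otimes> V\<close> are those of the
  undeformed pair.
\<close>

lemma T_emb [simp]:
  "t \<in> SA \<Longrightarrow> m t (EA a) = EA (mult P (\<alpha>A t) a)"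
  "t \<in> SA \<Longrightarrow> m (EA a) t = EA (mult P a (\<alpha>A t))"
  "x \<in> SL \<Longrightarrow> \<mu> x (EA a) = EA (anch P (\<alpha>L x) a)"
  "t \<in> SA \<Longrightarrow> \<mu> (EL y) t = EA (anch P y (\<alpha>A t))"
  "x \<in> SL \<Longrightarrow> br x (EL y) = EL (brk P (\<alpha>L x) y)"
  "x \<in> SL \<Longrightarrow> br (EL y) x = EL (brk P y (\<alpha>L x))"
proof -
  have A: "EA a = base_act S (actA P) (i 1) (\<iota>A a)" for a
    by (simp add: S.base_act_one vsA emb_def)
  have L: "EL a = base_act S (actL P) (i 1) (\<iota>L a)" for a
    by (simp add: S.base_act_one vsL emb_def)
  show "t \<in> SA \<Longrightarrow> m t (EA a) = EA (mult P (\<alpha>A t) a)"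
    "t \<in> SA \<Longrightarrow> m (EA a) t = EA (mult P a (\<alpha>A t))"
    "x \<in> SL \<Longrightarrow> \<mu> x (EA a) = EA (anch P (\<alpha>L x) a)"
    unfolding A[of a] by (simp_all only: T_rules closed) (simp_all add: base_act_i1 vsA)
  show "t \<in> SA \<Longrightarrow> \<mu> (EL y) t = EA (anch P y (\<alpha>A t))"
    "x \<in> SL \<Longrightarrow> br x (EL y) = EL (brk P (\<alpha>L x) y)"
    "x \<in> SL \<Longrightarrow> br (EL y) x = EL (brk P y (\<alpha>L x))"
    unfolding L[of y] by (simp_all only: T_rules closed) (simp_all add: base_act_i1 vsA vsL)
qed

lemmas act_rules = S.base_act_rules(1,4,5)[OF vsA] S.base_act_rules(1,4,5)[OF vsL]

lemma defect_closed [simp]: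
  "t \<in> SA \<Longrightarrow> u \<in> SA \<Longrightarrow> v \<in> SA \<Longrightarrow> defectA T t u v \<in> SA"
  "x \<in> SL \<Longrightarrow> t \<in> SA \<Longrightarrow> u \<in> SA \<Longrightarrow> defect1 T x t u \<in> SA"
  "x \<in> SL \<Longrightarrow> y \<in> SL \<Longrightarrow> t \<in> SA \<Longrightarrow> defect2 T x y t \<in> SA"
  "x \<in> SL \<Longrightarrow> y \<in> SL \<Longrightarrow> z \<in> SL \<Longrightarrow> defectL T x y z \<in> SL"
  unfolding defect_defs by (simp_all del: minus_diff_eq)

text \<open>
  The defects are \<open>S\<close>-multilinear with values in \<open>ker (p \<otimes> id)\<close>, so each argument matters only
  through its augmentation.
\<close>

lemma defectA_linear:
  assumes "t \<in> SA" "u \<in> SA" "v \<in> SA"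
  shows "t' \<in> SA \<Longrightarrow> defectA T (t + t') u v = defectA T t u v + defectA T t' u v"
    "defectA T (base_act S (actA P) s t) u v = base_act S (actA P) s (defectA T t u v)"
    "u' \<in> SA \<Longrightarrow> defectA T t (u + u') v = defectA T t u v + defectA T t u' v"
    "defectA T t (base_act S (actA P) s u) v = base_act S (actA P) s (defectA T t u v)"
    "v' \<in> SA \<Longrightarrow> defectA T t u (v + v') = defectA T t u v + defectA T t u v'"
    "defectA T t u (base_act S (actA P) s v) = base_act S (actA P) s (defectA T t u v)"
  using assms by (simp_all add: defectA_def act_rules)

lemma defectA_aug:
  assumes "t \<in> SA" "u \<in> SA" "v \<in> SA"
  shows "defectA T t u v = defectA T (\<iota>A (\<alpha>A t)) u v"
    "defectA T t u v = defectA T t (\<iota>A (\<alpha>A u)) v"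
    "defectA T t u v = defectA T t u (\<iota>A (\<alpha>A v))"
proof -
  show "defectA T t u v = defectA T (\<iota>A (\<alpha>A t)) u v"
    by (rule kernel_valued_factors[OF vsA vsA, where F = "\<lambda>t. defectA T t u v"])
      (use assms in \<open>simp_all add: defectA_linear pi_defects\<close>)
  show "defectA T t u v = defectA T t (\<iota>A (\<alpha>A u)) v"
    by (rule kernel_valued_factors[OF vsA vsA, where F = "\<lambda>u. defectA T t u v"])
      (use assms in \<open>simp_all add: defectA_linear pi_defects\<close>)
  show "defectA T t u v = defectA T t u (\<iota>A (\<alpha>A v))"
    by (rule kernel_valued_factors[OF vsA vsA, where F = "\<lambda>v. defectA T t u v"])
      (use assms in \<open>simp_all add: defectA_linear pi_defects\<close>)
qed

lemma defect1_linear: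
  assumes "x \<in> SL" "t \<in> SA" "u \<in> SA"
  shows "x' \<in> SL \<Longrightarrow> defect1 T (x + x') t u = defect1 T x t u + defect1 T x' t u"
    "defect1 T (base_act S (actL P) s x) t u = base_act S (actA P) s (defect1 T x t u)"
    "t' \<in> SA \<Longrightarrow> defect1 T x (t + t') u = defect1 T x t u + defect1 T x t' u"
    "defect1 T x (base_act S (actA P) s t) u = base_act S (actA P) s (defect1 T x t u)"
    "u' \<in> SA \<Longrightarrow> defect1 T x t (u + u') = defect1 T x t u + defect1 T x t u'"
    "defect1 T x t (base_act S (actA P) s u) = base_act S (actA P) s (defect1 T x t u)"
  using assms by (simp_all add: defect1_def act_rules)

lemma defect1_aug:
  assumes "x \<in> SL" "t \<in> SA" "u \<in> SA"
  shows "defect1 T x t u = defect1 T (\<iota>L (\<alpha>L x)) t u"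
    "defect1 T x t u = defect1 T x (\<iota>A (\<alpha>A t)) u"
    "defect1 T x t u = defect1 T x t (\<iota>A (\<alpha>A u))"
proof -
  show "defect1 T x t u = defect1 T (\<iota>L (\<alpha>L x)) t u"
    by (rule kernel_valued_factors[OF vsL vsA, where F = "\<lambda>x. defect1 T x t u"])
      (use assms in \<open>simp_all add: defect1_linear pi_defects\<close>)
  show "defect1 T x t u = defect1 T x (\<iota>A (\<alpha>A t)) u"
    by (rule kernel_valued_factors[OF vsA vsA, where F = "\<lambda>t. defect1 T x t u"])
      (use assms in \<open>simp_all add: defect1_linear pi_defects\<close>)
  show "defect1 T x t u = defect1 T x t (\<iota>A (\<alpha>A u))"
    by (rule kernel_valued_factors[OF vsA vsA, where F = "\<lambda>u. defect1 T x t u"])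
      (use assms in \<open>simp_all add: defect1_linear pi_defects\<close>)
qed

lemma defect2_linear:
  assumes "x \<in> SL" "y \<in> SL" "t \<in> SA"
  shows "x' \<in> SL \<Longrightarrow> defect2 T (x + x') y t = defect2 T x y t + defect2 T x' y t"
    "defect2 T (base_act S (actL P) s x) y t = base_act S (actA P) s (defect2 T x y t)"
    "y' \<in> SL \<Longrightarrow> defect2 T x (y + y') t = defect2 T x y t + defect2 T x y' t"
    "defect2 T x (base_act S (actL P) s y) t = base_act S (actA P) s (defect2 T x y t)"
    "t' \<in> SA \<Longrightarrow> defect2 T x y (t + t') = defect2 T x y t + defect2 T x y t'"
    "defect2 T x y (base_act S (actA P) s t) = base_act S (actA P) s (defect2 T x y t)"
  using assms by (simp_all add: defect2_def act_rules)

lemma defect2_aug: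
  assumes "x \<in> SL" "y \<in> SL" "t \<in> SA"
  shows "defect2 T x y t = defect2 T (\<iota>L (\<alpha>L x)) y t"
    "defect2 T x y t = defect2 T x (\<iota>L (\<alpha>L y)) t"
    "defect2 T x y t = defect2 T x y (\<iota>A (\<alpha>A t))"
proof -
  show "defect2 T x y t = defect2 T (\<iota>L (\<alpha>L x)) y t"
    by (rule kernel_valued_factors[OF vsL vsA, where F = "\<lambda>x. defect2 T x y t"])
      (use assms in \<open>simp_all add: defect2_linear pi_defects\<close>)
  show "defect2 T x y t = defect2 T x (\<iota>L (\<alpha>L y)) t"
    by (rule kernel_valued_factors[OF vsL vsA, where F = "\<lambda>y. defect2 T x y t"])
      (use assms in \<open>simp_all add: defect2_linear pi_defects\<close>)
  show "defect2 T x y t = defect2 T x y (\<iota>A (\<alpha>A t))"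
    by (rule kernel_valued_factors[OF vsA vsA, where F = "\<lambda>t. defect2 T x y t"])
      (use assms in \<open>simp_all add: defect2_linear pi_defects\<close>)
qed

lemma defectL_linear:
  assumes "x \<in> SL" "y \<in> SL" "z \<in> SL"
  shows "x' \<in> SL \<Longrightarrow> defectL T (x + x') y z = defectL T x y z + defectL T x' y z"
    "defectL T (base_act S (actL P) s x) y z = base_act S (actL P) s (defectL T x y z)"
    "y' \<in> SL \<Longrightarrow> defectL T x (y + y') z = defectL T x y z + defectL T x y' z"
    "defectL T x (base_act S (actL P) s y) z = base_act S (actL P) s (defectL T x y z)"
    "z' \<in> SL \<Longrightarrow> defectL T x y (z + z') = defectL T x y z + defectL T x y z'"
    "defectL T x y (base_act S (actL P) s z) = base_act S (actL P) s (defectL T x y z)"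
  using assms by (simp_all add: defectL_def act_rules)

lemma defectL_aug:
  assumes "x \<in> SL" "y \<in> SL" "z \<in> SL"
  shows "defectL T x y z = defectL T (\<iota>L (\<alpha>L x)) y z"
    "defectL T x y z = defectL T x (\<iota>L (\<alpha>L y)) z"
    "defectL T x y z = defectL T x y (\<iota>L (\<alpha>L z))"
proof -
  show "defectL T x y z = defectL T (\<iota>L (\<alpha>L x)) y z"
    by (rule kernel_valued_factors[OF vsL vsL, where F = "\<lambda>x. defectL T x y z"])
      (use assms in \<open>simp_all add: defectL_linear pi_defects\<close>)
  show "defectL T x y z = defectL T x (\<iota>L (\<alpha>L y)) z"
    by (rule kernel_valued_factors[OF vsL vsL, where F = "\<lambda>y. defectL T x y z"])
      (use assms in \<open>simp_all add: defectL_linear pi_defects\<close>)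
  show "defectL T x y z = defectL T x y (\<iota>L (\<alpha>L z))"
    by (rule kernel_valued_factors[OF vsL vsL, where F = "\<lambda>z. defectL T x y z"])
      (use assms in \<open>simp_all add: defectL_linear pi_defects\<close>)
qed

end


section \<open>The coboundary in low degrees\<close>

lemma sgn_pow_diff: "sgn_pow n (u - v) = sgn_pow n u - sgn_pow n v"
  by (simp add: sgn_pow_def)

lemma sgn_pow_Suc: "sgn_pow 0 v = v" "sgn_pow (Suc n) v = - sgn_pow n v"
  by (simp_all add: sgn_pow_def)

lemma leibniz_cobd_diff:
  assumes "\<And>x u v. lact x (u - v) = lact x u - lact x v"
    "\<And>x u v. ract (u - v) x = ract u x - ract v x"
  shows "leibniz_cobd br lact ract (\<psi> - \<chi>) xs =
    leibniz_cobd br lact ract \<psi> xs - leibniz_cobd br lact ract \<chi> xs"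
  unfolding leibniz_cobd_def Let_def
  by (simp only: minus_apply assms sgn_pow_diff sum_subtractf add_diff_add[symmetric]
      split: if_split) simp

text \<open>
  Used with \<open>Z\<close> expressing that a vector vanishes, and that a function vanishes on all lists of a
  given length; this covers both kinds of values of cochains.
\<close>

lemma leibniz_cobd_closed:
  assumes Z: "Z 0" "\<And>u v. Z u \<Longrightarrow> Z v \<Longrightarrow> Z (u + v)" "\<And>u. Z u \<Longrightarrow> Z (- u)"
    and act: "\<And>x u. Z u \<Longrightarrow> Z (lact x u)" "\<And>x u. Z u \<Longrightarrow> Z (ract u x)"
    and \<psi>: "\<And>zs. Suc (length zs) = length xs \<Longrightarrow> Z (\<psi> zs)"
  shows "Z (leibniz_cobd br lact ract \<psi> xs)"
proof -
  have s: "Z (sgn_pow n u)" if "Z u" for n u using that Z by (simp add: sgn_pow_def)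
  have sm: "Z (sum h J)" if "\<And>j. j \<in> J \<Longrightarrow> Z (h j)" for h and J :: "nat set"
    using that by (induction J rule: infinite_finite_induct) (auto intro: Z)
  have o: "Suc (length (omit j ys)) = length ys" if "1 \<le> j" "j \<le> length ys" for j and ys :: "'b list"
    using that by (simp add: omit_def)
  show ?thesis
  proof (cases "xs = []")
    case True
    then show ?thesis by (simp add: leibniz_cobd_def Z)
  next
    case False
    then have "Suc (length (butlast xs)) = length xs" by (cases xs) auto
    then show ?thesis using False unfolding leibniz_cobd_def Let_def
      by (auto intro!: s sm Z act \<psi> o simp: less_imp_le Suc_le_eq)
        (metis One_nat_def Suc_leI Suc_pred length_greater_0_conv length_list_update less_imp_le
          less_le_trans linorder_not_less o)+
  qed
qed

lemmas list_sum_simps = leibniz_cobd_def Let_def sgn_pow_Suc nth1_def omit_def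
  sum.cl_ivl_Suc sum.op_ivl_Suc numeral_eq_Suc

lemma leibniz_cobd_1: "leibniz_cobd br lact ract \<psi> [x] = ract (\<psi> []) x"
  and leibniz_cobd_2: "leibniz_cobd br lact ract \<psi> [x, y] =
      lact x (\<psi> [y]) + ract (\<psi> [x]) y - \<psi> [br x y]"
  and leibniz_cobd_3: "leibniz_cobd br lact ract \<psi> [x, y, z] =
      - (lact x (\<psi> [y, z]) - lact y (\<psi> [x, z]) - ract (\<psi> [x, y]) z
         - \<psi> [br x y, z] - \<psi> [y, br x z] + \<psi> [x, br y z])"
  and leibniz_cobd_4: "leibniz_cobd br lact ract \<psi> [x, y, z, w] =
      lact x (\<psi> [y, z, w]) - lact y (\<psi> [x, z, w]) + lact z (\<psi> [x, y, w]) + ract (\<psi> [x, y, z]) w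
      - \<psi> [br x y, z, w] - \<psi> [y, br x z, w] + \<psi> [x, br y z, w]
      - \<psi> [y, z, br x w] + \<psi> [x, z, br y w] - \<psi> [x, y, br z w]"
  by (simp_all add: list_sum_simps algebra_simps)

lemma hochschild_cobd_2: "hochschild_cobd m f [a, b] = m a (f [b]) - f [m a b] + m (f [a]) b"
  and hochschild_cobd_3: "hochschild_cobd m f [a, b, c] =
      m a (f [b, c]) - f [m a b, c] + f [a, m b c] - m (f [a, b]) c"
  and hochschild_cobd_4: "hochschild_cobd m f [a, b, c, d] =
      m a (f [b, c, d]) - f [m a b, c, d] + f [a, m b c, d] - f [a, b, m c d] + m (f [a, b, c]) d"
  by (simp_all add: hochschild_cobd_def merge_def list_sum_simps)

lemma hom_act_1: "hom_act P x f [a] = anch P x (f [a]) - f [anch P x a]"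
  and hom_act_2: "hom_act P x f [a, b] = anch P x (f [a, b]) - f [anch P x a, b] - f [a, anch P x b]"
  and hom_act_3: "hom_act P x f [a, b, c] =
    anch P x (f [a, b, c]) - f [anch P x a, b, c] - f [a, anch P x b, c] - f [a, b, anch P x c]"
  by (simp_all add: hom_act_def list_sum_simps algebra_simps)

lemmas cobd_simps = delta_tot_def split_def leibniz_cobd_1 leibniz_cobd_2 leibniz_cobd_3
  leibniz_cobd_4 hochschild_cobd_2 hochschild_cobd_3 hochschild_cobd_4
  hom_act_1 hom_act_2 hom_act_3 sgn_pow_def
  plus_fun_apply zero_fun_apply minus_apply uminus_apply

lemma linear_minus:
  assumes "Vector_Spaces.linear s t f" "Vector_Spaces.linear s t g"
  shows "Vector_Spaces.linear s t (\<lambda>x. f x - g x)"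
proof -
  interpret vector_space_pair s t
    using assms(1) by (simp add: vector_space_pair_def linear_vector_spaces)
  show ?thesis using assms by (rule linear_compose_sub)
qed

lemma C_tot_iff:
  "u \<in> C_tot P n \<longleftrightarrow>
     (\<forall>xs. length xs \<noteq> n \<longrightarrow> fst u xs = 0) \<and>
     (\<forall>xs k. length xs = n \<and> k < n \<longrightarrow>
        Vector_Spaces.linear (actL P) (actL P) (\<lambda>x. fst u (xs[k := x]))) \<and>
     (\<forall>xs as. as = [] \<or> length xs + length as \<noteq> n \<longrightarrow> snd u xs as = 0) \<and>
     (\<forall>xs as. as \<noteq> [] \<and> length xs + length as = n \<longrightarrow>
        (\<forall>k < length xs. Vector_Spaces.linear (actL P) (actA P) (\<lambda>x. snd u (xs[k := x]) as)) \<and>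
        (\<forall>k < length as. Vector_Spaces.linear (actA P) (actA P) (\<lambda>a. snd u xs (as[k := a]))))"
  unfolding C_tot_def by (simp only: split_def mem_Collect_eq)

context courant_over_field
begin

lemma hom_act_diff: "hom_act P x (u - v) = hom_act P x u - hom_act P x v"
  by (simp add: hom_act_def fun_eq_iff minus_apply anch_rules sum_subtractf)

lemma hochschild_cobd_diff:
  "hochschild_cobd (mult P) (f - g) as = hochschild_cobd (mult P) f as - hochschild_cobd (mult P) g as"
  by (simp add: hochschild_cobd_def Let_def minus_apply mult_rules sgn_pow_diff sum_subtractf)

lemma delta_tot_diff: "delta_tot P (u - v) = delta_tot P u - delta_tot P v"
proof (intro prod_eqI ext)
  show "fst (delta_tot P (u - v)) xs = fst (delta_tot P u - delta_tot P v) xs" for xs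
    by (simp add: delta_tot_def split_def minus_apply leibniz_cobd_diff brk_rules)
  have 1: "leibniz_cobd (brk P) (hom_act P) (\<lambda>h x. - hom_act P x h) (snd u - snd v) xs =
     leibniz_cobd (brk P) (hom_act P) (\<lambda>h x. - hom_act P x h) (snd u) xs
     - leibniz_cobd (brk P) (hom_act P) (\<lambda>h x. - hom_act P x h) (snd v) xs" for xs
    by (rule leibniz_cobd_diff) (simp_all add: hom_act_diff)
  show "snd (delta_tot P (u - v)) xs as = snd (delta_tot P u - delta_tot P v) xs as" for xs as
    by (simp add: delta_tot_def split_def minus_apply 1 anch_rules hochschild_cobd_diff sgn_pow_diff)
qed

lemma C_tot_diff: "u \<in> C_tot P n \<Longrightarrow> v \<in> C_tot P n \<Longrightarrow> u - v \<in> C_tot P n"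
  unfolding C_tot_iff by (simp add: minus_apply linear_minus)

lemma zero_in_C_tot: "0 \<in> C_tot P n"
  by (auto simp: C_tot_def zero_prod_def zero_fun_apply intro!: linear_intro vector_spaces
      simp: vector_space_rules[OF vsA] vector_space_rules[OF vsL])

lemma delta_tot_0: "delta_tot P 0 = 0"
  using delta_tot_diff[of 0 0] by simp

lemma delta_tot_degree:
  assumes u: "u \<in> C_tot P n"
  shows "length xs \<noteq> Suc n \<Longrightarrow> fst (delta_tot P u) xs = 0"
    and "as = [] \<or> length xs + length as \<noteq> Suc n \<Longrightarrow> snd (delta_tot P u) xs as = 0"
proof -
  obtain g f where gf: "u = (g, f)" by (cases u)
  have g: "g xs = 0" if "length xs \<noteq> n" for xs using u that by (simp add: gf C_tot_def)
  have f: "f xs as = 0" if "as = [] \<or> length xs + length as \<noteq> n" for xs as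
    using u that unfolding gf C_tot_def by blast
  show "fst (delta_tot P u) xs = 0" if "length xs \<noteq> Suc n"
    unfolding gf delta_tot_def using that
    by (auto intro!: leibniz_cobd_closed[where Z = "\<lambda>v. v = 0"] simp: brk_rules g)
  assume as: "as = [] \<or> length xs + length as \<noteq> Suc n"
  have "\<forall>bs. length bs = length as \<longrightarrow>
      leibniz_cobd (brk P) (hom_act P) (\<lambda>h x. - hom_act P x h) f xs bs = 0"
  proof (rule leibniz_cobd_closed[where Z = "\<lambda>h. \<forall>bs. length bs = length as \<longrightarrow> h bs = 0"])
    show "\<forall>bs. length bs = length as \<longrightarrow> f zs bs = 0" if "Suc (length zs) = length xs" for zs
      using as that by (auto intro!: f)
  qed (auto simp: plus_fun_apply zero_fun_apply uminus_apply hom_act_def anch_rules)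
  moreover have "anch P (g xs) (hd as) = 0" if "length as = 1"
    using as that by (auto simp: g anch_rules)
  moreover have "hochschild_cobd (mult P) (f xs) as = 0" if "as \<noteq> []" "length as \<noteq> 1"
  proof -
    have two: "2 \<le> length as" using that by (cases as; cases "tl as") auto
    have "f xs bs = 0" if "Suc (length bs) = length as" for bs
      using as that by (auto intro!: f)
    moreover have "Suc (length (merge (mult P) j as)) = length as"
      if "1 \<le> j" "j \<le> length as - 1" for j
      using that two by (simp add: merge_def)
    moreover have "Suc (length (butlast as)) = length as" "Suc (length (tl as)) = length as"
      using two by auto
    ultimately have "(\<Sum>j\<in>{1..length as - 1}. sgn_pow j (f xs (merge (mult P) j as))) = 0"
      "f xs (butlast as) = 0" "f xs (tl as) = 0"
      by (auto simp: sgn_pow_def intro!: sum.neutral)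
    then show ?thesis
      by (simp add: hochschild_cobd_def Let_def mult_rules) (simp add: sgn_pow_def)
  qed
  ultimately show "snd (delta_tot P u) xs as = 0"
    unfolding gf delta_tot_def by (auto simp: sgn_pow_def)
qed

end

lemma length_cases:
  "length xs = 1 \<Longrightarrow> \<exists>a. xs = [a]" "length xs = 2 \<Longrightarrow> \<exists>a b. xs = [a, b]"
  "length xs = 3 \<Longrightarrow> \<exists>a b c. xs = [a, b, c]" "length xs = 4 \<Longrightarrow> \<exists>a b c d. xs = [a, b, c, d]"
  by (auto simp: numeral_eq_Suc length_Suc_conv)

lemma bidegree_cases:
  assumes "as \<noteq> []"
  shows "length xs + length as = 2 \<Longrightarrow>
      xs = [] \<and> (\<exists>a b. as = [a, b]) \<or> (\<exists>x a. xs = [x] \<and> as = [a])"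
    and "length xs + length as = 3 \<Longrightarrow>
      xs = [] \<and> (\<exists>a b c. as = [a, b, c]) \<or> (\<exists>x a b. xs = [x] \<and> as = [a, b]) \<or>
      (\<exists>x y a. xs = [x, y] \<and> as = [a])"
    and "length xs + length as = 4 \<Longrightarrow>
      xs = [] \<and> (\<exists>a b c d. as = [a, b, c, d]) \<or> (\<exists>x a b c. xs = [x] \<and> as = [a, b, c]) \<or>
      (\<exists>x y a b. xs = [x, y] \<and> as = [a, b]) \<or> (\<exists>x y z a. xs = [x, y, z] \<and> as = [a])"
proof -
  have *: "0 < length as" using assms by simp
  show "xs = [] \<and> (\<exists>a b. as = [a, b]) \<or> (\<exists>x a. xs = [x] \<and> as = [a])"
    if "length xs + length as = 2"
  proof -
    have "length xs = 0 \<and> length as = 2 \<or> length xs = 1 \<and> length as = 1"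
      using * that by arith
    then show ?thesis using length_cases[of xs] length_cases[of as] by auto
  qed
  show "xs = [] \<and> (\<exists>a b c. as = [a, b, c]) \<or> (\<exists>x a b. xs = [x] \<and> as = [a, b]) \<or>
      (\<exists>x y a. xs = [x, y] \<and> as = [a])" if "length xs + length as = 3"
  proof -
    have "length xs = 0 \<and> length as = 3 \<or> length xs = 1 \<and> length as = 2 \<or>
        length xs = 2 \<and> length as = 1" using * that by arith
    then show ?thesis using length_cases[of xs] length_cases[of as] by auto
  qed
  show "xs = [] \<and> (\<exists>a b c d. as = [a, b, c, d]) \<or> (\<exists>x a b c. xs = [x] \<and> as = [a, b, c]) \<or>
      (\<exists>x y a b. xs = [x, y] \<and> as = [a, b]) \<or> (\<exists>x y z a. xs = [x, y, z] \<and> as = [a])"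
    if "length xs + length as = 4"
  proof -
    have "length xs = 0 \<and> length as = 4 \<or> length xs = 1 \<and> length as = 3 \<or>
        length xs = 2 \<and> length as = 2 \<or> length xs = 3 \<and> length as = 1"
      using * that by arith
    then show ?thesis using length_cases[of xs] length_cases[of as] by auto
  qed
qed

lemma cochain_degree_3_eqI:
  assumes "\<And>xs. length xs \<noteq> 3 \<Longrightarrow> fst u xs = fst v xs"
    and "\<And>xs as. as = [] \<or> length xs + length as \<noteq> 3 \<Longrightarrow> snd u xs as = snd v xs as"
    and "\<And>a b c. snd u [] [a, b, c] = snd v [] [a, b, c]"
    and "\<And>x a b. snd u [x] [a, b] = snd v [x] [a, b]"
    and "\<And>x y a. snd u [x, y] [a] = snd v [x, y] [a]"
    and "\<And>x y z. fst u [x, y, z] = fst v [x, y, z]"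
  shows "u = (v :: ('a, 'l) cochain)"
proof (intro prod_eqI ext)
  show "fst u xs = fst v xs" for xs
    using assms(1,6) length_cases(3)[of xs] by (cases "length xs = 3") auto
  show "snd u xs as = snd v xs as" for xs as
  proof (cases "as = [] \<or> length xs + length as \<noteq> 3")
    case False
    then show ?thesis using assms(3-5) bidegree_cases(2)[of as xs] by auto
  qed (use assms(2) in blast)
qed

lemma cochain_degree_4_eqI:
  assumes "\<And>xs. length xs \<noteq> 4 \<Longrightarrow> fst u xs = fst v xs"
    and "\<And>xs as. as = [] \<or> length xs + length as \<noteq> 4 \<Longrightarrow> snd u xs as = snd v xs as"
    and "\<And>a b c d. snd u [] [a, b, c, d] = snd v [] [a, b, c, d]"
    and "\<And>x a b c. snd u [x] [a, b, c] = snd v [x] [a, b, c]"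
    and "\<And>x y a b. snd u [x, y] [a, b] = snd v [x, y] [a, b]"
    and "\<And>x y z a. snd u [x, y, z] [a] = snd v [x, y, z] [a]"
    and "\<And>x y z w. fst u [x, y, z, w] = fst v [x, y, z, w]"
  shows "u = (v :: ('a, 'l) cochain)"
proof (intro prod_eqI ext)
  show "fst u xs = fst v xs" for xs
    using assms(1,7) length_cases(4)[of xs] by (cases "length xs = 4") auto
  show "snd u xs as = snd v xs as" for xs as
  proof (cases "as = [] \<or> length xs + length as \<noteq> 4")
    case False
    then show ?thesis using assms(3-6) bidegree_cases(3)[of as xs] by auto
  qed (use assms(2) in blast)
qed

definition cochain2 ::
  "('a \<Rightarrow> 'a \<Rightarrow> 'a) \<Rightarrow> ('l \<Rightarrow> 'a \<Rightarrow> 'a) \<Rightarrow> ('l \<Rightarrow> 'l \<Rightarrow> 'l) \<Rightarrow> ('a::zero, 'l::zero) cochain" where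
  "cochain2 f1 f2 f3 =
     (\<lambda>xs. case xs of [x, y] \<Rightarrow> f3 x y | _ \<Rightarrow> 0,
      \<lambda>xs as. case (xs, as) of ([], [a, b]) \<Rightarrow> f1 a b | ([x], [a]) \<Rightarrow> f2 x a | _ \<Rightarrow> 0)"

definition cochain3 ::
  "('a \<Rightarrow> 'a \<Rightarrow> 'a \<Rightarrow> 'a) \<Rightarrow> ('l \<Rightarrow> 'a \<Rightarrow> 'a \<Rightarrow> 'a) \<Rightarrow> ('l \<Rightarrow> 'l \<Rightarrow> 'a \<Rightarrow> 'a) \<Rightarrow> ('l \<Rightarrow> 'l \<Rightarrow> 'l \<Rightarrow> 'l) \<Rightarrow>
   ('a::zero, 'l::zero) cochain" where
  "cochain3 fA f1 f2 fL =
     (\<lambda>xs. case xs of [x, y, z] \<Rightarrow> fL x y z | _ \<Rightarrow> 0,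
      \<lambda>xs as. case (xs, as) of ([], [a, b, c]) \<Rightarrow> fA a b c | ([x], [a, b]) \<Rightarrow> f1 x a b
        | ([x, y], [a]) \<Rightarrow> f2 x y a | _ \<Rightarrow> 0)"

lemma cochain2_simps [simp]:
  "fst (cochain2 f1 f2 f3) [x, y] = f3 x y" "snd (cochain2 f1 f2 f3) [] [a, b] = f1 a b"
  "snd (cochain2 f1 f2 f3) [x] [a] = f2 x a"
  by (simp_all add: cochain2_def)

lemma cochain3_simps [simp]:
  "fst (cochain3 fA f1 f2 fL) [x, y, z] = fL x y z"
  "snd (cochain3 fA f1 f2 fL) [] [a, b, c] = fA a b c"
  "snd (cochain3 fA f1 f2 fL) [x] [a, b] = f1 x a b"
  "snd (cochain3 fA f1 f2 fL) [x, y] [a] = f2 x y a"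
  by (simp_all add: cochain3_def)

context courant_over_field
begin

lemma cochain2_in_C_tot:
  assumes "bilin (actA P) (actA P) (actA P) f1" "bilin (actL P) (actA P) (actA P) f2"
    "bilin (actL P) (actL P) (actL P) f3"
  shows "cochain2 f1 f2 f3 \<in> C_tot P 2"
  unfolding C_tot_iff
proof (intro conjI allI impI)
  note r = assms[unfolded bilin_def]
  fix xs :: "'l list" and k :: nat
  assume *: "length xs = 2 \<and> k < 2"
  then obtain x y where "xs = [x, y]" using length_cases(2) by blast
  moreover have "k = 0 \<or> k = 1" using * by auto
  ultimately show "Vector_Spaces.linear (actL P) (actL P)
      (\<lambda>x. fst (cochain2 f1 f2 f3) (xs[k := x]))"
    using r by auto
next
  note r = assms[unfolded bilin_def]
  fix xs :: "'l list" and as :: "'a list" and k :: nat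
  assume *: "as \<noteq> [] \<and> length xs + length as = 2"
  then have "xs = [] \<and> (\<exists>a b. as = [a, b]) \<or> (\<exists>x a. xs = [x] \<and> as = [a])"
    using bidegree_cases(1) by blast
  moreover have "k < Suc (Suc 0) \<longleftrightarrow> k = 0 \<or> k = 1" by auto
  ultimately show "k < length xs \<Longrightarrow> Vector_Spaces.linear (actL P) (actA P)
      (\<lambda>x. snd (cochain2 f1 f2 f3) (xs[k := x]) as)"
    "k < length as \<Longrightarrow> Vector_Spaces.linear (actA P) (actA P)
      (\<lambda>a. snd (cochain2 f1 f2 f3) xs (as[k := a]))"
    using r by auto
qed (auto simp: cochain2_def split: list.splits)

lemma cochain3_in_C_tot:
  assumes A: "\<And>b c. Vector_Spaces.linear (actA P) (actA P) (\<lambda>a. fA a b c)"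
      "\<And>a c. Vector_Spaces.linear (actA P) (actA P) (\<lambda>b. fA a b c)"
      "\<And>a b. Vector_Spaces.linear (actA P) (actA P) (\<lambda>c. fA a b c)"
    and 1: "\<And>b c. Vector_Spaces.linear (actL P) (actA P) (\<lambda>a. f1 a b c)"
      "\<And>a c. Vector_Spaces.linear (actA P) (actA P) (\<lambda>b. f1 a b c)"
      "\<And>a b. Vector_Spaces.linear (actA P) (actA P) (\<lambda>c. f1 a b c)"
    and 2: "\<And>b c. Vector_Spaces.linear (actL P) (actA P) (\<lambda>a. f2 a b c)"
      "\<And>a c. Vector_Spaces.linear (actL P) (actA P) (\<lambda>b. f2 a b c)"
      "\<And>a b. Vector_Spaces.linear (actA P) (actA P) (\<lambda>c. f2 a b c)"
    and L: "\<And>b c. Vector_Spaces.linear (actL P) (actL P) (\<lambda>a. fL a b c)"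
      "\<And>a c. Vector_Spaces.linear (actL P) (actL P) (\<lambda>b. fL a b c)"
      "\<And>a b. Vector_Spaces.linear (actL P) (actL P) (\<lambda>c. fL a b c)"
  shows "cochain3 fA f1 f2 fL \<in> C_tot P 3"
  unfolding C_tot_iff
proof (intro conjI allI impI)
  fix xs :: "'l list" and k :: nat
  assume *: "length xs = 3 \<and> k < 3"
  then obtain x y z where "xs = [x, y, z]" using length_cases(3) by blast
  moreover have "k = 0 \<or> k = 1 \<or> k = 2" using * by auto
  ultimately show "Vector_Spaces.linear (actL P) (actL P)
      (\<lambda>x. fst (cochain3 fA f1 f2 fL) (xs[k := x]))"
    using L by (auto simp: numeral_2_eq_2)
next
  fix xs :: "'l list" and as :: "'a list" and k :: nat
  assume *: "as \<noteq> [] \<and> length xs + length as = 3"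
  then have "xs = [] \<and> (\<exists>a b c. as = [a, b, c]) \<or> (\<exists>x a b. xs = [x] \<and> as = [a, b]) \<or>
      (\<exists>x y a. xs = [x, y] \<and> as = [a])"
    using bidegree_cases(2) by blast
  moreover have "k < Suc (Suc 0) \<longleftrightarrow> k = 0 \<or> k = 1"
      "k < Suc (Suc (Suc 0)) \<longleftrightarrow> k = 0 \<or> k = 1 \<or> k = Suc (Suc 0)" by auto
  ultimately show "k < length xs \<Longrightarrow> Vector_Spaces.linear (actL P) (actA P)
      (\<lambda>x. snd (cochain3 fA f1 f2 fL) (xs[k := x]) as)"
    "k < length as \<Longrightarrow> Vector_Spaces.linear (actA P) (actA P)
      (\<lambda>a. snd (cochain3 fA f1 f2 fL) xs (as[k := a]))"
    using A 1 2 by auto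
qed (auto simp: cochain3_def split: list.splits)

lemma C_tot_2_bilin:
  assumes u: "u \<in> C_tot P 2"
  shows "bilin (actA P) (actA P) (actA P) (\<lambda>a b. snd u [] [a, b])"
    "bilin (actL P) (actA P) (actA P) (\<lambda>x a. snd u [x] [a])"
    "bilin (actL P) (actL P) (actL P) (\<lambda>x y. fst u [x, y])"
proof -
  obtain g f where gf: "u = (g, f)" by (cases u)
  have g: "Vector_Spaces.linear (actL P) (actL P) (\<lambda>x. g (xs[k := x]))"
    if "length xs = 2" "k < 2" for xs k
    using u that by (simp add: gf C_tot_def)
  have f: "k < length xs \<Longrightarrow> Vector_Spaces.linear (actL P) (actA P) (\<lambda>x. f (xs[k := x]) as)"
    "j < length as \<Longrightarrow> Vector_Spaces.linear (actA P) (actA P) (\<lambda>a. f xs (as[j := a]))"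
    if "as \<noteq> []" "length xs + length as = 2" for xs as k j
    using u that by (simp_all add: gf C_tot_def)
  show "bilin (actA P) (actA P) (actA P) (\<lambda>a b. snd u [] [a, b])"
    unfolding bilin_def gf using f(2)[of "[_, _]" "[]" 0] f(2)[of "[_, _]" "[]" 1] by simp
  show "bilin (actL P) (actA P) (actA P) (\<lambda>x a. snd u [x] [a])"
    unfolding bilin_def gf using f(1)[of "[_]" "[_]" 0] f(2)[of "[_]" "[_]" 0] by simp
  show "bilin (actL P) (actL P) (actL P) (\<lambda>x y. fst u [x, y])"
    unfolding bilin_def gf using g[of "[_, _]" 0] g[of "[_, _]" 1] by simp
qed

end


section \<open>The obstruction cochain of a lift\<close>

lemma tscale_rules:
  "tscale c (x + y) = tscale c x + tscale c y" "tscale c (x - y) = tscale c x - tscale c y"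
  "tscale c (- x) = - tscale c x"
  by (simp_all add: tscale_def fun_eq_iff plus_fun_apply minus_apply uminus_apply algebra_simps)

lemma leibniz_cobd_0: "leibniz_cobd br lact ract \<psi> [] = 0"
  by (simp add: leibniz_cobd_def)

text \<open>
  In degree two these are the first order variations of the four defects under a variation of the
  product, the anchor and the bracket.
\<close>

lemma delta_tot_2:
  "snd (delta_tot P u) [] [a, b, c] =
     mult P a (snd u [] [b, c]) - snd u [] [mult P a b, c] + snd u [] [a, mult P b c]
     - mult P (snd u [] [a, b]) c"
  "snd (delta_tot P u) [x] [a, b] =
     mult P a (snd u [x] [b]) - snd u [x] [mult P a b] + mult P (snd u [x] [a]) b
     - (anch P x (snd u [] [a, b]) - snd u [] [anch P x a, b] - snd u [] [a, anch P x b])"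
  "snd (delta_tot P u) [x, y] [a] =
     anch P (fst u [x, y]) a - (anch P x (snd u [y] [a]) - snd u [y] [anch P x a])
     + (anch P y (snd u [x] [a]) - snd u [x] [anch P y a]) + snd u [brk P x y] [a]"
  "fst (delta_tot P u) [x, y, z] =
     - (brk P x (fst u [y, z]) - brk P y (fst u [x, z]) - brk P (fst u [x, y]) z
        - fst u [brk P x y, z] - fst u [y, brk P x z] + fst u [x, brk P y z])"
  by (simp_all add: cobd_simps leibniz_cobd_0)

lemma delta_tot_3:
  "snd (delta_tot P u) [] [a, b, c, d] =
     mult P a (snd u [] [b, c, d]) - snd u [] [mult P a b, c, d] + snd u [] [a, mult P b c, d]
     - snd u [] [a, b, mult P c d] + mult P (snd u [] [a, b, c]) d"
  "snd (delta_tot P u) [x] [a, b, c] =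
     mult P a (snd u [x] [b, c]) - snd u [x] [mult P a b, c] + snd u [x] [a, mult P b c]
     - mult P (snd u [x] [a, b]) c
     + (anch P x (snd u [] [a, b, c]) - snd u [] [anch P x a, b, c] - snd u [] [a, anch P x b, c]
        - snd u [] [a, b, anch P x c])"
  "snd (delta_tot P u) [x, y] [a, b] =
     mult P a (snd u [x, y] [b]) - snd u [x, y] [mult P a b] + mult P (snd u [x, y] [a]) b
     + (anch P x (snd u [y] [a, b]) - snd u [y] [anch P x a, b] - snd u [y] [a, anch P x b])
     - (anch P y (snd u [x] [a, b]) - snd u [x] [anch P y a, b] - snd u [x] [a, anch P y b])
     - snd u [brk P x y] [a, b]"
  "snd (delta_tot P u) [x, y, z] [a] =
     anch P (fst u [x, y, z]) a
     + (anch P x (snd u [y, z] [a]) - snd u [y, z] [anch P x a])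
     - (anch P y (snd u [x, z] [a]) - snd u [x, z] [anch P y a])
     + (anch P z (snd u [x, y] [a]) - snd u [x, y] [anch P z a])
     - snd u [brk P x y, z] [a] - snd u [y, brk P x z] [a] + snd u [x, brk P y z] [a]"
  "fst (delta_tot P u) [x, y, z, w] =
     brk P x (fst u [y, z, w]) - brk P y (fst u [x, z, w]) + brk P z (fst u [x, y, w])
     + brk P (fst u [x, y, z]) w
     - fst u [brk P x y, z, w] - fst u [y, brk P x z, w] + fst u [x, brk P y z, w]
     - fst u [y, z, brk P x w] + fst u [x, z, brk P y w] - fst u [x, y, brk P z w]"
  by (simp_all add: cobd_simps leibniz_cobd_0)

context lifting_problem
begin

lemma defect_cochain_iff:
  "defect_cochain P S (i 1) T \<Theta> \<longleftrightarrow> \<Theta> \<in> C_tot P 3 \<and>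
    (\<forall>a b c. EA (snd \<Theta> [] [a, b, c]) = defectA T (\<iota>A a) (\<iota>A b) (\<iota>A c)) \<and>
    (\<forall>x a b. EA (snd \<Theta> [x] [a, b]) = defect1 T (\<iota>L x) (\<iota>A a) (\<iota>A b)) \<and>
    (\<forall>x y a. EA (snd \<Theta> [x, y] [a]) = defect2 T (\<iota>L x) (\<iota>L y) (\<iota>A a)) \<and>
    (\<forall>x y z. EL (fst \<Theta> [x, y, z]) = defectL T (\<iota>L x) (\<iota>L y) (\<iota>L z))"
  unfolding defect_cochain_def Let_def defect_defs emb_def ..

lemma emb_eq_0_iff: "EA a = 0 \<longleftrightarrow> a = 0" "EL x = 0 \<longleftrightarrow> x = 0"
  using emb_inject[OF vsA, of a 0] emb_inject[OF vsL, of x 0] by (simp_all add: emb_rules vsA vsL)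

lemmas emb_lin = emb_rules(1-4)[OF vsA] emb_rules(1-4)[OF vsL]

end

context lifted
begin

lemma defect_reduce:
  "t \<in> SA \<Longrightarrow> u \<in> SA \<Longrightarrow> v \<in> SA \<Longrightarrow>
    defectA T t u v = defectA T (\<iota>A (\<alpha>A t)) (\<iota>A (\<alpha>A u)) (\<iota>A (\<alpha>A v))"
  "x \<in> SL \<Longrightarrow> t \<in> SA \<Longrightarrow> u \<in> SA \<Longrightarrow>
    defect1 T x t u = defect1 T (\<iota>L (\<alpha>L x)) (\<iota>A (\<alpha>A t)) (\<iota>A (\<alpha>A u))"
  "x \<in> SL \<Longrightarrow> y \<in> SL \<Longrightarrow> t \<in> SA \<Longrightarrow>
    defect2 T x y t = defect2 T (\<iota>L (\<alpha>L x)) (\<iota>L (\<alpha>L y)) (\<iota>A (\<alpha>A t))"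
  "x \<in> SL \<Longrightarrow> y \<in> SL \<Longrightarrow> z \<in> SL \<Longrightarrow>
    defectL T x y z = defectL T (\<iota>L (\<alpha>L x)) (\<iota>L (\<alpha>L y)) (\<iota>L (\<alpha>L z))"
  using defectA_aug(1)[of t u v] defectA_aug(2)[of "\<iota>A (\<alpha>A t)" u v]
    defectA_aug(3)[of "\<iota>A (\<alpha>A t)" "\<iota>A (\<alpha>A u)" v]
    defect1_aug(1)[of x t u] defect1_aug(2)[of "\<iota>L (\<alpha>L x)" t u]
    defect1_aug(3)[of "\<iota>L (\<alpha>L x)" "\<iota>A (\<alpha>A t)" u]
    defect2_aug(1)[of x y t] defect2_aug(2)[of "\<iota>L (\<alpha>L x)" y t]
    defect2_aug(3)[of "\<iota>L (\<alpha>L x)" "\<iota>L (\<alpha>L y)" t]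
    defectL_aug(1)[of x y z] defectL_aug(2)[of "\<iota>L (\<alpha>L x)" y z]
    defectL_aug(3)[of "\<iota>L (\<alpha>L x)" "\<iota>L (\<alpha>L y)" z]
  by auto

text \<open>
  The defects lie in the kernel of \<open>p \<otimes> id\<close>, because \<open>\<lambda>\<close> is a deformation, so their coefficients
  at \<open>e\<close> determine them.
\<close>

lemma defect_cochain_exists: "\<exists>\<Theta>. defect_cochain P S (i 1) T \<Theta>"
proof -
  let ?cA = "emb_coeff (actA P)" and ?cL = "emb_coeff (actL P)"
  let ?\<Theta> = "cochain3
    (\<lambda>a b c. ?cA (defectA T (\<iota>A a) (\<iota>A b) (\<iota>A c))) (\<lambda>x a b. ?cA (defect1 T (\<iota>L x) (\<iota>A a) (\<iota>A b)))
    (\<lambda>x y a. ?cA (defect2 T (\<iota>L x) (\<iota>L y) (\<iota>A a))) (\<lambda>x y z. ?cL (defectL T (\<iota>L x) (\<iota>L y) (\<iota>L z)))"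
  note lin = linear_rules[OF emb_coeff_linear[OF vsA]] linear_rules[OF emb_coeff_linear[OF vsL]]
    S.one_tensor_rules[OF vsA] S.one_tensor_rules[OF vsL]
  have "?\<Theta> \<in> C_tot P 3"
    by (intro cochain3_in_C_tot linear_intro vsA vsL)
      (simp_all add: lin defectA_linear defect1_linear defect2_linear defectL_linear,
        simp_all add: defect_defs lin flip: tscale_rules)
  then have "defect_cochain P S (i 1) T ?\<Theta>"
    unfolding defect_cochain_iff
    by (simp add: emb_emb_coeff[OF vsA] emb_emb_coeff[OF vsL] pi_defects)
  then show ?thesis ..
qed

text \<open>
  The coboundary of the defect cochain is an identity between nested products, valid for any
  bilinear operations; this is the pentagon identity in the case of \<open>\<theta>\<^sub>A\<close>.
\<close>

lemma defect_cochain_cocycle: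
  assumes \<Theta>: "defect_cochain P S (i 1) T \<Theta>"
  shows "\<Theta> \<in> Z_tot P 3"
proof -
  note \<Theta>_in = conjunct1[OF \<Theta>[unfolded defect_cochain_iff]]
    and E = conjunct2[OF \<Theta>[unfolded defect_cochain_iff]]
  have E: "EA (snd \<Theta> [] [a, b, c]) = defectA T (\<iota>A a) (\<iota>A b) (\<iota>A c)"
    "EA (snd \<Theta> [x] [a, b]) = defect1 T (\<iota>L x) (\<iota>A a) (\<iota>A b)"
    "EA (snd \<Theta> [x, y] [a]) = defect2 T (\<iota>L x) (\<iota>L y) (\<iota>A a)"
    "EL (fst \<Theta> [x, y, z]) = defectL T (\<iota>L x) (\<iota>L y) (\<iota>L z)" for a b c x y z
    using E by auto
  \<comment> \<open>Below, \<open>E\<close> of an undeformed product with a value of \<open>\<Theta>\<close> becomes a product of \<open>T\<close> with a defect.\<close>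
  have E_op: "EA (mult P a b) = m (\<iota>A a) (EA b)" "EA (anch P x a) = \<mu> (\<iota>L x) (EA a)"
    "EL (brk P x y) = br (\<iota>L x) (EL y)" for a b x y
    by simp_all
  have E_op': "EA (mult P a b) = m (EA a) (\<iota>A b)" "EA (anch P x a) = \<mu> (EL x) (\<iota>A a)"
    "EL (brk P x y) = br (EL x) (\<iota>L y)" for a b x y
    by simp_all
  \<comment> \<open>The elements \<open>1 \<otimes> ab\<close> and \<open>(1 \<otimes> a)(1 \<otimes> b)\<close> have the same augmentation, hence the same defects.\<close>
  have A: "defectA T (\<iota>A (mult P a b)) (\<iota>A v) (\<iota>A w) = defectA T (m (\<iota>A a) (\<iota>A b)) (\<iota>A v) (\<iota>A w)"
      "defectA T (\<iota>A (anch P x b)) (\<iota>A v) (\<iota>A w) = defectA T (\<mu> (\<iota>L x) (\<iota>A b)) (\<iota>A v) (\<iota>A w)"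
      "defectA T (\<iota>A u) (\<iota>A (mult P a b)) (\<iota>A w) = defectA T (\<iota>A u) (m (\<iota>A a) (\<iota>A b)) (\<iota>A w)"
      "defectA T (\<iota>A u) (\<iota>A (anch P x b)) (\<iota>A w) = defectA T (\<iota>A u) (\<mu> (\<iota>L x) (\<iota>A b)) (\<iota>A w)"
      "defectA T (\<iota>A u) (\<iota>A v) (\<iota>A (mult P a b)) = defectA T (\<iota>A u) (\<iota>A v) (m (\<iota>A a) (\<iota>A b))"
      "defectA T (\<iota>A u) (\<iota>A v) (\<iota>A (anch P x b)) = defectA T (\<iota>A u) (\<iota>A v) (\<mu> (\<iota>L x) (\<iota>A b))"
    for a b x y u v w
    using defectA_aug(1)[of "m (\<iota>A a) (\<iota>A b)" "\<iota>A v" "\<iota>A w"]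
      defectA_aug(1)[of "\<mu> (\<iota>L x) (\<iota>A b)" "\<iota>A v" "\<iota>A w"]
      defectA_aug(2)[of "\<iota>A u" "m (\<iota>A a) (\<iota>A b)" "\<iota>A w"]
      defectA_aug(2)[of "\<iota>A u" "\<mu> (\<iota>L x) (\<iota>A b)" "\<iota>A w"]
      defectA_aug(3)[of "\<iota>A u" "\<iota>A v" "m (\<iota>A a) (\<iota>A b)"]
      defectA_aug(3)[of "\<iota>A u" "\<iota>A v" "\<mu> (\<iota>L x) (\<iota>A b)"]
    by simp_all
  have 1: "defect1 T (\<iota>L (brk P x y)) (\<iota>A v) (\<iota>A w) = defect1 T (br (\<iota>L x) (\<iota>L y)) (\<iota>A v) (\<iota>A w)"
      "defect1 T (\<iota>L u) (\<iota>A (mult P a b)) (\<iota>A w) = defect1 T (\<iota>L u) (m (\<iota>A a) (\<iota>A b)) (\<iota>A w)"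
      "defect1 T (\<iota>L u) (\<iota>A (anch P x b)) (\<iota>A w) = defect1 T (\<iota>L u) (\<mu> (\<iota>L x) (\<iota>A b)) (\<iota>A w)"
      "defect1 T (\<iota>L u) (\<iota>A v) (\<iota>A (mult P a b)) = defect1 T (\<iota>L u) (\<iota>A v) (m (\<iota>A a) (\<iota>A b))"
      "defect1 T (\<iota>L u) (\<iota>A v) (\<iota>A (anch P x b)) = defect1 T (\<iota>L u) (\<iota>A v) (\<mu> (\<iota>L x) (\<iota>A b))"
    for a b x y u v w
    using defect1_aug(1)[of "br (\<iota>L x) (\<iota>L y)" "\<iota>A v" "\<iota>A w"]
      defect1_aug(2)[of "\<iota>L u" "m (\<iota>A a) (\<iota>A b)" "\<iota>A w"]
      defect1_aug(2)[of "\<iota>L u" "\<mu> (\<iota>L x) (\<iota>A b)" "\<iota>A w"]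
      defect1_aug(3)[of "\<iota>L u" "\<iota>A v" "m (\<iota>A a) (\<iota>A b)"]
      defect1_aug(3)[of "\<iota>L u" "\<iota>A v" "\<mu> (\<iota>L x) (\<iota>A b)"]
    by simp_all
  have 2: "defect2 T (\<iota>L (brk P x y)) (\<iota>L v) (\<iota>A w) = defect2 T (br (\<iota>L x) (\<iota>L y)) (\<iota>L v) (\<iota>A w)"
      "defect2 T (\<iota>L u) (\<iota>L (brk P x y)) (\<iota>A w) = defect2 T (\<iota>L u) (br (\<iota>L x) (\<iota>L y)) (\<iota>A w)"
      "defect2 T (\<iota>L u) (\<iota>L v) (\<iota>A (mult P a b)) = defect2 T (\<iota>L u) (\<iota>L v) (m (\<iota>A a) (\<iota>A b))"
      "defect2 T (\<iota>L u) (\<iota>L v) (\<iota>A (anch P x b)) = defect2 T (\<iota>L u) (\<iota>L v) (\<mu> (\<iota>L x) (\<iota>A b))"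
    for a b x y u v w
    using defect2_aug(1)[of "br (\<iota>L x) (\<iota>L y)" "\<iota>L v" "\<iota>A w"]
      defect2_aug(2)[of "\<iota>L u" "br (\<iota>L x) (\<iota>L y)" "\<iota>A w"]
      defect2_aug(3)[of "\<iota>L u" "\<iota>L v" "m (\<iota>A a) (\<iota>A b)"]
      defect2_aug(3)[of "\<iota>L u" "\<iota>L v" "\<mu> (\<iota>L x) (\<iota>A b)"]
    by simp_all
  have L: "defectL T (\<iota>L (brk P x y)) (\<iota>L v) (\<iota>L w) = defectL T (br (\<iota>L x) (\<iota>L y)) (\<iota>L v) (\<iota>L w)"
      "defectL T (\<iota>L u) (\<iota>L (brk P x y)) (\<iota>L w) = defectL T (\<iota>L u) (br (\<iota>L x) (\<iota>L y)) (\<iota>L w)"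
      "defectL T (\<iota>L u) (\<iota>L v) (\<iota>L (brk P x y)) = defectL T (\<iota>L u) (\<iota>L v) (br (\<iota>L x) (\<iota>L y))"
    for a b x y u v w
    using defectL_aug(1)[of "br (\<iota>L x) (\<iota>L y)" "\<iota>L v" "\<iota>L w"]
      defectL_aug(2)[of "\<iota>L u" "br (\<iota>L x) (\<iota>L y)" "\<iota>L w"]
      defectL_aug(3)[of "\<iota>L u" "\<iota>L v" "br (\<iota>L x) (\<iota>L y)"]
    by simp_all
  note E_op_\<Theta> = E_op(1)[of _ "snd \<Theta> _ _"] E_op(2)[of _ "snd \<Theta> _ _"] E_op(3)[of _ "fst \<Theta> _"]
    E_op'(1)[of "snd \<Theta> _ _"] E_op'(2)[of "fst \<Theta> _"] E_op'(3)[of "fst \<Theta> _"]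
  have v: "EA (snd (delta_tot P \<Theta>) [] [a, b, c, d]) = 0"
    "EA (snd (delta_tot P \<Theta>) [x] [a, b, c]) = 0"
    "EA (snd (delta_tot P \<Theta>) [x, y] [a, b]) = 0"
    "EA (snd (delta_tot P \<Theta>) [x, y, z] [a]) = 0"
    "EL (fst (delta_tot P \<Theta>) [x, y, z, w]) = 0"
    for a b c d x y z w
    by (simp_all add: delta_tot_3 emb_lin E_op_\<Theta> E A 1 2 L del: T_emb) (simp_all add: defect_defs)
  have "delta_tot P \<Theta> = 0"
  proof (rule cochain_degree_4_eqI)
    show "fst (delta_tot P \<Theta>) xs = fst 0 xs" if "length xs \<noteq> 4" for xs
      using delta_tot_degree(1)[OF \<Theta>_in] that by (simp add: zero_fun_apply)
    show "snd (delta_tot P \<Theta>) xs as = snd 0 xs as"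
      if "as = [] \<or> length xs + length as \<noteq> 4" for xs as
      using delta_tot_degree(2)[OF \<Theta>_in] that by (simp add: zero_fun_apply)
    show "snd (delta_tot P \<Theta>) [] [a, b, c, d] = snd 0 [] [a, b, c, d]" for a b c d
      using v(1) by (simp add: emb_eq_0_iff zero_fun_apply)
    show "snd (delta_tot P \<Theta>) [x] [a, b, c] = snd 0 [x] [a, b, c]" for x a b c
      using v(2) by (simp add: emb_eq_0_iff zero_fun_apply)
    show "snd (delta_tot P \<Theta>) [x, y] [a, b] = snd 0 [x, y] [a, b]" for x y a b
      using v(3) by (simp add: emb_eq_0_iff zero_fun_apply)
    show "snd (delta_tot P \<Theta>) [x, y, z] [a] = snd 0 [x, y, z] [a]" for x y z a
      using v(4) by (simp add: emb_eq_0_iff zero_fun_apply)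
    show "fst (delta_tot P \<Theta>) [x, y, z, w] = fst 0 [x, y, z, w]" for x y z w
      using v(5) by (simp add: emb_eq_0_iff zero_fun_apply)
  qed
  then show ?thesis using \<Theta>_in by (simp add: Z_tot_def)
qed

lemma deformation_iff_zero_defect:
  "deformation P S (\<epsilon> \<circ> p) T \<longleftrightarrow> defect_cochain P S (i 1) T 0"
proof
  assume "deformation P S (\<epsilon> \<circ> p) T"
  then have "defects_vanish P S T" by (simp add: S.deformation_iff)
  then show "defect_cochain P S (i 1) T 0"
    unfolding defect_cochain_iff defects_vanish_def
    by (simp add: zero_in_C_tot zero_fun_apply emb_lin)
next
  assume "defect_cochain P S (i 1) T 0"
  then have "defectA T (\<iota>A a) (\<iota>A b) (\<iota>A c) = 0" "defect1 T (\<iota>L x) (\<iota>A a) (\<iota>A b) = 0"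
    "defect2 T (\<iota>L x) (\<iota>L y) (\<iota>A a) = 0" "defectL T (\<iota>L x) (\<iota>L y) (\<iota>L z) = 0" for a b c x y z
    unfolding defect_cochain_iff by (simp_all add: zero_fun_apply emb_lin)
  then have "defects_vanish P S T"
    unfolding defects_vanish_def
    by (intro conjI ballI; subst defect_reduce) simp_all
  then show "deformation P S (\<epsilon> \<circ> p) T"
    by (simp add: S.deformation_iff T_triplet T_reduces)
qed

end

context lifting_problem
begin

lemma lifted: "lift T \<Longrightarrow> lifted R \<epsilon> S i p P lam T"
  by unfold_locales

text \<open>
  The lift \<open>T + e \<otimes> \<Phi>\<close>. On \<open>S \<otimes> A\<close> and \<open>S \<otimes> L\<close>, all lifts of \<open>\<lambda>\<close> arise in this way from a given one.
\<close>

definition perturb :: "('k, 's, 'a, 'l) deform \<Rightarrow> ('a, 'l) cochain \<Rightarrow> ('k, 's, 'a, 'l) deform" where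
  "perturb T \<Phi> = \<lparr>
     tmult = (\<lambda>t u. tmult T t u + EA (snd \<Phi> [] [\<alpha>A t, \<alpha>A u])),
     tanch = (\<lambda>x t. tanch T x t + EA (snd \<Phi> [\<alpha>L x] [\<alpha>A t])),
     tbrk = (\<lambda>x y. tbrk T x y + EL (fst \<Phi> [\<alpha>L x, \<alpha>L y])) \<rparr>"

lemma ext_bilinear_emb:
  assumes vs: "vector_space sU" "vector_space sV" "vector_space sW" and f: "bilin sU sV sW f"
  shows "ext_bilinear S sU sV sW
    (\<lambda>t u. emb sW (f (aug_map S sU (\<epsilon> \<circ> p) t) (aug_map S sV (\<epsilon> \<circ> p) u)))"
  unfolding bilinear_on_def linear_on_def
  by (simp add: aug_map_rules[OF S.aug_linear] S.aug_base_act vs bilin_rules[OF f] emb_rules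
      emb_closed base_act_emb) (simp add: o_apply)

lemma ext_bilinear_plus:
  assumes vs: "vector_space sU" "vector_space sV" "vector_space sW"
    and "ext_bilinear S sU sV sW f" "ext_bilinear S sU sV sW g"
  shows "ext_bilinear S sU sV sW (\<lambda>t u. f t u + g t u)"
  using assms(4,5) unfolding bilinear_on_def linear_on_def
  by (simp add: S.ext_closed[OF vs(3)] S.base_act_rules[OF vs(3)] add_ac)

lemma lift_perturb:
  assumes T: "lift T" and \<Phi>: "\<Phi> \<in> C_tot P 2"
  shows "lift (perturb T \<Phi>)"
proof -
  interpret T: lifted R \<epsilon> S i p P lam T using T by (rule lifted)
  note b = C_tot_2_bilin[OF \<Phi>]
  have "ext_triplet P S (perturb T \<Phi>)"
    unfolding ext_triplet_def perturb_def triplet.simps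
    by (intro conjI ext_bilinear_plus T.T_bilinear vsA vsL
      ext_bilinear_emb[OF vsA vsA vsA b(1)] ext_bilinear_emb[OF vsL vsA vsA b(2)]
      ext_bilinear_emb[OF vsL vsL vsL b(3)])
  then show ?thesis
    unfolding lift_def by (simp add: perturb_def T.lift_one)
qed

text \<open>
  Terms quadratic in \<open>\<Phi>\<close> vanish because \<open>e \<otimes> V\<close> has augmentation zero, and what remains is the
  first order variation of the defect.
\<close>

lemma defect_cochain_difference:
  assumes T: "lift T" and T': "lift T'" and \<Phi>: "\<Phi> \<in> C_tot P 2"
    and eq: "\<And>a b. tmult T' (\<iota>A a) (\<iota>A b) = tmult T (\<iota>A a) (\<iota>A b) + EA (snd \<Phi> [] [a, b])"
      "\<And>x a. tanch T' (\<iota>L x) (\<iota>A a) = tanch T (\<iota>L x) (\<iota>A a) + EA (snd \<Phi> [x] [a])"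
      "\<And>x y. tbrk T' (\<iota>L x) (\<iota>L y) = tbrk T (\<iota>L x) (\<iota>L y) + EL (fst \<Phi> [x, y])"
    and \<Theta>: "defect_cochain P S (i 1) T \<Theta>" and \<Theta>': "defect_cochain P S (i 1) T' \<Theta>'"
  shows "\<Theta>' - \<Theta> = delta_tot P \<Phi>"
proof -
  interpret T: lifted R \<epsilon> S i p P lam T using T by (rule lifted)
  interpret T': lifted R \<epsilon> S i p P lam T' using T' by (rule lifted)
  interpret Q: lifted R \<epsilon> S i p P lam "perturb T \<Phi>" using lift_perturb[OF T \<Phi>] by (rule lifted)
  have T'_eq:
    "t \<in> SA \<Longrightarrow> u \<in> SA \<Longrightarrow> tmult T' t u = tmult T t u + EA (snd \<Phi> [] [\<alpha>A t, \<alpha>A u])"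
    "x \<in> SL \<Longrightarrow> u \<in> SA \<Longrightarrow> tanch T' x u = tanch T x u + EA (snd \<Phi> [\<alpha>L x] [\<alpha>A u])"
    "x \<in> SL \<Longrightarrow> y \<in> SL \<Longrightarrow> tbrk T' x y = tbrk T x y + EL (fst \<Phi> [\<alpha>L x, \<alpha>L y])" for t u x y
    using ext_bilinear_eq[OF comm_S vsA vsA vsA T'.T_bilinear(1) Q.T_bilinear(1)]
      ext_bilinear_eq[OF comm_S vsL vsA vsA T'.T_bilinear(2) Q.T_bilinear(2)]
      ext_bilinear_eq[OF comm_S vsL vsL vsL T'.T_bilinear(3) Q.T_bilinear(3)]
    by (simp_all add: perturb_def eq)
  note in3 = conjunct1[OF \<Theta>[unfolded defect_cochain_iff]] conjunct1[OF \<Theta>'[unfolded defect_cochain_iff]]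
  note d3 = in3[unfolded C_tot_iff]
  note E = \<Theta>[unfolded defect_cochain_iff] and E' = \<Theta>'[unfolded defect_cochain_iff]
  note sub = fst_diff snd_diff
  show ?thesis
  proof (rule cochain_degree_3_eqI)
    show "fst (\<Theta>' - \<Theta>) xs = fst (delta_tot P \<Phi>) xs" if "length xs \<noteq> 3" for xs
      using delta_tot_degree(1)[OF \<Phi>] d3 that by (simp add: minus_apply)
    show "snd (\<Theta>' - \<Theta>) xs as = snd (delta_tot P \<Phi>) xs as"
      if "as = [] \<or> length xs + length as \<noteq> 3" for xs as
      using delta_tot_degree(2)[OF \<Phi>] d3 that by (auto simp: minus_apply)
    show "snd (\<Theta>' - \<Theta>) [] [a, b, c] = snd (delta_tot P \<Phi>) [] [a, b, c]" for a b c
      unfolding emb_inject[OF vsA, symmetric] sub minus_apply[of "snd \<Theta>'"]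
        minus_apply[of "snd \<Theta>' _"]
      by (simp add: E E' defectA_def T'_eq delta_tot_2 emb_lin)
    show "snd (\<Theta>' - \<Theta>) [x] [a, b] = snd (delta_tot P \<Phi>) [x] [a, b]" for x a b
      unfolding emb_inject[OF vsA, symmetric] sub minus_apply[of "snd \<Theta>'"]
        minus_apply[of "snd \<Theta>' _"]
      by (simp add: E E' defect1_def T'_eq delta_tot_2 emb_lin)
    show "snd (\<Theta>' - \<Theta>) [x, y] [a] = snd (delta_tot P \<Phi>) [x, y] [a]" for x y a
      unfolding emb_inject[OF vsA, symmetric] sub minus_apply[of "snd \<Theta>'"]
        minus_apply[of "snd \<Theta>' _"]
      by (simp add: E E' defect2_def T'_eq delta_tot_2 emb_lin)
    show "fst (\<Theta>' - \<Theta>) [x, y, z] = fst (delta_tot P \<Phi>) [x, y, z]" for x y z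
      unfolding emb_inject[OF vsL, symmetric] sub minus_apply[of "fst \<Theta>'"]
      by (simp add: E E' defectL_def T'_eq delta_tot_2 emb_lin)
  qed
qed

text \<open>Both lifts reduce to \<open>\<lambda>\<close>, so their difference takes values in \<open>ker (p \<otimes> id) = e \<otimes> V\<close>.\<close>

lemma lifts_differ:
  assumes T: "lift T" and T': "lift T'"
  obtains \<Phi> where "\<Phi> \<in> C_tot P 2"
    "\<And>a b. tmult T' (\<iota>A a) (\<iota>A b) = tmult T (\<iota>A a) (\<iota>A b) + EA (snd \<Phi> [] [a, b])"
    "\<And>x a. tanch T' (\<iota>L x) (\<iota>A a) = tanch T (\<iota>L x) (\<iota>A a) + EA (snd \<Phi> [x] [a])"
    "\<And>x y. tbrk T' (\<iota>L x) (\<iota>L y) = tbrk T (\<iota>L x) (\<iota>L y) + EL (fst \<Phi> [x, y])"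
proof -
  interpret T: lifted R \<epsilon> S i p P lam T using T by (rule lifted)
  interpret T': lifted R \<epsilon> S i p P lam T' using T' by (rule lifted)
  let ?cA = "emb_coeff (actA P)" and ?cL = "emb_coeff (actL P)"
  let ?\<Phi> = "cochain2 (\<lambda>a b. ?cA (tmult T' (\<iota>A a) (\<iota>A b) - tmult T (\<iota>A a) (\<iota>A b)))
    (\<lambda>x a. ?cA (tanch T' (\<iota>L x) (\<iota>A a) - tanch T (\<iota>L x) (\<iota>A a)))
    (\<lambda>x y. ?cL (tbrk T' (\<iota>L x) (\<iota>L y) - tbrk T (\<iota>L x) (\<iota>L y)))"
  note lin = linear_rules[OF emb_coeff_linear[OF vsA]] linear_rules[OF emb_coeff_linear[OF vsL]]
    S.one_tensor_rules[OF vsA] S.one_tensor_rules[OF vsL]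
    vector_space_rules[OF vsA] vector_space_rules[OF vsL]
  have "?\<Phi> \<in> C_tot P 2"
    by (intro cochain2_in_C_tot bilin_intro vsA vsL) (simp_all add: lin flip: tscale_rules(2))
  then show thesis
    by (rule that) (simp_all add: emb_emb_coeff[OF vsA] emb_emb_coeff[OF vsL] T.lift_one T'.lift_one)
qed

lemma defect_cochains_cohomologous:
  assumes T: "lift T" "defect_cochain P S (i 1) T \<Theta>"
    and T': "lift T'" "defect_cochain P S (i 1) T' \<Theta>'"
  shows "\<Theta>' - \<Theta> \<in> B_tot P 3"
proof -
  obtain \<Phi> where \<Phi>: "\<Phi> \<in> C_tot P 2"
    "\<And>a b. tmult T' (\<iota>A a) (\<iota>A b) = tmult T (\<iota>A a) (\<iota>A b) + EA (snd \<Phi> [] [a, b])"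
    "\<And>x a. tanch T' (\<iota>L x) (\<iota>A a) = tanch T (\<iota>L x) (\<iota>A a) + EA (snd \<Phi> [x] [a])"
    "\<And>x y. tbrk T' (\<iota>L x) (\<iota>L y) = tbrk T (\<iota>L x) (\<iota>L y) + EL (fst \<Phi> [x, y])"
    using lifts_differ[OF T(1) T'(1)] by blast
  have "\<Theta>' - \<Theta> = delta_tot P \<Phi>"
    by (rule defect_cochain_difference[OF T(1) T'(1) \<Phi> T(2) T'(2)])
  then show ?thesis using \<Phi>(1) by (simp add: B_tot_def)
qed

text \<open>Subtracting \<open>e \<otimes> \<Phi>\<close> from a lift whose defect is \<open>\<delta>\<Phi>\<close> makes it a deformation.\<close>

lemma exact_defect_removable:
  assumes T: "lift T" "defect_cochain P S (i 1) T \<Theta>" and \<Theta>: "\<Theta> \<in> B_tot P 3"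
  shows "\<exists>T'. lift T' \<and> deformation P S (\<epsilon> \<circ> p) T'"
proof -
  obtain \<Phi> where \<Phi>: "\<Phi> \<in> C_tot P 2" "\<Theta> = delta_tot P \<Phi>"
    using \<Theta> by (auto simp: B_tot_def)
  have n: "0 - \<Phi> \<in> C_tot P 2" using C_tot_diff[OF zero_in_C_tot \<Phi>(1)] .
  let ?T = "perturb T (0 - \<Phi>)"
  have l: "lift ?T" by (rule lift_perturb[OF T(1) n])
  interpret Q: lifted R \<epsilon> S i p P lam ?T using l by (rule lifted)
  obtain \<Theta>' where \<Theta>': "defect_cochain P S (i 1) ?T \<Theta>'" using Q.defect_cochain_exists ..
  have "\<Theta>' - \<Theta> = delta_tot P (0 - \<Phi>)"
    by (rule defect_cochain_difference[OF T(1) l n _ _ _ T(2) \<Theta>']) (simp_all add: perturb_def)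
  then have "\<Theta>' = 0" by (simp add: \<Phi>(2) delta_tot_diff delta_tot_0 del: diff_0)
  with \<Theta>' have "deformation P S (\<epsilon> \<circ> p) ?T" by (simp only: Q.deformation_iff_zero_defect)
  with l show ?thesis by blast
qed

text \<open>
  The push-out and \<open>\<lambda>\<close> are both \<open>R\<close>-bilinear, so they agree once they agree on \<open>1 \<otimes> A\<close> and \<open>1 \<otimes> L\<close>,
  which is what the definition of a lift asks for.
\<close>

lemma push_out_eq_iff_lift:
  assumes T: "ext_triplet P S T"
  shows "triplet_eq P R (push_out P S R p T) lam \<longleftrightarrow> lift T"
proof -
  note Tb = T[unfolded ext_triplet_def]
  have Tr: "ext_bilinear S (actA P) (actA P) (actA P) (tmult T)"
    "ext_bilinear S (actL P) (actA P) (actA P) (tanch T)"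
    "ext_bilinear S (actL P) (actL P) (actL P) (tbrk T)" using Tb by auto
  note r = ext_bilinear_rules[OF Tr(1) comm_S vsA vsA vsA] ext_bilinear_rules[OF Tr(2) comm_S vsL vsA vsA]
     ext_bilinear_rules[OF Tr(3) comm_S vsL vsL vsL]
  note o = S.one_tensor_rules[OF vsA] S.one_tensor_rules[OF vsL]
    base_change_rules(2)[OF p_linear vsA] base_change_rules(2)[OF p_linear vsL]
  let ?A = "\<lambda>a b. \<pi>A (tmult T (\<iota>A a) (\<iota>A b))" and ?M = "\<lambda>x a. \<pi>A (tanch T (\<iota>L x) (\<iota>A a))"
    and ?L = "\<lambda>x y. \<pi>L (tbrk T (\<iota>L x) (\<iota>L y))"
  have b: "bilin (actA P) (actA P) tscale ?A" "bilin (actL P) (actA P) tscale ?M"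
    "bilin (actL P) (actL P) tscale ?L"
    by (intro bilin_intro vsA vsL vector_space_tscale; simp add: r o)+
  have c: "?A a b \<in> R \<otimes>s actA P" "?M x a \<in> R \<otimes>s actA P" "?L x y \<in> R \<otimes>s actL P" for a b x y
    by (simp_all add: r)
  note sA = scalar_ext[OF R.comm vsA vsA vsA b(1) c(1)]
    and sM = scalar_ext[OF R.comm vsL vsA vsA b(2) c(2)]
    and sL = scalar_ext[OF R.comm vsL vsL vsL b(3) c(3)]
  note one = R.one_tensor_closed[OF vsA] R.one_tensor_closed[OF vsL]
  show ?thesis
  proof
    assume "triplet_eq P R (push_out P S R p T) lam"
    note eq = this[unfolded triplet_eq_def push_out_def Let_def triplet.simps]
    have "?A a b = tmult lam (one_tensor R (actA P) a) (one_tensor R (actA P) b)" for a b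
      by (rule trans[OF sA(2)[symmetric]]) (use eq one in blast)
    moreover have "?M x a = tanch lam (one_tensor R (actL P) x) (one_tensor R (actA P) a)" for a x
      by (rule trans[OF sM(2)[symmetric]]) (use eq one in blast)
    moreover have "?L x y = tbrk lam (one_tensor R (actL P) x) (one_tensor R (actL P) y)" for x y
      by (rule trans[OF sL(2)[symmetric]]) (use eq one in blast)
    ultimately show "lift T" using T unfolding lift_def by blast
  next
    assume l: "lift T"
    interpret T: lifted R \<epsilon> S i p P lam T using l by (rule lifted)
    show "triplet_eq P R (push_out P S R p T) lam"
      unfolding triplet_eq_def push_out_def Let_def triplet.simps
    proof (intro conjI ballI)
      show "scalar_ext R (actA P) (actA P) (actA P) ?A t u = tmult lam t u"
        if "t \<in> R \<otimes>s actA P" "u \<in> R \<otimes>s actA P" for t u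
        by (rule ext_bilinear_eq[OF R.comm vsA vsA vsA sA(1) lam_bilinear(1) _ that])
          (rule trans[OF sA(2) T.lift_one(1)])
      show "scalar_ext R (actL P) (actA P) (actA P) ?M t u = tanch lam t u"
        if "t \<in> R \<otimes>s actL P" "u \<in> R \<otimes>s actA P" for t u
        by (rule ext_bilinear_eq[OF R.comm vsL vsA vsA sM(1) lam_bilinear(2) _ that])
          (rule trans[OF sM(2) T.lift_one(2)])
      show "scalar_ext R (actL P) (actL P) (actL P) ?L t u = tbrk lam t u"
        if "t \<in> R \<otimes>s actL P" "u \<in> R \<otimes>s actL P" for t u
        by (rule ext_bilinear_eq[OF R.comm vsL vsL vsL sL(1) lam_bilinear(3) _ that])
          (rule trans[OF sL(2) T.lift_one(3)])
    qed
  qed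
qed

lemma extends_iff:
  "(\<exists>lam'. deformation P S (\<epsilon> \<circ> p) lam' \<and> triplet_eq P R (push_out P S R p lam') lam) \<longleftrightarrow>
   (\<exists>T. lift T \<and> deformation P S (\<epsilon> \<circ> p) T)"
  using push_out_eq_iff_lift unfolding S.deformation_iff by blast

lemma extends_iff_exact:
  assumes T: "lift T" "defect_cochain P S (i 1) T \<Theta>"
  shows "(\<exists>lam'. deformation P S (\<epsilon> \<circ> p) lam' \<and> triplet_eq P R (push_out P S R p lam') lam) \<longleftrightarrow>
    \<Theta> \<in> B_tot P 3"
proof -
  have "\<Theta> \<in> B_tot P 3" if "lift T'" "deformation P S (\<epsilon> \<circ> p) T'" for T'
    using defect_cochains_cohomologous[OF that(1) _ T, of 0] that(2)
      lifted.deformation_iff_zero_defect[OF lifted[OF that(1)]] by simp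
  then show ?thesis unfolding extends_iff using exact_defect_removable[OF T] by blast
qed

end


section \<open>Lifts from structure constants\<close>

lemma tscale_sum: "tscale c (sum f J) = (\<Sum>j\<in>J. tscale c (f j))"
  by (induction J rule: infinite_finite_induct)
    (simp_all add: tscale_rules vector_space_rules[OF vector_space_tscale])

lemma base_change_sum:
  assumes "Vector_Spaces.linear (smul R) (smul S) \<phi>" "vector_space sV"
  shows "base_change R S sV \<phi> (sum f J) = (\<Sum>j\<in>J. base_change R S sV \<phi> (f j))"
  by (induction J rule: infinite_finite_induct) (simp_all add: base_change_rules[OF assms])

lemma base_change_expansion:
  assumes \<phi>: "alg_hom S S' \<phi>" and V: "vector_space sV"
  shows "base_change S S' sV \<phi>
      (one_tensor S sV v + (\<Sum>j\<in>J. tensor (smul S) sV (b j) (w j))) =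
    one_tensor S' sV v + (\<Sum>j\<in>J. tensor (smul S') sV (\<phi> (b j)) (w j))"
  by (simp add: base_change_rules[OF alg_hom_rules(1)[OF \<phi>] V] base_change_one[OF \<phi> V]
      base_change_sum[OF alg_hom_rules(1)[OF \<phi>] V])

lemma expansion_bilin:
  fixes b :: "nat \<Rightarrow> 's::ab_group_add"
  assumes S: "comm_alg S" and g: "bilin sU sV sW g" and f: "\<And>j. j \<in> J \<Longrightarrow> bilin sU sV sW (f j)"
    and vs: "vector_space sU" "vector_space sV" "vector_space sW"
  defines "F \<equiv> \<lambda>u v. one_tensor S sW (g u v) + (\<Sum>j\<in>J. tensor (smul S) sW (b j) (f j u v))"
  shows "bilin sU sV tscale F" and "F u v \<in> S \<otimes>s sW"
proof -
  interpret S: base_algebra S by (rule base_algebra.intro) fact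
  note r = S.one_tensor_rules[OF vs(3)] S.ten_rules[OF vs(3)] bilin_rules[OF g]
  show "bilin sU sV tscale F"
  proof (intro bilin_intro vs vector_space_tscale)
    fix x y u v w c
    have "(\<Sum>j\<in>J. tensor (smul S) sW (b j) (f j (x + y) v)) =
        (\<Sum>j\<in>J. tensor (smul S) sW (b j) (f j x v)) + (\<Sum>j\<in>J. tensor (smul S) sW (b j) (f j y v))"
      by (simp add: bilin_rules[OF f] r flip: sum.distrib)
    then show "F (x + y) v = F x v + F y v" by (simp add: F_def r)
    have "(\<Sum>j\<in>J. tensor (smul S) sW (b j) (f j u (v + w))) =
        (\<Sum>j\<in>J. tensor (smul S) sW (b j) (f j u v)) + (\<Sum>j\<in>J. tensor (smul S) sW (b j) (f j u w))"
      by (simp add: bilin_rules[OF f] r flip: sum.distrib)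
    then show "F u (v + w) = F u v + F u w" by (simp add: F_def r)
    have "(\<Sum>j\<in>J. tensor (smul S) sW (b j) (f j (sU c u) v)) =
        (\<Sum>j\<in>J. tscale c (tensor (smul S) sW (b j) (f j u v)))"
      by (simp add: bilin_rules[OF f] r)
    then show "F (sU c u) v = tscale c (F u v)" by (simp add: F_def r tscale_rules tscale_sum)
    have "(\<Sum>j\<in>J. tensor (smul S) sW (b j) (f j u (sV c v))) =
        (\<Sum>j\<in>J. tscale c (tensor (smul S) sW (b j) (f j u v)))"
      by (simp add: bilin_rules[OF f] r)
    then show "F u (sV c v) = tscale c (F u v)" by (simp add: F_def r tscale_rules tscale_sum)
  qed
  show "F u v \<in> S \<otimes>s sW"
    unfolding F_def
    by (intro S.ext_closed[OF vs(3)] S.one_tensor_closed[OF vs(3)] tensor_space_sum[OF S.smul_vs vs(3)]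
        tensor_space_tensor[OF S.smul_vs vs(3)])
qed

context courant_over_field
begin

lemma coeff_triplet:
  assumes S: "comm_alg S" and \<Psi>: "\<And>j. j \<in> {1..n} \<Longrightarrow> \<Psi> j \<in> C_tot P 2"
  shows "ext_triplet P S (coeff_triplet P S b n \<Psi>)"
    and "tmult (coeff_triplet P S b n \<Psi>) (one_tensor S (actA P) a) (one_tensor S (actA P) a') =
      coeff_mult P S b n \<Psi> a a'"
    and "tanch (coeff_triplet P S b n \<Psi>) (one_tensor S (actL P) x) (one_tensor S (actA P) a) =
      coeff_anch P S b n \<Psi> x a"
    and "tbrk (coeff_triplet P S b n \<Psi>) (one_tensor S (actL P) x) (one_tensor S (actL P) y) =
      coeff_brk P S b n \<Psi> x y"
proof -
  have bA: "bilin (actA P) (actA P) tscale (coeff_mult P S b n \<Psi>)"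
      and cA: "coeff_mult P S b n \<Psi> a a' \<in> S \<otimes>s actA P" for a a'
    using expansion_bilin[OF S bilin_mult C_tot_2_bilin(1)[OF \<Psi>] vsA vsA vsA, of "{1..n}" "\<lambda>j. j"]
    unfolding coeff_mult_def by auto
  have bM: "bilin (actL P) (actA P) tscale (coeff_anch P S b n \<Psi>)"
      and cM: "coeff_anch P S b n \<Psi> x a \<in> S \<otimes>s actA P" for x a
    using expansion_bilin[OF S bilin_anch C_tot_2_bilin(2)[OF \<Psi>] vsL vsA vsA, of "{1..n}" "\<lambda>j. j"]
    unfolding coeff_anch_def by auto
  have bL: "bilin (actL P) (actL P) tscale (coeff_brk P S b n \<Psi>)"
      and cL: "coeff_brk P S b n \<Psi> x y \<in> S \<otimes>s actL P" for x y
    using expansion_bilin[OF S bilin_brk C_tot_2_bilin(3)[OF \<Psi>] vsL vsL vsL, of "{1..n}" "\<lambda>j. j"]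
    unfolding coeff_brk_def by auto
  note s = scalar_ext[OF S vsA vsA vsA bA cA] scalar_ext[OF S vsL vsA vsA bM cM]
    scalar_ext[OF S vsL vsL vsL bL cL]
  show "ext_triplet P S (coeff_triplet P S b n \<Psi>)"
    "tmult (coeff_triplet P S b n \<Psi>) (one_tensor S (actA P) a) (one_tensor S (actA P) a') =
      coeff_mult P S b n \<Psi> a a'"
    "tanch (coeff_triplet P S b n \<Psi>) (one_tensor S (actL P) x) (one_tensor S (actA P) a) =
      coeff_anch P S b n \<Psi> x a"
    "tbrk (coeff_triplet P S b n \<Psi>) (one_tensor S (actL P) x) (one_tensor S (actL P) y) =
      coeff_brk P S b n \<Psi> x y"
    using s by (simp_all add: ext_triplet_def coeff_triplet_def)
qed

lemma base_change_coeff: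
  assumes "alg_hom S S' \<phi>"
  shows "base_change S S' (actA P) \<phi> (coeff_mult P S b n \<Psi> a a') = coeff_mult P S' (\<lambda>j. \<phi> (b j)) n \<Psi> a a'"
    "base_change S S' (actA P) \<phi> (coeff_anch P S b n \<Psi> x a) = coeff_anch P S' (\<lambda>j. \<phi> (b j)) n \<Psi> x a"
    "base_change S S' (actL P) \<phi> (coeff_brk P S b n \<Psi> x y) = coeff_brk P S' (\<lambda>j. \<phi> (b j)) n \<Psi> x y"
  by (simp_all add: coeff_mult_def coeff_anch_def coeff_brk_def base_change_expansion[OF assms] vsA vsL)

end

lemma (in augmented_algebra) indexed_basis_exists:
  assumes "finite_dimensional_vector_space (smul R) B"
  obtains m n where "indexed_basis R m n (aug_ideal \<epsilon>)"
proof -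
  interpret F: finite_dimensional_vector_space "smul R" B by fact
  have sub: "F.subspace (aug_ideal \<epsilon>)"
    by (auto simp: F.subspace_def aug_ideal_def linear_rules[OF aug_linear])
  obtain C where C: "C \<subseteq> aug_ideal \<epsilon>" "F.independent C" "aug_ideal \<epsilon> \<subseteq> F.span C"
    by (rule F.basis_exists[of "aug_ideal \<epsilon>"])
  have "finite C" using C(2) by (rule F.finiteI_independent)
  then obtain m where m: "bij_betw m {1..card C} C" using ex_bij_betw_nat_finite_1 by blast
  have "F.span C = aug_ideal \<epsilon>" using C(3) F.span_minimal[OF C(1) sub] by (rule equalityI[rotated])
  then have "indexed_basis R m (card C) (aug_ideal \<epsilon>)"
    using m C(2) by (simp add: indexed_basis_def bij_betw_def)
  then show thesis by (rule that)
qed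

lemma (in augmented_algebra) coordinates_exist:
  assumes m: "indexed_basis R m n (aug_ideal \<epsilon>)"
  obtains f where "\<And>j. Vector_Spaces.linear (smul R) (*) (f j)"
    "\<And>r. r = smul R (\<epsilon> r) (aunit R) + (\<Sum>j\<in>{1..n}. smul R (f j r) (m j))"
proof -
  interpret V: vector_space "smul R" by (rule smul_vs)
  define C where "C = m ` {1..n}"
  have inj: "inj_on m {1..n}" and ind: "V.independent C" and sp: "V.span C = aug_ideal \<epsilon>"
    using m by (auto simp: indexed_basis_def C_def)
  define d where "d r = r - smul R (\<epsilon> r) (aunit R)" for r
  have d: "d r \<in> V.span C" for r
    unfolding sp d_def by (simp add: aug_ideal_def linear_rules[OF aug_linear] aug_unit)
  have dl: "d (x + y) = d x + d y" "d (smul R c x) = smul R c (d x)" for x y c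
    by (simp_all add: d_def linear_rules[OF aug_linear] V.scale_left_distrib V.scale_right_diff_distrib)
  show thesis
  proof (rule that[of "\<lambda>j r. V.representation C (d r) (m j)"])
    show "Vector_Spaces.linear (smul R) (*) (\<lambda>r. V.representation C (d r) (m j))" for j
      by (intro linear_intro smul_vs vector_space_field)
        (simp_all add: dl V.representation_add[OF ind d d] V.representation_scale[OF ind d])
    fix r
    have "(\<Sum>b\<in>C. smul R (V.representation C (d r) b) b) = d r"
      by (rule V.sum_representation_eq[OF ind d]) (simp_all add: C_def)
    then have "(\<Sum>j\<in>{1..n}. smul R (V.representation C (d r) (m j)) (m j)) = d r"
      by (subst (asm) (1) C_def) (simp only: sum.reindex[OF inj] o_def)
    then show "r = smul R (\<epsilon> r) (aunit R) +
        (\<Sum>j\<in>{1..n}. smul R (V.representation C (d r) (m j)) (m j))"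
      by (simp add: d_def)
  qed
qed

text \<open>
  Coordinates with respect to \<open>1, m\<^sub>1, \<dots>, m\<^sub>n\<close> give the structure constants; the coordinate at
  \<open>1\<close> is the augmentation.
\<close>

lemma (in augmented_algebra) tensor_expansion:
  fixes n :: nat
  assumes V: "vector_space sV" and f: "\<And>j. Vector_Spaces.linear (smul R) (*) (f j)"
    "\<And>r. r = smul R (\<epsilon> r) (aunit R) + (\<Sum>j\<in>{1..n}. smul R (f j r) (m j))"
    and t: "t \<in> R \<otimes>s sV"
  shows "t = one_tensor R sV (aug_map R sV \<epsilon> t) +
    (\<Sum>j\<in>{1..n}. tensor (smul R) sV (m j) (aug_map R sV (f j) t))"
proof (rule ext_eq[OF V t])
  fix r v
  have s: "tensor (smul R) sV (sum g J) v = (\<Sum>j\<in>J. tensor (smul R) sV (g j) v)" for g and J :: "nat set"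
    by (induction J rule: infinite_finite_induct) (simp_all add: ten_rules[OF V])
  show "tensor (smul R) sV r v = one_tensor R sV (aug_map R sV \<epsilon> (tensor (smul R) sV r v)) +
    (\<Sum>j\<in>{1..n}. tensor (smul R) sV (m j) (aug_map R sV (f j) (tensor (smul R) sV r v)))"
    by (subst f(2)[of r])
      (simp only: s aug_map_rules[OF aug_linear V] aug_map_rules[OF f(1) V] ten_rules[OF V] one_tensor_def)
qed (simp_all add: aug_map_rules[OF aug_linear V] aug_map_rules[OF f(1) V] one_tensor_rules[OF V]
    ten_rules[OF V] sum.distrib)

lemma ext_basis_last: "Vector_Spaces.linear (smul R) (smul S) q \<Longrightarrow> ext_basis i q m n (n + 1) = i 1"
  by (simp add: ext_basis_def section_pair_def linear_rules)

context lifting_problem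
begin

lemma coefficients_exist:
  assumes m: "indexed_basis R m n (aug_ideal \<epsilon>)"
  obtains \<Psi> where "\<And>j. \<Psi> j \<in> C_tot P 2" "has_coeffs P R m n \<Psi> lam"
proof -
  obtain f where f: "\<And>j. Vector_Spaces.linear (smul R) (*) (f j)"
    "\<And>r. r = smul R (\<epsilon> r) (aunit R) + (\<Sum>j\<in>{1..n}. smul R (f j r) (m j))"
    using R.coordinates_exist[OF m] by blast
  let ?oA = "one_tensor R (actA P)" and ?oL = "one_tensor R (actL P)"
  define \<Psi> where "\<Psi> j = cochain2 (\<lambda>a b. aug_map R (actA P) (f j) (tmult lam (?oA a) (?oA b)))
    (\<lambda>x a. aug_map R (actA P) (f j) (tanch lam (?oL x) (?oA a)))
    (\<lambda>x y. aug_map R (actL P) (f j) (tbrk lam (?oL x) (?oL y)))" for j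
  note r = ext_bilinear_rules[OF lam_bilinear(1) R.comm vsA vsA vsA]
    ext_bilinear_rules[OF lam_bilinear(2) R.comm vsL vsA vsA]
    ext_bilinear_rules[OF lam_bilinear(3) R.comm vsL vsL vsL]
    R.one_tensor_closed[OF vsA] R.one_tensor_closed[OF vsL]
  have "\<Psi> j \<in> C_tot P 2" for j
    unfolding \<Psi>_def
    by (intro cochain2_in_C_tot bilin_intro vsA vsL)
      (simp_all add: R.one_tensor_rules[OF vsA] R.one_tensor_rules[OF vsL] r
        aug_map_rules[OF f(1) vsA] aug_map_rules[OF f(1) vsL])
  moreover have "has_coeffs P R m n \<Psi> lam"
  proof -
    note red = lam(3)[unfolded reduces_to_def]
    have "tmult lam (?oA a) (?oA b) = coeff_mult P R m n \<Psi> a b" for a b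
      using R.tensor_expansion[OF vsA f, of "tmult lam (?oA a) (?oA b)"] red
      by (simp add: coeff_mult_def \<Psi>_def r)
    moreover have "tanch lam (?oL x) (?oA b) = coeff_anch P R m n \<Psi> x b" for x b
      using R.tensor_expansion[OF vsA f, of "tanch lam (?oL x) (?oA b)"] red
      by (simp add: coeff_anch_def \<Psi>_def r)
    moreover have "tbrk lam (?oL x) (?oL y) = coeff_brk P R m n \<Psi> x y" for x y
      using R.tensor_expansion[OF vsL f, of "tbrk lam (?oL x) (?oL y)"] red
      by (simp add: coeff_brk_def \<Psi>_def r)
    ultimately show ?thesis by (simp add: has_coeffs_def)
  qed
  ultimately show thesis by (rule that)
qed

text \<open>The map \<open>p\<close> sends \<open>n\<^sub>j\<close> to \<open>m\<^sub>j\<close> for \<open>j \<le> n\<close>, and \<open>n\<^sub>n\<^sub>+\<^sub>1\<close> to \<open>0\<close>.\<close>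

lemma coeff_triplet_lift:
  assumes q: "linear_section R S p q" and \<Psi>: "\<And>j. j \<in> {1..n+1} \<Longrightarrow> \<Psi> j \<in> C_tot P 2"
    and lam: "has_coeffs P R m n \<Psi> lam"
  shows "lift (coeff_triplet P S (ext_basis i q m n) (n + 1) \<Psi>)"
proof -
  note c = coeff_triplet[OF comm_S \<Psi>]
  have q': "Vector_Spaces.linear (smul R) (smul S) q" "p (q r) = r" for r
    using q by (auto simp: linear_section_def)
  have b: "p (ext_basis i q m n j) = (if j \<le> n then m j else 0)" for j
    by (simp add: ext_basis_def section_pair_def linear_rules[OF p_linear] q' p_i)
  have s: "(\<Sum>j\<in>{1..n + 1}. tensor (smul R) sV (if j \<le> n then m j else 0) (w j)) =
      (\<Sum>j\<in>{1..n}. tensor (smul R) sV (m j) (w j))"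
    if "vector_space sV" for sV :: "'k \<Rightarrow> 'v::ab_group_add \<Rightarrow> 'v" and w
    by (simp add: R.ten_rules[OF that])
  note s' = s[OF vsA] s[OF vsL]
  have "coeff_mult P R (\<lambda>j. p (ext_basis i q m n j)) (n + 1) \<Psi> a a' = coeff_mult P R m n \<Psi> a a'"
    "coeff_anch P R (\<lambda>j. p (ext_basis i q m n j)) (n + 1) \<Psi> x a = coeff_anch P R m n \<Psi> x a"
    "coeff_brk P R (\<lambda>j. p (ext_basis i q m n j)) (n + 1) \<Psi> x y = coeff_brk P R m n \<Psi> x y" for a a' x y
    unfolding coeff_mult_def coeff_anch_def coeff_brk_def b by (simp_all only: s')
  then show ?thesis
    using lam unfolding lift_def has_coeffs_def
    by (simp only: c base_change_coeff[OF p_hom]) simp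
qed

lemma obstruction_cochain_lift:
  assumes "obstruction_cochain P R \<epsilon> lam S i p \<Theta>"
  obtains T where "lift T" "defect_cochain P S (i 1) T \<Theta>"
proof -
  obtain q n m \<Psi> where q: "linear_section R S p q" and \<Psi>: "\<forall>j\<in>{1..n+1}. \<Psi> j \<in> C_tot P 2"
    and c: "has_coeffs P R m n \<Psi> lam"
    and d: "defect_cochain P S (ext_basis i q m n (n + 1))
          (coeff_triplet P S (ext_basis i q m n) (n + 1) \<Psi>) \<Theta>"
    using assms unfolding obstruction_cochain_def by blast
  have "lift (coeff_triplet P S (ext_basis i q m n) (n + 1) \<Psi>)"
    using coeff_triplet_lift[OF q _ c] \<Psi> by blast
  moreover have "ext_basis i q m n (n + 1) = i 1"
    using q ext_basis_last unfolding linear_section_def by blast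
  ultimately show thesis using d by (intro that) simp_all
qed

lemma obstruction_cochain_exists:
  assumes "finite_dimensional_vector_space (smul R) B"
  obtains \<Theta> where "obstruction_cochain P R \<epsilon> lam S i p \<Theta>"
proof -
  obtain q where q: "linear_section R S p q" using section_exists by blast
  obtain m n where m: "indexed_basis R m n (aug_ideal \<epsilon>)" using R.indexed_basis_exists[OF assms] .
  obtain \<Psi> where \<Psi>: "\<And>j. \<Psi> j \<in> C_tot P 2" "has_coeffs P R m n \<Psi> lam"
    using coefficients_exist[OF m] by blast
  let ?T = "coeff_triplet P S (ext_basis i q m n) (n + 1) \<Psi>"
  have "lift ?T" using coeff_triplet_lift[OF q \<Psi>] by blast
  then interpret T: lifted R \<epsilon> S i p P lam ?T by (rule lifted)
  obtain \<Theta> where "defect_cochain P S (i 1) ?T \<Theta>" using T.defect_cochain_exists ..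
  moreover have "ext_basis i q m n (n + 1) = i 1"
    using q ext_basis_last unfolding linear_section_def by blast
  ultimately have "obstruction_cochain P R \<epsilon> lam S i p \<Theta>"
    unfolding obstruction_cochain_def using q m \<Psi> by metis
  then show thesis by (rule that)
qed

end

section \<open>Independence of the extension\<close>

text \<open>
  A morphism \<open>\<phi>\<close> of extensions maps \<open>e\<close> to \<open>e'\<close>, so applying \<open>\<phi> \<otimes> id\<close> to the equations defining
  \<open>\<Theta>\<close> over \<open>S\<close> gives those over \<open>S'\<close>.
\<close>

lemma defect_cochain_transport:
  assumes T: "lifted R \<epsilon> S i p P lam T" and T': "lifted R \<epsilon> S' i' p' P lam T'"
    and \<phi>: "alg_hom S S' \<phi>" and i: "\<And>k. \<phi> (i k) = i' k"
    and H_one: "\<And>a a'. base_change S S' (actA P) \<phi>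
        (tmult T (one_tensor S (actA P) a) (one_tensor S (actA P) a')) =
      tmult T' (one_tensor S' (actA P) a) (one_tensor S' (actA P) a')"
    "\<And>x a. base_change S S' (actA P) \<phi>
        (tanch T (one_tensor S (actL P) x) (one_tensor S (actA P) a)) =
      tanch T' (one_tensor S' (actL P) x) (one_tensor S' (actA P) a)"
    "\<And>x y. base_change S S' (actL P) \<phi>
        (tbrk T (one_tensor S (actL P) x) (one_tensor S (actL P) y)) =
      tbrk T' (one_tensor S' (actL P) x) (one_tensor S' (actL P) y)"
    and d: "defect_cochain P S (i 1) T \<Theta>"
  shows "defect_cochain P S' (i' 1) T' \<Theta>"
proof -
  interpret T: lifted R \<epsilon> S i p P lam T by (rule T)
  interpret T': lifted R \<epsilon> S' i' p' P lam T' by (rule T')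
  let ?HA = "base_change S S' (actA P) \<phi>" and ?HL = "base_change S S' (actL P) \<phi>"
  note H =
    base_change_ext_bilinear[OF \<phi> T.comm_S T'.comm_S T.vsA T.vsA T.vsA T.T_bilinear(1)
      T'.T_bilinear(1) H_one(1)]
    base_change_ext_bilinear[OF \<phi> T.comm_S T'.comm_S T.vsL T.vsA T.vsA T.T_bilinear(2)
      T'.T_bilinear(2) H_one(2)]
    base_change_ext_bilinear[OF \<phi> T.comm_S T'.comm_S T.vsL T.vsL T.vsL T.T_bilinear(3)
      T'.T_bilinear(3) H_one(3)]
    base_change_one[OF \<phi> T.vsA] base_change_one[OF \<phi> T.vsL]
  note lin = base_change_rules(1-5)[OF alg_hom_rules(1)[OF \<phi>] T.vsA]
    base_change_rules(1-5)[OF alg_hom_rules(1)[OF \<phi>] T.vsL]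
  have emb: "?HA (T.EA a) = T'.EA a" "?HL (T.EL x) = T'.EL x" for a x
    by (simp_all add: T.emb_def T'.emb_def base_change_rules[OF alg_hom_rules(1)[OF \<phi>]] T.vsA T.vsL i)
  have "?HA (defectA T (T.\<iota>A a) (T.\<iota>A b) (T.\<iota>A c)) = defectA T' (T'.\<iota>A a) (T'.\<iota>A b) (T'.\<iota>A c)"
    "?HA (defect1 T (T.\<iota>L x) (T.\<iota>A a) (T.\<iota>A b)) = defect1 T' (T'.\<iota>L x) (T'.\<iota>A a) (T'.\<iota>A b)"
    "?HA (defect2 T (T.\<iota>L x) (T.\<iota>L y) (T.\<iota>A a)) = defect2 T' (T'.\<iota>L x) (T'.\<iota>L y) (T'.\<iota>A a)"
    "?HL (defectL T (T.\<iota>L x) (T.\<iota>L y) (T.\<iota>L z)) = defectL T' (T'.\<iota>L x) (T'.\<iota>L y) (T'.\<iota>L z)"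
    for a b c x y z
    by (simp_all add: defect_defs lin H)
  then show ?thesis
    using d unfolding T.defect_cochain_iff T'.defect_cochain_iff by (simp flip: emb)
qed

text \<open>
  With the section \<open>\<phi> \<circ> q\<close> and the same basis and structure constants, \<open>\<phi>\<close> maps the basis
  \<open>n\<^sub>1, \<dots>, n\<^sub>n\<^sub>+\<^sub>1\<close> for \<open>S\<close> to the one for \<open>S'\<close>.
\<close>

lemma obstruction_cochain_transport:
  assumes X: "lifting_problem R \<epsilon> S i p P lam" and X': "lifting_problem R \<epsilon> S' i' p' P lam"
    and \<phi>: "alg_hom S S' \<phi>" and p: "\<And>s. p' (\<phi> s) = p s" and i: "\<And>k. \<phi> (i k) = i' k"
    and ob: "obstruction_cochain P R \<epsilon> lam S i p \<Theta>"
  shows "obstruction_cochain P R \<epsilon> lam S' i' p' \<Theta>"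
proof -
  interpret X: lifting_problem R \<epsilon> S i p P lam by (rule X)
  interpret X': lifting_problem R \<epsilon> S' i' p' P lam by (rule X')
  obtain q n m \<Psi> where q: "linear_section R S p q" and m: "indexed_basis R m n (aug_ideal \<epsilon>)"
    and \<Psi>: "\<And>j. j \<in> {1..n+1} \<Longrightarrow> \<Psi> j \<in> C_tot P 2"
    and c: "has_coeffs P R m n \<Psi> lam"
    and d: "defect_cochain P S (ext_basis i q m n (n + 1))
          (coeff_triplet P S (ext_basis i q m n) (n + 1) \<Psi>) \<Theta>"
    using ob unfolding obstruction_cochain_def by blast
  let ?q = "\<lambda>r. \<phi> (q r)" and ?b = "ext_basis i q m n"
  have ql: "Vector_Spaces.linear (smul R) (smul S) q" using q by (simp add: linear_section_def)
  have q': "linear_section R S' p' ?q"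
    using q Vector_Spaces.linear_compose[OF ql alg_hom_rules(1)[OF \<phi>]]
    by (simp add: linear_section_def p comp_def)
  have b': "ext_basis i' ?q m n = (\<lambda>j. \<phi> (?b j))"
    by (simp add: fun_eq_iff ext_basis_def section_pair_def linear_rules[OF alg_hom_rules(1)[OF \<phi>]] i)
  let ?T = "coeff_triplet P S ?b (n + 1) \<Psi>"
    and ?T' = "coeff_triplet P S' (\<lambda>j. \<phi> (?b j)) (n + 1) \<Psi>"
  have last: "?b (n + 1) = i 1" using ext_basis_last[OF ql] .
  have l: "X.lift ?T" using X.coeff_triplet_lift[OF q \<Psi> c] by blast
  have l': "X'.lift ?T'" using X'.coeff_triplet_lift[OF q' \<Psi> c] unfolding b' by blast
  note ct = X.coeff_triplet[OF X.comm_S \<Psi>] and ct' = X.coeff_triplet[OF X'.comm_S \<Psi>]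
  have "defect_cochain P S' (i' 1) ?T' \<Theta>"
  proof (rule defect_cochain_transport[OF X.lifted[OF l] X'.lifted[OF l'] \<phi> i])
    show "defect_cochain P S (i 1) ?T \<Theta>" using d unfolding last .
  qed (simp_all only: ct ct' X.base_change_coeff[OF \<phi>])
  then have "defect_cochain P S' (ext_basis i' ?q m n (n + 1))
      (coeff_triplet P S' (ext_basis i' ?q m n) (n + 1) \<Psi>) \<Theta>"
    unfolding b' last i .
  then show ?thesis
    unfolding obstruction_cochain_def using q' m \<Psi> c by blast
qed

lemma corresponds_transport:
  assumes \<phi>: "alg_hom S S' \<phi>" and p: "\<And>s. p' (\<phi> s) = p s" and i: "\<And>k. \<phi> (i k) = i' k"
    and c: "corresponds R \<epsilon> S i p c"
  shows "corresponds R \<epsilon> S' i' p' c"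
proof -
  obtain q \<psi> where q: "linear_section R S p q" "section_cocycle R \<epsilon> S i q \<psi>" "\<psi> \<in> c"
    using c unfolding corresponds_def by blast
  have pair: "section_pair i' (\<lambda>r. \<phi> (q r)) r k = \<phi> (section_pair i q r k)" for r k
    by (simp add: section_pair_def linear_rules[OF alg_hom_rules(1)[OF \<phi>]] i)
  have "linear_section R S' p' (\<lambda>r. \<phi> (q r))"
    using q(1) Vector_Spaces.linear_compose[of "smul R" "smul S" q "smul S'" \<phi>] alg_hom_rules(1)[OF \<phi>]
    by (simp add: linear_section_def p comp_def)
  moreover have "section_cocycle R \<epsilon> S' i' (\<lambda>r. \<phi> (q r)) \<psi>"
    using q(2) unfolding section_cocycle_def pair by (simp flip: alg_hom_rules(2)[OF \<phi>])
  ultimately show ?thesis unfolding corresponds_def using q(3) by blast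
qed

text \<open>
  If \<open>\<psi>' - \<psi> = \<delta>h\<close>, then subtracting \<open>h(r)\<close> from the \<open>\<bbbK>\<close>-coordinate, \<open>(r, k)\<^sub>q \<mapsto> (r, k - h(r))\<^sub>q\<^sub>'\<close>, is
  multiplicative. Below, \<open>g\<close> is \<open>-h\<close>.
\<close>

lemma extension_morphism:
  assumes X: "extension R \<epsilon> S i p" and X': "extension R \<epsilon> S' i' p'"
    and c: "c \<in> H2_harr R \<epsilon>" and co: "corresponds R \<epsilon> S i p c" "corresponds R \<epsilon> S' i' p' c"
  shows "\<exists>\<phi>. alg_hom S S' \<phi> \<and> (\<forall>s. p' (\<phi> s) = p s) \<and> (\<forall>k. \<phi> (i k) = i' k)"
proof -
  interpret X: extension R \<epsilon> S i p by (rule X)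
  interpret X': extension R \<epsilon> S' i' p' by (rule X')
  obtain q \<psi> where q: "linear_section R S p q" "section_cocycle R \<epsilon> S i q \<psi>" "\<psi> \<in> c"
    using co(1) unfolding corresponds_def by blast
  obtain q' \<psi>' where q': "linear_section R S' p' q'" "section_cocycle R \<epsilon> S' i' q' \<psi>'" "\<psi>' \<in> c"
    using co(2) unfolding corresponds_def by blast
  obtain \<psi>0 where "c = harr_cohomologous R \<epsilon> `` {\<psi>0}"
    using c unfolding H2_harr_def by (rule quotientE)
  then have "(\<psi>0, \<psi>) \<in> harr_cohomologous R \<epsilon>" "(\<psi>0, \<psi>') \<in> harr_cohomologous R \<epsilon>"
    using q(3) q'(3) by simp_all
  then have "\<psi>0 - \<psi> \<in> harr_B2 R \<epsilon>" "\<psi>0 - \<psi>' \<in> harr_B2 R \<epsilon>"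
    by (simp_all add: harr_cohomologous_def)
  then obtain h h' where h: "Vector_Spaces.linear (smul R) (*) h" "Vector_Spaces.linear (smul R) (*) h'"
    and e: "\<psi>0 - \<psi> = (\<lambda>r s. \<epsilon> r * h s - h (amul R r s) + h r * \<epsilon> s)"
      "\<psi>0 - \<psi>' = (\<lambda>r s. \<epsilon> r * h' s - h' (amul R r s) + h' r * \<epsilon> s)"
    unfolding harr_B2_def by blast
  define g where "g r = h' r - h r" for r
  have gl: "Vector_Spaces.linear (smul R) (*) g" unfolding g_def by (rule linear_minus[OF h(2,1)])
  have coh: "\<psi> r s + g (amul R r s) = \<epsilon> r * g s + \<epsilon> s * g r + \<psi>' r s" for r s
  proof -
    have d: "\<psi>0 r s - \<psi> r s = \<epsilon> r * h s - h (amul R r s) + h r * \<epsilon> s"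
      "\<psi>0 r s - \<psi>' r s = \<epsilon> r * h' s - h' (amul R r s) + h' r * \<epsilon> s"
      using fun_cong[OF fun_cong[OF e(1)], of r s] fun_cong[OF fun_cong[OF e(2)], of r s]
      by (simp_all only: minus_apply)
    have "\<psi> r s = \<psi>0 r s - (\<epsilon> r * h s - h (amul R r s) + h r * \<epsilon> s)"
      "\<psi>' r s = \<psi>0 r s - (\<epsilon> r * h' s - h' (amul R r s) + h' r * \<epsilon> s)"
      unfolding d[symmetric] by simp_all
    then show ?thesis unfolding g_def by (simp only:) (simp add: algebra_simps)
  qed
  have ql: "Vector_Spaces.linear (smul R) (smul S) q" "p (q r) = r" for r
    using q(1) by (auto simp: linear_section_def)
  have ql': "Vector_Spaces.linear (smul R) (smul S') q'" "p' (q' r) = r" for r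
    using q'(1) by (auto simp: linear_section_def)
  obtain \<kappa> where \<kappa>: "Vector_Spaces.linear (smul S) (*) \<kappa>" "\<And>s. s = q (p s) + i (\<kappa> s)"
    "\<And>r k. \<kappa> (q r + i k) = k"
    by (rule X.section_coefficient[OF q(1)]) blast
  obtain \<kappa>' where \<kappa>': "\<And>s. s = q' (p' s) + i' (\<kappa>' s)"
    by (rule X'.section_coefficient[OF q'(1)]) blast
  define \<phi> where "\<phi> s = q' (p s) + i' (\<kappa> s + g (p s))" for s
  note l = linear_rules[OF ql(1)] linear_rules[OF ql'(1)] linear_rules[OF gl] linear_rules[OF \<kappa>(1)]
    linear_rules[OF X.p_linear] linear_rules[OF X'.p_linear] linear_rules[OF X.i_linear]
    linear_rules[OF X'.i_linear] X.p_i X'.p_i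
  have \<phi>_pair: "\<phi> (q r + i k) = q' r + i' (k + g r)" for r k
  proof -
    have "p (q r + i k) = r" by (simp add: ql l)
    then show ?thesis by (simp only: \<phi>_def \<kappa>(3))
  qed
  have lin: "Vector_Spaces.linear (smul S) (smul S') \<phi>"
    by (intro linear_intro X.S.smul_vs X'.S.smul_vs)
      (simp_all add: \<phi>_def l vector_space_rules[OF X'.S.smul_vs] distrib_left)
  have mult: "\<phi> (amul S s t) = amul S' (\<phi> s) (\<phi> t)" for s t
  proof -
    define r k where "r = p s" "k = \<kappa> s"
    define r' k' where "r' = p t" "k' = \<kappa> t"
    have s: "s = q r + i k" "t = q r' + i k'" unfolding r_k_def r'_k'_def by (rule \<kappa>(2))+
    have "amul S s t = q (amul R r r') + i (\<epsilon> r * k' + \<epsilon> r' * k + \<psi> r r')"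
      using q(2) unfolding s section_cocycle_def section_pair_def by blast
    then have "\<phi> (amul S s t) =
        q' (amul R r r') + i' (\<epsilon> r * k' + \<epsilon> r' * k + (\<psi> r r' + g (amul R r r')))"
      by (simp add: \<phi>_pair add.assoc)
    also have "\<dots> = q' (amul R r r') + i' (\<epsilon> r * (k' + g r') + \<epsilon> r' * (k + g r) + \<psi>' r r')"
      unfolding coh by (simp add: algebra_simps)
    also have "\<dots> = amul S' (q' r + i' (k + g r)) (q' r' + i' (k' + g r'))"
      using q'(2) unfolding section_cocycle_def section_pair_def by metis
    finally show ?thesis by (simp add: s \<phi>_pair)
  qed
  \<comment> \<open>Being multiplicative and onto, \<open>\<phi>\<close> preserves the unit.\<close>
  have "\<phi> (aunit S) = aunit S'"
  proof -
    have "aunit S' = \<phi> (q (p' (aunit S')) + i (\<kappa>' (aunit S') - g (p' (aunit S'))))"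
      by (simp add: \<phi>_pair flip: \<kappa>')
    then obtain u where u: "aunit S' = \<phi> u" ..
    have "\<phi> (aunit S) = amul S' (\<phi> (aunit S)) (\<phi> u)" by (simp flip: u)
    also have "\<dots> = \<phi> u" by (simp flip: mult)
    finally show ?thesis by (simp add: u)
  qed
  moreover have "p' (\<phi> s) = p s" for s by (simp add: \<phi>_def l ql')
  moreover have "\<phi> (i k) = i' k" for k using \<phi>_pair[of 0 k] by (simp add: l)
  ultimately show ?thesis using lin mult unfolding alg_hom_def by blast
qed

text \<open>Transport of structure along an additive bijection \<open>f\<close> with inverse \<open>g\<close>.\<close>

definition transported_alg ::
  "('k::field, 's::ab_group_add) ualg \<Rightarrow> ('s \<Rightarrow> 't::ab_group_add) \<Rightarrow> ('t \<Rightarrow> 's) \<Rightarrow> ('k, 't) ualg" where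
  "transported_alg S f g = \<lparr> smul = (\<lambda>c x. f (smul S c (g x))),
     amul = (\<lambda>x y. f (amul S (g x) (g y))), aunit = f (aunit S) \<rparr>"

lemma transported_extension:
  assumes X: "extension R \<epsilon> S i p"
    and f: "\<And>x y. f (x + y) = f x + f y" and gf: "\<And>x. g (f x) = x" and fg: "\<And>y. f (g y) = y"
  defines "S' \<equiv> transported_alg S f g"
  shows "alg_hom S S' f" and "extension R \<epsilon> S' (\<lambda>k. f (i k)) (\<lambda>t. p (g t))"
proof -
  interpret X: extension R \<epsilon> S i p by (rule X)
  have g: "g (x + y) = g x + g y" for x y by (metis f fg gf)
  note v = vector_space_rules[OF X.S.smul_vs]
  have vs: "vector_space (smul S')"
    by unfold_locales (simp_all add: S'_def transported_alg_def f g gf fg v)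
  show hom: "alg_hom S S' f"
    unfolding alg_hom_def
    by (intro conjI linear_intro X.S.smul_vs vs) (simp_all add: S'_def transported_alg_def f gf)
  have ghom: "alg_hom S' S g"
    unfolding alg_hom_def
    by (intro conjI linear_intro X.S.smul_vs vs) (simp_all add: S'_def transported_alg_def g gf)
  have comm: "comm_alg S'"
    unfolding comm_alg_def
  proof (intro conjI allI vs)
    show "bilin (smul S') (smul S') (smul S') (amul S')"
      by (intro bilin_intro vs) (simp_all add: S'_def transported_alg_def f g gf X.S.amul_rules)
  qed (simp_all add: S'_def transported_alg_def gf fg X.S.assoc X.S.commute X.S.left_commute)
  have "alg_hom S' R (\<lambda>t. p (g t))"
    unfolding alg_hom_def[of S' R]
    using Vector_Spaces.linear_compose[OF alg_hom_rules(1)[OF ghom] X.p_linear, unfolded comp_def]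
    by (simp only: alg_hom_rules(2,3)[OF ghom] alg_hom_rules(2,3)[OF X.p_hom]) simp
  moreover have "Vector_Spaces.linear (*) (smul S') (\<lambda>k. f (i k))"
    by (rule Vector_Spaces.linear_compose[OF X.i_linear alg_hom_rules(1)[OF hom], unfolded comp_def])
  moreover have "inj (\<lambda>k. f (i k))"
    by (rule injI, drule arg_cong[where f = g]) (simp only: gf inj_eq[OF X.i_inj])
  moreover have "range (\<lambda>k. f (i k)) = {t. p (g t) = 0}"
  proof (intro set_eqI iffI)
    fix t
    assume "t \<in> range (\<lambda>k. f (i k))"
    then show "t \<in> {t. p (g t) = 0}" by (auto simp: gf X.p_i)
  next
    fix t
    assume "t \<in> {t. p (g t) = 0}"
    then obtain k where "g t = i k" using X.i_range by blast
    then have "t = f (i k)" by (metis fg)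
    then show "t \<in> range (\<lambda>k. f (i k))" by (rule image_eqI) simp
  qed
  moreover have "surj (\<lambda>t. p (g t))"
    unfolding surj_def using X.p_surj gf by (metis surjD)
  moreover have "amul S' t (f (i k)) = f (i (\<epsilon> (p (g t)) * k))" for t k
    by (simp add: S'_def transported_alg_def gf X.amul_i)
  ultimately have "one_dim_extension R \<epsilon> S' (\<lambda>k. f (i k)) (\<lambda>t. p (g t))"
    using comm by (simp add: one_dim_extension_def)
  then show "extension R \<epsilon> S' (\<lambda>k. f (i k)) (\<lambda>t. p (g t))"
    by unfold_locales
qed

text \<open>
  The obstruction map ranges over extensions on \<open>R \<oplus> \<bbbK>\<close>; a section identifies \<open>S\<close> with one of them.
\<close>

lemma extension_on_pairs:
  fixes R :: "('k::field, 'r::ab_group_add) ualg"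
  assumes X: "extension R \<epsilon> S i p"
  obtains S' :: "('k, 'r \<times> 'k) ualg" and i' p' \<phi> where "extension R \<epsilon> S' i' p'"
    "alg_hom S S' \<phi>" "\<And>s. p' (\<phi> s) = p s" "\<And>k. \<phi> (i k) = i' k"
proof -
  interpret X: extension R \<epsilon> S i p by (rule X)
  obtain q where q: "linear_section R S p q" using X.section_exists ..
  have pq: "p (q r) = r" for r using q by (simp add: linear_section_def)
  obtain \<kappa> where \<kappa>: "Vector_Spaces.linear (smul S) (*) \<kappa>" "\<And>s. s = q (p s) + i (\<kappa> s)"
    "\<And>r k. \<kappa> (q r + i k) = k"
    by (rule X.section_coefficient[OF q]) blast
  let ?f = "\<lambda>s. (p s, \<kappa> s)" and ?g = "\<lambda>t. q (fst t) + i (snd t)"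
  have f: "?f (x + y) = ?f x + ?f y" for x y
    by (simp add: linear_rules[OF X.p_linear] linear_rules[OF \<kappa>(1)])
  have gf: "?g (?f x) = x" for x by (simp flip: \<kappa>(2))
  have fg: "?f (?g y) = y" for y
    by (simp add: \<kappa>(3) linear_rules[OF X.p_linear] X.p_i pq)
  show thesis
    by (rule that[OF transported_extension(2,1)[OF X f gf fg]]) (simp_all only: gf)
qed


section \<open>The obstruction class\<close>

context courant_over_field
begin

lemma class_CP_cong:
  assumes "u \<in> Z_tot P 3" "v \<in> Z_tot P 3" and uv: "u - v \<in> B_tot P 3"
  shows "class_CP P 3 u = class_CP P 3 v"
proof -
  have diff: "x - y \<in> B_tot P 3" if "x \<in> B_tot P 3" "y \<in> B_tot P 3" for x y
    using that C_tot_diff by (auto simp: B_tot_def simp flip: delta_tot_diff)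
  have B0: "0 \<in> B_tot P 3"
    using zero_in_C_tot delta_tot_0 by (auto simp: B_tot_def intro!: image_eqI[of _ _ 0])
  have "u - w \<in> B_tot P 3 \<longleftrightarrow> v - w \<in> B_tot P 3" for w
  proof
    assume "u - w \<in> B_tot P 3"
    then show "v - w \<in> B_tot P 3" using diff[of "u - w" "u - v"] uv by simp
  next
    assume "v - w \<in> B_tot P 3"
    then show "u - w \<in> B_tot P 3" using diff[of "v - w" "0 - (u - v)"] diff[OF B0 uv] by simp
  qed
  then show ?thesis using assms by (auto simp: class_CP_def cohomologous_def)
qed

lemma class_CP_eq_0_iff:
  assumes "u \<in> Z_tot P 3"
  shows "class_CP P 3 u = class_CP P 3 0 \<longleftrightarrow> u \<in> B_tot P 3"
proof
  have Z0: "0 \<in> Z_tot P 3" by (simp add: Z_tot_def zero_in_C_tot delta_tot_0)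
  have "0 - 0 \<in> B_tot P 3"
    using zero_in_C_tot delta_tot_0 by (auto simp: B_tot_def intro!: image_eqI[of _ _ 0])
  then have "0 \<in> class_CP P 3 0" using Z0 by (simp add: class_CP_def cohomologous_def)
  then show "u \<in> B_tot P 3" if "class_CP P 3 u = class_CP P 3 0"
    unfolding that[symmetric] by (simp add: class_CP_def cohomologous_def)
  show "class_CP P 3 u = class_CP P 3 0" if "u \<in> B_tot P 3"
    using that by (intro class_CP_cong assms Z0) simp
qed

end

lemma (in lifting_problem) obstruction_cocycle:
  "obstruction_cochain P R \<epsilon> lam S i p \<Theta> \<Longrightarrow> \<Theta> \<in> Z_tot P 3"
  by (metis obstruction_cochain_lift lifted lifted.defect_cochain_cocycle)

text \<open>
  Obstruction cochains of extensions on \<open>R \<oplus> \<bbbK>\<close> in the class \<open>c\<close> are transported to \<open>S\<close>, where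
  any two of them differ by a coboundary; conversely, \<open>\<Theta>\<close> is transported to \<open>R \<oplus> \<bbbK>\<close>.
\<close>

lemma (in lifting_problem) obstruction_map_eq:
  assumes ob: "obstruction_cochain P R \<epsilon> lam S i p \<Theta>"
    and c: "c \<in> H2_harr R \<epsilon>" "corresponds R \<epsilon> S i p c"
  shows "obstruction_map P R \<epsilon> lam c = class_CP P 3 \<Theta>"
  unfolding obstruction_map_def
proof (rule the_equality)
  have lp: "lifting_problem R \<epsilon> S i p P lam" by unfold_locales
  have ex: "extension R \<epsilon> S i p" by unfold_locales
  have lp': "lifting_problem R \<epsilon> S' i' p' P lam" if "extension R \<epsilon> S' i' p'"
    for S' :: "('k, 'r \<times> 'k) ualg" and i' p'
    using that deformation
    by (simp add: lifting_problem_def lifting_problem_axioms_def courant_base_axioms)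
  obtain S' :: "('k, 'r \<times> 'k) ualg" and i' p' \<phi> where X': "extension R \<epsilon> S' i' p'"
    and \<phi>: "alg_hom S S' \<phi>" "\<And>s. p' (\<phi> s) = p s" "\<And>k. \<phi> (i k) = i' k"
    using extension_on_pairs[OF ex] by blast
  have "obstruction_cochain P R \<epsilon> lam S' i' p' \<Theta>"
    by (rule obstruction_cochain_transport[OF lp lp'[OF X'] \<phi> ob])
  moreover have "corresponds R \<epsilon> S' i' p' c"
    by (rule corresponds_transport[OF \<phi> c(2)])
  ultimately show "\<exists>(S :: ('k, 'r \<times> 'k) ualg) i p \<Theta>'.
        one_dim_extension R \<epsilon> S i p \<and> corresponds R \<epsilon> S i p c \<and>
        obstruction_cochain P R \<epsilon> lam S i p \<Theta>' \<and> class_CP P 3 \<Theta> = class_CP P 3 \<Theta>'"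
    using extension.ext[OF X'] by blast
next
  fix h
  have lp: "lifting_problem R \<epsilon> S i p P lam" by unfold_locales
  have ex: "extension R \<epsilon> S i p" by unfold_locales
  assume "\<exists>(S :: ('k, 'r \<times> 'k) ualg) i p \<Theta>'.
        one_dim_extension R \<epsilon> S i p \<and> corresponds R \<epsilon> S i p c \<and>
        obstruction_cochain P R \<epsilon> lam S i p \<Theta>' \<and> h = class_CP P 3 \<Theta>'"
  then obtain S' :: "('k, 'r \<times> 'k) ualg" and i' p' \<Theta>' where
    X: "one_dim_extension R \<epsilon> S' i' p'" and co: "corresponds R \<epsilon> S' i' p' c"
    and ob': "obstruction_cochain P R \<epsilon> lam S' i' p' \<Theta>'" and h: "h = class_CP P 3 \<Theta>'"
    by blast
  have X': "extension R \<epsilon> S' i' p'" using X by unfold_locales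
  then have lp': "lifting_problem R \<epsilon> S' i' p' P lam"
    using deformation
    by (simp add: lifting_problem_def lifting_problem_axioms_def courant_base_axioms)
  obtain \<phi> where \<phi>: "alg_hom S' S \<phi>" "\<And>s. p (\<phi> s) = p' s" "\<And>k. \<phi> (i' k) = i k"
    using extension_morphism[OF X' ex c(1) co c(2)] by blast
  have ob2: "obstruction_cochain P R \<epsilon> lam S i p \<Theta>'"
    by (rule obstruction_cochain_transport[OF lp' lp \<phi> ob'])
  have "\<Theta>' - \<Theta> \<in> B_tot P 3"
    using obstruction_cochain_lift[OF ob] obstruction_cochain_lift[OF ob2]
      defect_cochains_cohomologous by metis
  then show "h = class_CP P 3 \<Theta>"
    unfolding h by (intro class_CP_cong obstruction_cocycle ob ob2)
qed

theorem theorem3p12: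
  fixes P :: "('k::field_char_0, 'a::ab_group_add, 'l::ab_group_add) courant"
    and R :: "('k, 'r::ab_group_add) ualg" and \<epsilon> :: "'r \<Rightarrow> 'k"
    and lam :: "('k, 'r, 'a, 'l) deform"
    and S :: "('k, 's::ab_group_add) ualg" and i :: "'k \<Rightarrow> 's" and p :: "'s \<Rightarrow> 'r"
    and c :: "('r \<Rightarrow> 'r \<Rightarrow> 'k) set"
  assumes "courant_pair base_field P" and "carA P = UNIV" and "carL P = UNIV"
    and "fd_local_base R \<epsilon>"
    and "deformation P R \<epsilon> lam"
    and "one_dim_extension R \<epsilon> S i p"
    and "c \<in> H2_harr R \<epsilon>" and "corresponds R \<epsilon> S i p c"
  shows "(\<exists>lam' :: ('k, 's, 'a, 'l) deform.
            deformation P S (\<epsilon> \<circ> p) lam' \<and> triplet_eq P R (push_out P S R p lam') lam)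
         \<longleftrightarrow> obstruction_map P R \<epsilon> lam c = class_CP P 3 0"
proof -
  interpret lifting_problem R \<epsilon> S i p P lam
    using assms by unfold_locales (auto simp: fd_local_base_def local_alg_def)
  obtain B where "finite_dimensional_vector_space (smul R) B"
    using assms(4) by (auto simp: fd_local_base_def)
  then obtain \<Theta> where \<Theta>: "obstruction_cochain P R \<epsilon> lam S i p \<Theta>"
    by (rule obstruction_cochain_exists)
  obtain T where T: "lift T" "defect_cochain P S (i 1) T \<Theta>"
    using obstruction_cochain_lift[OF \<Theta>] .
  show ?thesis
    unfolding extends_iff_exact[OF T] obstruction_map_eq[OF \<Theta> assms(7,8)]
      class_CP_eq_0_iff[OF obstruction_cocycle[OF \<Theta>]] ..
qed

end
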